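(* Let $q$ be an odd prime and let $m>1$ be an integer such that $n=(2mq)^2+1$ is square-free. Assume that the class number $h_n^+$ of $\mathbb{Q}(\zeta_n^+)$ is prime. If $\phi(n)/4$ and the class number of $\mathbb{Q}(\sqrt{n})$ are relatively prime, then $\mathbf{R}_{\mathbb{Q}(\zeta_n^+)/\mathbb{Q}}$ is non-trivial, i.e. $\mathbf{R}_{\mathbb{Q}(\zeta_n^+)/\mathbb{Q}}\neq\{1\}$.
   Context: Here $\mathbb{Q}(\zeta_n^+)$ denotes the maximal real subfield of the cyclotomic field $\mathbb{Q}(\zeta_n)$ ($\zeta_n$ a primitive $n$-th root of unity), $h_n^+$ its class number, and $\phi$ is Euler's totient function. For a Galois extension of number fields $L/K$, the residue degree of a prime ideal $\wp$ of $L$ above a prime $\mathfrak{p}$ of $K$ is $[\mathcal{O}_L/\wp:\mathcal{O}_K/\mathfrak{p}]$, and $$\mathbf{R}_{L/K}=\{f\in\mathbb{N}: \text{the class group of } L \text{ is generated by the classes of prime ideals of } L \text{ that are unramified over } K \text{ and have residue degree } f \text{ for } L/K\}.$$ One always has $1\in\mathbf{R}_{L/K}$; the set $\mathbf{R}_{L/K}$ is called trivial if it equals $\{1\}$ and non-trivial otherwise. *)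

theory Defs
  imports
    "HOL-Algebra.Algebra"
    "HOL-Algebra.Algebraic_Closure_Type"
    "HOL-Number_Theory.Totient"
    "HOL-Computational_Algebra.Squarefree"
begin

text \<open>
  Number fields are represented by their carriers, as subfields of the complex numbers.
\<close>

abbreviation CC :: "complex ring" where
  "CC \<equiv> ring_of_type_algebra"

definition ring_of_integers :: "complex set \<Rightarrow> complex ring" where
  "ring_of_integers K = CC\<lparr>carrier := {x \<in> K. algebraic_int x}\<rparr>"


subsection \<open>Ideal class groups\<close>

definition fractional_ideals :: "complex set \<Rightarrow> complex set set" where
  "fractional_ideals K =
     {(\<lambda>x. x / d) ` J | d J. d \<in> carrier (ring_of_integers K) \<and> d \<noteq> 0 \<and>
                           ideal J (ring_of_integers K) \<and> J \<noteq> {0}}"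

definition principal_fractional_ideals :: "complex set \<Rightarrow> complex set set" where
  "principal_fractional_ideals K =
     {(\<lambda>x. a * x) ` carrier (ring_of_integers K) | a. a \<in> K \<and> a \<noteq> 0}"

text \<open>
  \<^term>\<open>ideal_prod CC I J\<close> is the set of finite nonempty sums of products \<open>i * j\<close>, taken in the
  ambient field; hence it is also the product of fractional ideals.
\<close>

definition ideal_group :: "complex set \<Rightarrow> complex set monoid" where
  "ideal_group K =
     \<lparr>carrier = fractional_ideals K, monoid.mult = ideal_prod CC,
      one = carrier (ring_of_integers K)\<rparr>"

definition class_group :: "complex set \<Rightarrow> complex set set monoid" where
  "class_group K = ideal_group K Mod principal_fractional_ideals K"

definition ideal_class :: "complex set \<Rightarrow> complex set \<Rightarrow> complex set set" where
  "ideal_class K I = principal_fractional_ideals K #>\<^bsub>ideal_group K\<^esub> I"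

definition class_number :: "complex set \<Rightarrow> nat" where
  "class_number K = Coset.order (class_group K)"


subsection \<open>Primes in an extension of number fields\<close>

definition prime_ideals :: "complex set \<Rightarrow> complex set set" where
  "prime_ideals L = {P. primeideal P (ring_of_integers L) \<and> P \<noteq> {0}}"

text \<open>
  In the following, \<open>K \<subseteq> L\<close> are number fields and \<open>P\<close> is a nonzero prime ideal of the ring of
  integers of \<open>L\<close>; the prime of \<open>K\<close> below \<open>P\<close> is \<open>P \<inter> carrier (ring_of_integers K)\<close>.

  The residue field of that prime is identified with its canonical image in the residue field
  of \<open>P\<close>, that is, with the set of cosets of elements of the ring of integers of \<open>K\<close>.
\<close>

definition residue_degree :: "complex set \<Rightarrow> complex set \<Rightarrow> complex set \<Rightarrow> nat" where
  "residue_degree L K P =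
     (let R = ring_of_integers L; F = R Quot P
      in ring.dim F ((\<lambda>x. P +>\<^bsub>R\<^esub> x) ` carrier (ring_of_integers K)) (carrier F))"

text \<open>
  The exponent of \<open>P\<close> in the factorization of the ideal \<open>\<pp> O\<^sub>L\<close>, where \<open>\<pp>\<close> is the prime below
  \<open>P\<close>: the largest \<open>e\<close> such that \<open>P ^ e\<close> contains (that is, divides) \<open>\<pp> O\<^sub>L\<close>.
\<close>

definition ramification_index :: "complex set \<Rightarrow> complex set \<Rightarrow> complex set \<Rightarrow> nat" where
  "ramification_index L K P =
     (GREATEST e::nat. Idl\<^bsub>ring_of_integers L\<^esub> (P \<inter> carrier (ring_of_integers K))
                         \<subseteq> P [^]\<^bsub>ideal_group L\<^esub> e)"

text \<open>Residue field extensions are separable here, the residue fields being finite.\<close>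

definition unramified :: "complex set \<Rightarrow> complex set \<Rightarrow> complex set \<Rightarrow> bool" where
  "unramified L K P \<longleftrightarrow> ramification_index L K P = 1"

definition generating_residue_degrees :: "complex set \<Rightarrow> complex set \<Rightarrow> nat set" where
  "generating_residue_degrees L K =
     {f. f \<ge> 1 \<and>
         generate (class_group L)
           (ideal_class L ` {P \<in> prime_ideals L. unramified L K P \<and> residue_degree L K P = f})
         = carrier (class_group L)}"


subsection \<open>The fields in question\<close>

text \<open>
  The smallest subfield of the complex numbers containing a given set automatically contains
  the rationals.
\<close>

definition cyclotomic_field :: "nat \<Rightarrow> complex set" where
  "cyclotomic_field n = generate_field CC {cis (2 * pi / real n)}"

definition max_real_cyclotomic_field :: "nat \<Rightarrow> complex set" where
  "max_real_cyclotomic_field n = cyclotomic_field n \<inter> \<real>"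

definition real_quadratic_field :: "nat \<Rightarrow> complex set" where
  "real_quadratic_field d = generate_field CC {complex_of_real (sqrt (real d))}"

end

theory Submission
  imports Defs "Jordan_Normal_Form.Char_Poly" "HOL-Number_Theory.Residues"
begin

text \<open>
  Write \<open>K\<close> for the maximal real subfield of the \<open>n\<close>-th cyclotomic field and \<open>k\<close> for the real
  quadratic field generated by \<open>sqrt n\<close>, a subfield of \<open>K\<close> of relative degree \<open>d = \<phi>(n) / 4\<close>. The
  ideal \<open>Q\<close> of \<open>k\<close> generated by \<open>q\<close> and \<open>sqrt n - 1\<close> has norm \<open>q\<close>; it is not principal, because
  \<open>x\<^sup>2 - n y\<^sup>2 = 4 q\<close> and \<open>x\<^sup>2 - n y\<^sup>2 = - 4 q\<close> have no solutions when \<open>4 q\<close> is small compared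
  with \<open>sqrt n\<close>. As \<open>d\<close> is prime to the class number of \<open>k\<close>, taking norms from \<open>K\<close> to \<open>k\<close> shows that
  \<open>Q\<close> does not become principal in \<open>K\<close>. Hence some prime \<open>P\<close> of \<open>K\<close> above \<open>q\<close> is not principal, and
  its class generates the class group, whose order is prime. Since \<open>q\<close> does not divide \<open>n\<close>, \<open>P\<close> is
  unramified, and its residue degree is not \<open>1\<close> because \<open>q\<close> is neither \<open>1\<close> nor \<open>-1\<close> modulo \<open>n\<close>.
\<close>

section \<open>Algebraic integers\<close>

text \<open>Finiteness of the class groups is read off from \<open>class_number\<close> being
  nonzero, since an infinite carrier has cardinality 0: for K the class number is prime, and for k
  it cannot be 0, because only 1 is coprime to 0 while phi(n)/4 is at least 2. Finiteness in turn
  yields invertibility of ideals, by pigeonhole and Nakayama's lemma. A non-principal P above q is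
  found by dividing ideals by generators of principal primes: if all primes containing q were
  principal, so would be the extension of Q. Galois theory is carried out by hand with the maps z ->
  z^j on rational polynomial expressions in z, fixed elements being recognised by traces. In place
  of an integral basis, n times any algebraic integer of the cyclotomic field lies in Z[z], and n is
  invertible modulo q. Hence x -> x^(q^phi(n)) is the identity modulo q, the integers modulo q have
  no nilpotents, and q does not ramify. If P had residue degree 1, z^q + z^(-q) and z + z^(-1) would
  agree modulo P, but their difference divides n^2. The condition m > 1 gives 4 q < 2 t for t = 2 m
  q, the range in which the descent for x^2 - (t^2 + 1) y^2 works.\<close>

definition int_span :: "complex set \<Rightarrow> complex set" where
  "int_span V = {\<Sum>v\<in>V. of_int (c v) * v | c :: complex \<Rightarrow> int. True}"

lemma int_span_add: "x \<in> int_span V \<Longrightarrow> y \<in> int_span V \<Longrightarrow> x + y \<in> int_span V"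
proof -
  assume "x \<in> int_span V" "y \<in> int_span V"
  then obtain c d :: "complex \<Rightarrow> int" where "x = (\<Sum>v\<in>V. of_int (c v) * v)" "y = (\<Sum>v\<in>V. of_int (d v) * v)"
    unfolding int_span_def by blast
  then have "x + y = (\<Sum>v\<in>V. of_int (c v + d v) * v)"
    by (simp add: sum.distrib algebra_simps)
  then show ?thesis unfolding int_span_def by (auto intro!: exI[of _ "\<lambda>v. c v + d v"])
qed

lemma int_span_scale: "x \<in> int_span V \<Longrightarrow> of_int k * x \<in> int_span V"
proof -
  assume "x \<in> int_span V"
  then obtain c :: "complex \<Rightarrow> int" where "x = (\<Sum>v\<in>V. of_int (c v) * v)"
    unfolding int_span_def by blast
  then have "of_int k * x = (\<Sum>v\<in>V. of_int (k * c v) * v)"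
    by (simp add: sum_distrib_left algebra_simps)
  then show ?thesis unfolding int_span_def by (auto intro!: exI[of _ "\<lambda>v. k * c v"])
qed

lemma int_span_0: "0 \<in> int_span V"
  unfolding int_span_def by (auto intro!: exI[of _ "\<lambda>_. 0"])

lemma int_span_base:
  assumes "finite V" "v \<in> V" shows "v \<in> int_span V"
proof -
  have "(\<Sum>w\<in>V. of_int (if w = v then 1 else 0) * w) = (\<Sum>w\<in>V. if w = v then w else 0)"
    by (intro sum.cong) auto
  also have "\<dots> = v" using assms by simp
  finally show ?thesis unfolding int_span_def
    by (auto intro!: exI[of _ "\<lambda>w. if w = v then 1 else 0"])
qed

lemma int_span_sum:
  "(\<And>i. i \<in> I \<Longrightarrow> f i \<in> int_span V) \<Longrightarrow> sum f I \<in> int_span V"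
  by (induction I rule: infinite_finite_induct) (auto simp: int_span_0 int_span_add)

lemma int_span_mult_closed:
  assumes "\<And>v. v \<in> V \<Longrightarrow> s * v \<in> int_span V" "x \<in> int_span V"
  shows "s * x \<in> int_span V"
proof -
  obtain c :: "complex \<Rightarrow> int" where "x = (\<Sum>v\<in>V. of_int (c v) * v)"
    using assms(2) unfolding int_span_def by blast
  then have "s * x = (\<Sum>v\<in>V. of_int (c v) * (s * v))"
    by (simp add: sum_distrib_left algebra_simps)
  then show ?thesis using assms(1) by (auto intro!: int_span_sum int_span_scale)
qed

text \<open>Determinant trick: multiplication by \<open>s\<close> acts on the vector of elements of
  \<open>V\<close> through an integer matrix, so \<open>s\<close> is an eigenvalue and a root of a
  monic integral characteristic polynomial. The nonzero \<open>v0\<close> makes that vector a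
  genuine eigenvector.\<close>

lemma algebraic_int_if_stable_span:
  assumes "finite V" "v0 \<in> V" "v0 \<noteq> 0"
    and "\<And>v. v \<in> V \<Longrightarrow> s * v \<in> int_span V"
  shows "algebraic_int s"
proof -
  define N where "N = card V"
  obtain e where e: "bij_betw e {..<N} V"
    using assms(1) unfolding N_def by (metis atLeast0LessThan ex_bij_betw_nat_finite)
  have "\<forall>v\<in>V. \<exists>c::complex \<Rightarrow> int. s * v = (\<Sum>w\<in>V. of_int (c w) * w)"
    using assms(4) unfolding int_span_def by blast
  then obtain C :: "complex \<Rightarrow> complex \<Rightarrow> int"
    where C: "\<And>v. v \<in> V \<Longrightarrow> s * v = (\<Sum>w\<in>V. of_int (C v w) * w)"
    by metis
  define A :: "int mat" where "A = Matrix.mat N N (\<lambda>(i,j). C (e i) (e j))"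
  define A' :: "complex mat" where "A' = map_mat of_int A"
  define u :: "complex vec" where "u = Matrix.vec N e"
  have A: "A \<in> carrier_mat N N" and A': "A' \<in> carrier_mat N N"
    unfolding A_def A'_def by auto
  have "A' *\<^sub>v u = s \<cdot>\<^sub>v u"
  proof (rule eq_vecI)
    show "dim_vec (A' *\<^sub>v u) = dim_vec (s \<cdot>\<^sub>v u)" using A' by (simp add: u_def)
    fix i assume "i < dim_vec (s \<cdot>\<^sub>v u)"
    then have i: "i < N" by (simp add: u_def)
    have "(A' *\<^sub>v u) $ i = (\<Sum>j<N. of_int (C (e i) (e j)) * e j)"
      using i by (simp add: A'_def A_def u_def scalar_prod_def atLeast0LessThan)
    also have "\<dots> = (\<Sum>w\<in>V. of_int (C (e i) w) * w)"
      using e by (rule sum.reindex_bij_betw)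
    also have "\<dots> = s * e i" using C[of "e i"] e i by (auto simp: bij_betw_def)
    finally show "(A' *\<^sub>v u) $ i = (s \<cdot>\<^sub>v u) $ i" using i by (simp add: u_def)
  qed
  moreover have "u \<noteq> 0\<^sub>v N"
  proof
    assume u0: "u = 0\<^sub>v N"
    obtain i where "i < N" "e i = v0" using e assms(2) by (auto simp: bij_betw_def)
    then have "u $ i = v0" by (simp add: u_def)
    with u0 \<open>i < N\<close> assms(3) show False by simp
  qed
  moreover have "u \<in> carrier_vec N" by (simp add: u_def)
  ultimately have "eigenvector A' u s"
    unfolding eigenvector_def using A' by auto
  then have "poly (char_poly A') s = 0"
    using eigenvalue_root_char_poly[OF A'] unfolding eigenvalue_def by blast
  also have "char_poly A' = map_poly of_int (char_poly A)"
    unfolding A'_def by (rule of_int_hom.char_poly_hom[OF A])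
  finally have "poly (map_poly of_int (char_poly A)) s = 0" .
  then show ?thesis
    unfolding algebraic_int_altdef_ipoly
    using degree_monic_char_poly[OF A] by auto
qed

text \<open>The monic equation expresses \<open>x ^ N\<close> by lower powers, so multiplication by
  \<open>x\<close> preserves the span of the first \<open>N\<close> powers. Positivity of
  \<open>N\<close> puts 1 among the generators.\<close>

lemma int_span_powers:
  assumes "algebraic_int (x::complex)"
  obtains N where "N > 0" "\<And>i. x ^ i \<in> int_span ((^) x ` {..<N})"
proof -
  obtain p where p: "poly (map_poly of_int p) x = 0" "lead_coeff p = 1"
    using assms unfolding algebraic_int_altdef_ipoly by blast
  define N where "N = degree p"
  have "N > 0"
  proof (rule ccontr)
    assume "\<not> N > 0"
    then obtain c where "p = [:c:]" using degree_eq_zeroE N_def by (metis not_gr_zero)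
    with p show False by auto
  qed
  let ?V = "(^) x ` {..<N}"
  have "poly (map_poly of_int p) x = (\<Sum>i\<le>N. of_int (coeff p i) * x ^ i)"
    by (simp add: poly_altdef N_def)
  also have "\<dots> = (\<Sum>i<N. of_int (coeff p i) * x ^ i) + x ^ N"
    using p(2) by (simp add: N_def lessThan_Suc_atMost[symmetric])
  finally have xN: "x ^ N = (\<Sum>i<N. of_int (- coeff p i) * x ^ i)"
    using p(1) by (simp add: sum_negf algebra_simps eq_neg_iff_add_eq_0 add.commute)
  have base: "x ^ i \<in> int_span ?V" if "i < N" for i
    using that by (intro int_span_base) auto
  have N_in: "x ^ N \<in> int_span ?V"
    unfolding xN by (intro int_span_sum int_span_scale base) auto
  have step: "x * v \<in> int_span ?V" if v: "v \<in> ?V" for v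
  proof -
    obtain i where i: "i < N" "v = x ^ i" using v by auto
    then have "x * v = x ^ Suc i" by simp
    then show ?thesis using N_in base[of "Suc i"] i(1) by (cases "Suc i = N") auto
  qed
  have "x ^ i \<in> int_span ?V" for i
  proof (induction i)
    case 0 show ?case using base[of 0] \<open>N > 0\<close> by simp
  next
    case (Suc i) then show ?case using int_span_mult_closed[OF step Suc] by simp
  qed
  then show thesis using that \<open>N > 0\<close> by blast
qed

text \<open>The monomials \<open>x ^ i * y ^ j\<close> span a module stable under both numbers,
  hence under their sum and product; 1 serves as the nonzero generator.\<close>

lemma algebraic_int_common_span:
  assumes x: "algebraic_int (x::complex)" and y: "algebraic_int (y::complex)"
  obtains V where "finite V" "1 \<in> V"
    "\<And>v. v \<in> V \<Longrightarrow> x * v \<in> int_span V" "\<And>v. v \<in> V \<Longrightarrow> y * v \<in> int_span V"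
proof -
  obtain N where N: "N > 0" "\<And>i. x ^ i \<in> int_span ((^) x ` {..<N})"
    using int_span_powers[OF x] by blast
  obtain M where M: "M > 0" "\<And>i. y ^ i \<in> int_span ((^) y ` {..<M})"
    using int_span_powers[OF y] by blast
  define V where "V = (\<lambda>(i,j). x ^ i * y ^ j) ` ({..<N} \<times> {..<M})"
  have fin: "finite V" by (simp add: V_def)
  have prods: "a * b \<in> int_span V"
    if a: "a \<in> int_span ((^) x ` {..<N})" and b: "b \<in> int_span ((^) y ` {..<M})" for a b
  proof -
    obtain c d :: "complex \<Rightarrow> int" where
      "a = (\<Sum>v\<in>(^) x ` {..<N}. of_int (c v) * v)" "b = (\<Sum>v\<in>(^) y ` {..<M}. of_int (d v) * v)"
      using a b unfolding int_span_def by blast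
    then have "a * b = (\<Sum>v\<in>(^) x ` {..<N}. \<Sum>w\<in>(^) y ` {..<M}. of_int (c v * d w) * (v * w))"
      by (simp add: sum_product algebra_simps)
    also have "\<dots> \<in> int_span V"
      by (intro int_span_sum int_span_scale int_span_base fin) (auto simp: V_def)
    finally show ?thesis .
  qed
  have mon: "x ^ i * y ^ j \<in> int_span V" for i j using prods N(2) M(2) by blast
  show thesis
  proof (rule that[OF fin])
    show "1 \<in> V" unfolding V_def using N(1) M(1) by (force intro: image_eqI[of _ _ "(0,0)"])
    fix v assume "v \<in> V"
    then obtain i j where "v = x ^ i * y ^ j" by (auto simp: V_def)
    then have "x * v = x ^ Suc i * y ^ j" "y * v = x ^ i * y ^ Suc j" by simp_all
    then show "x * v \<in> int_span V" "y * v \<in> int_span V" using mon by metis+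
  qed
qed

lemma algebraic_int_add: "algebraic_int (x::complex) \<Longrightarrow> algebraic_int y \<Longrightarrow> algebraic_int (x + y)"
proof -
  assume "algebraic_int x" "algebraic_int y"
  then obtain V where V: "finite V" "1 \<in> V"
    "\<And>v. v \<in> V \<Longrightarrow> x * v \<in> int_span V" "\<And>v. v \<in> V \<Longrightarrow> y * v \<in> int_span V"
    using algebraic_int_common_span by blast
  show ?thesis
    by (rule algebraic_int_if_stable_span[OF V(1,2)]) (auto simp: distrib_right intro: int_span_add V)
qed

lemma algebraic_int_mult: "algebraic_int (x::complex) \<Longrightarrow> algebraic_int y \<Longrightarrow> algebraic_int (x * y)"
proof -
  assume "algebraic_int x" "algebraic_int y"
  then obtain V where V: "finite V" "1 \<in> V"
    "\<And>v. v \<in> V \<Longrightarrow> x * v \<in> int_span V" "\<And>v. v \<in> V \<Longrightarrow> y * v \<in> int_span V"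
    using algebraic_int_common_span by blast
  show ?thesis
    by (rule algebraic_int_if_stable_span[OF V(1,2)])
       (auto simp: mult.assoc intro: int_span_mult_closed V)
qed

lemma algebraic_int_of_int: "algebraic_int (of_int k :: complex)"
  by (rule int_imp_algebraic_int) simp

lemma algebraic_int_of_nat: "algebraic_int (of_nat k :: complex)"
  by (rule int_imp_algebraic_int) simp

lemma algebraic_int_1: "algebraic_int (1 :: complex)"
  by (rule int_imp_algebraic_int) simp

lemma algebraic_int_diff: "algebraic_int (x::complex) \<Longrightarrow> algebraic_int y \<Longrightarrow> algebraic_int (x - y)"
  using algebraic_int_add[of x "- y"] by simp

lemma algebraic_int_power: "algebraic_int (x::complex) \<Longrightarrow> algebraic_int (x ^ k)"
  by (induction k) (auto simp: algebraic_int_1 intro: algebraic_int_mult)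

lemma algebraic_int_sum: "(\<And>i. i \<in> I \<Longrightarrow> algebraic_int (f i :: complex)) \<Longrightarrow> algebraic_int (sum f I)"
  by (induction I rule: infinite_finite_induct) (auto intro: algebraic_int_add)

lemma algebraic_int_prod: "(\<And>i. i \<in> I \<Longrightarrow> algebraic_int (f i :: complex)) \<Longrightarrow> algebraic_int (prod f I)"
  by (induction I rule: infinite_finite_induct) (auto simp: algebraic_int_1 intro: algebraic_int_mult)

lemmas algebraic_int_intros =
  algebraic_int_add algebraic_int_mult algebraic_int_diff algebraic_int_power algebraic_int_of_int
  algebraic_int_of_nat algebraic_int_1 algebraic_int_0

lemma algebraic_int_rootof:
  assumes "algebraic_int ((x::complex) ^ k)" "k > 0" shows "algebraic_int x"
  by (rule algebraic_int_root[OF assms(1), of "monom 1 k"])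
     (use assms in \<open>auto simp: poly_monom degree_monom_eq\<close>)

lemma algebraic_int_of_int_quotient:
  assumes "algebraic_int (of_int a / of_int b :: complex)" "b \<noteq> 0" shows "b dvd a"
proof -
  have "of_int a / of_int b \<in> (\<rat> :: complex set)" by simp
  with assms(1) have "of_int a / of_int b \<in> (\<int> :: complex set)"
    using rational_algebraic_int_is_int by blast
  then obtain k where "of_int a / of_int b = (of_int k :: complex)" by (auto elim: Ints_cases)
  then have "of_int a = (of_int (k * b) :: complex)" using assms(2) by (simp add: field_simps)
  then have "a = k * b" using of_int_eq_iff by blast
  then show ?thesis by simp
qed

section \<open>Congruences modulo p in the ring of all algebraic integers\<close>

definition ai_cong :: "nat \<Rightarrow> complex \<Rightarrow> complex \<Rightarrow> bool" where
  "ai_cong p x y \<longleftrightarrow> algebraic_int ((x - y) / of_nat p)"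

lemma ai_cong_refl: "ai_cong p x x" by (simp add: ai_cong_def)

lemma ai_cong_sym: "ai_cong p x y \<Longrightarrow> ai_cong p y x"
  unfolding ai_cong_def by (metis algebraic_int_minus_iff minus_diff_eq minus_divide_left)

lemma ai_cong_trans: "ai_cong p x y \<Longrightarrow> ai_cong p y z \<Longrightarrow> ai_cong p x z"
  unfolding ai_cong_def using algebraic_int_add[of "(x - y)/of_nat p" "(y - z)/of_nat p"]
  by (simp add: diff_divide_distrib)

lemma ai_cong_add: "ai_cong p x y \<Longrightarrow> ai_cong p x' y' \<Longrightarrow> ai_cong p (x + x') (y + y')"
  unfolding ai_cong_def using algebraic_int_add[of "(x - y)/of_nat p" "(x' - y')/of_nat p"]
  by (simp add: diff_divide_distrib add_divide_distrib algebra_simps)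

lemma ai_cong_mult:
  assumes "ai_cong p x y" "ai_cong p x' y'" "algebraic_int x'" "algebraic_int y"
  shows "ai_cong p (x * x') (y * y')"
proof -
  have eq: "(x * x' - y * y') / of_nat p = (x - y) / of_nat p * x' + y * ((x' - y') / of_nat p)"
    by (simp add: diff_divide_distrib algebra_simps)
  show ?thesis using assms unfolding ai_cong_def eq by (intro algebraic_int_intros)
qed

lemma ai_cong_power:
  assumes "ai_cong p x y" "algebraic_int x" "algebraic_int y"
  shows "ai_cong p (x ^ k) (y ^ k)"
  by (induction k) (auto intro!: ai_cong_mult assms algebraic_int_power simp: ai_cong_refl)

lemma ai_cong_sum:
  "(\<And>i. i \<in> I \<Longrightarrow> ai_cong p (f i) (g i)) \<Longrightarrow> ai_cong p (sum f I) (sum g I)"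
  by (induction I rule: infinite_finite_induct) (auto intro: ai_cong_add ai_cong_refl)

text \<open>The inner binomial coefficients are divisible by \<open>p\<close>.\<close>

lemma ai_cong_frobenius_add:
  assumes p: "Factorial_Ring.prime p" and x: "algebraic_int x" and y: "algebraic_int y"
  shows "ai_cong p ((x + y) ^ p) (x ^ p + y ^ p)"
proof -
  have p0: "p > 1" using p by (rule prime_gt_1_nat)
  have "(x + y) ^ p = (\<Sum>k\<le>p. of_nat (p choose k) * x ^ k * y ^ (p - k))"
    by (rule binomial_ring)
  also have "{..p} = insert 0 (insert p {1..<p})" using p0 by auto
  also have "(\<Sum>k\<in>\<dots>. of_nat (p choose k) * x ^ k * y ^ (p - k)) =
     y ^ p + (x ^ p + (\<Sum>k\<in>{1..<p}. of_nat (p choose k) * x ^ k * y ^ (p - k)))"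
    using p0 by simp
  finally have eq: "((x + y) ^ p - (x ^ p + y ^ p)) / of_nat p =
      (\<Sum>k\<in>{1..<p}. of_nat (p choose k) * x ^ k * y ^ (p - k) / of_nat p)"
    by (simp add: sum_divide_distrib)
  have "algebraic_int (of_nat (p choose k) * x ^ k * y ^ (p - k) / of_nat p)" if "k \<in> {1..<p}" for k
  proof -
    have "p dvd p choose k" using that p by (intro dvd_choose_prime) auto
    then obtain c where "p choose k = p * c" by blast
    then have "of_nat (p choose k) * x ^ k * y ^ (p - k) / of_nat p = of_nat c * x ^ k * y ^ (p - k)"
      using p0 by simp
    then show ?thesis using x y by (auto intro!: algebraic_int_intros)
  qed
  then show ?thesis unfolding ai_cong_def eq by (rule algebraic_int_sum)
qed

lemma ai_cong_frobenius_sum: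
  assumes p: "Factorial_Ring.prime p" and "\<And>i. i \<in> I \<Longrightarrow> algebraic_int (f i)"
  shows "ai_cong p (sum f I ^ p) (\<Sum>i\<in>I. f i ^ p)"
  using assms(2)
proof (induction I rule: infinite_finite_induct)
  case (insert i I)
  have "ai_cong p ((f i + sum f I) ^ p) (f i ^ p + sum f I ^ p)"
    by (intro ai_cong_frobenius_add p algebraic_int_sum) (use insert in auto)
  moreover have "ai_cong p (f i ^ p + sum f I ^ p) (f i ^ p + (\<Sum>i\<in>I. f i ^ p))"
    by (intro ai_cong_add ai_cong_refl insert.IH) (use insert in auto)
  ultimately show ?case using insert by (auto intro: ai_cong_trans)
qed (use prime_gt_0_nat[OF p] in \<open>auto intro: ai_cong_refl simp: power_0_left\<close>)

lemma ai_cong_of_int: "int p dvd a - b \<Longrightarrow> ai_cong p (of_int a) (of_int b)"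
proof -
  assume "int p dvd a - b"
  then obtain c where "a - b = int p * c" by blast
  then have "of_int a - of_int b = (of_nat p * of_int c :: complex)"
    by (metis of_int_diff of_int_mult of_int_of_nat_eq)
  then show ?thesis unfolding ai_cong_def by (cases "p = 0") (auto intro: algebraic_int_intros)
qed

lemma fermat_int:
  assumes "Factorial_Ring.prime p" shows "int p dvd a ^ p - a"
proof -
  have "[nat (a mod int p) ^ p = nat (a mod int p)] (mod p)"
  proof (cases "p dvd nat (a mod int p)")
    case True
    then have "[nat (a mod int p) ^ p = 0] (mod p)" "[nat (a mod int p) = 0] (mod p)"
      using prime_gt_0_nat[OF assms] by (auto simp: cong_0_iff intro: dvd_power_same dvd_trans dvd_power)
    then show ?thesis using cong_sym cong_trans by blast
  next
    case False
    then have "[nat (a mod int p) ^ (p - 1) = 1] (mod p)" using fermat_theorem assms by blast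
    then have "[nat (a mod int p) ^ (p - 1) * nat (a mod int p) = 1 * nat (a mod int p)] (mod p)"
      by (rule cong_mult) simp
    then show ?thesis using prime_gt_0_nat[OF assms] by (metis mult_1 power_minus_mult)
  qed
  then have "[int (nat (a mod int p)) ^ p = int (nat (a mod int p))] (mod int p)"
    by (metis cong_int_iff of_nat_power)
  then have "[(a mod int p) ^ p = a mod int p] (mod int p)"
    using prime_gt_0_nat[OF assms] by simp
  then have "[a ^ p = a] (mod int p)"
    by (simp add: cong_def power_mod)
  then show ?thesis by (simp add: cong_iff_dvd_diff)
qed

text \<open>Iterated Frobenius. By Fermat the integer coefficients are fixed modulo
  \<open>p\<close>, so only the \<open>f i\<close> are raised to the power.\<close>

lemma ai_cong_frobenius_int_combination:
  assumes p: "Factorial_Ring.prime p" and "\<And>i. i \<in> I \<Longrightarrow> algebraic_int (f i)"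
  shows "ai_cong p ((\<Sum>i\<in>I. of_int (a i) * f i) ^ (p ^ k)) (\<Sum>i\<in>I. of_int (a i) * f i ^ (p ^ k))"
proof (induction k)
  case (Suc k)
  let ?g = "\<lambda>i. f i ^ (p ^ k)"
  have gi: "algebraic_int (?g i)" if "i \<in> I" for i using assms that by (auto intro: algebraic_int_intros)
  have "ai_cong p (((\<Sum>i\<in>I. of_int (a i) * f i) ^ (p ^ k)) ^ p) ((\<Sum>i\<in>I. of_int (a i) * ?g i) ^ p)"
    by (intro ai_cong_power Suc.IH algebraic_int_power algebraic_int_sum algebraic_int_mult
          algebraic_int_of_int) (use assms in auto)
  moreover have "ai_cong p ((\<Sum>i\<in>I. of_int (a i) * ?g i) ^ p) (\<Sum>i\<in>I. (of_int (a i) * ?g i) ^ p)"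
    by (intro ai_cong_frobenius_sum p) (auto intro!: algebraic_int_intros gi)
  moreover have "ai_cong p (\<Sum>i\<in>I. (of_int (a i) * ?g i) ^ p) (\<Sum>i\<in>I. of_int (a i) * ?g i ^ p)"
  proof (rule ai_cong_sum)
    fix i assume "i \<in> I"
    have "ai_cong p (of_int (a i ^ p)) (of_int (a i))" by (intro ai_cong_of_int fermat_int p)
    then show "ai_cong p ((of_int (a i) * ?g i) ^ p) (of_int (a i) * ?g i ^ p)"
      unfolding power_mult_distrib
      by (intro ai_cong_mult ai_cong_refl) (auto intro: algebraic_int_intros gi \<open>i \<in> I\<close>)
  qed
  ultimately have "ai_cong p (((\<Sum>i\<in>I. of_int (a i) * f i) ^ (p ^ k)) ^ p) (\<Sum>i\<in>I. of_int (a i) * ?g i ^ p)"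
    by (meson ai_cong_trans)
  then show ?case by (simp add: power_mult[symmetric] mult.commute)
qed (simp add: ai_cong_refl)

section \<open>Conjugates of roots of unity\<close>

lemma algebraic_int_coeff_prod:
  fixes f :: "'i \<Rightarrow> complex poly"
  assumes "\<And>a k. a \<in> I \<Longrightarrow> algebraic_int (coeff (f a) k)"
  shows "algebraic_int (coeff (prod f I) k)"
proof -
  have mult: "algebraic_int (coeff (p * q) k)"
    if "\<And>k. algebraic_int (coeff p k)" "\<And>k. algebraic_int (coeff q k)" for p q :: "complex poly" and k
    unfolding coeff_mult by (intro algebraic_int_sum algebraic_int_mult that)
  have one: "algebraic_int (coeff (1 :: complex poly) k)" for k
    by (auto intro: algebraic_int_1 simp: coeff_1)
  show ?thesis using assms
  proof (induction I arbitrary: k rule: infinite_finite_induct)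
    case (insert a I)
    then show ?case using mult[of "f a" "prod f I"] by simp
  qed (use one in auto)
qed

text \<open>Up to sign the coefficients are elementary symmetric functions of the roots, obtained
  here by expanding the product of linear factors.\<close>

lemma algebraic_int_coeff_monic:
  fixes p :: "complex poly"
  assumes "lead_coeff p = 1" "\<And>x. poly p x = 0 \<Longrightarrow> algebraic_int x"
  shows "algebraic_int (coeff p k)"
proof -
  have "p = (\<Prod>z | poly p z = 0. [:-z, 1:] ^ order z p)"
    using complex_poly_decompose[of p] assms(1) by simp
  also have "\<dots> = (\<Prod>z\<in>{z. poly p z = 0}. prod (\<lambda>i. [:-z, 1:]) {..<order z p})" by simp
  also have "algebraic_int (coeff \<dots> k)"
  proof (intro algebraic_int_coeff_prod)
    fix z k assume "z \<in> {z. poly p z = 0}"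
    then have "algebraic_int z" using assms(2) by auto
    then show "algebraic_int (coeff [:-z, 1:] k)"
      by (auto simp: coeff_pCons algebraic_int_1 split: nat.splits)
  qed
  finally show ?thesis .
qed

section \<open>Rational polynomials evaluated at complex numbers\<close>

definition qpoly :: "rat poly \<Rightarrow> complex \<Rightarrow> complex" where
  "qpoly f x = poly (map_poly of_rat f) x"

interpretation qh: map_poly_inj_idom_hom "of_rat :: rat \<Rightarrow> complex" ..

lemma qpoly_add: "qpoly (f + g) x = qpoly f x + qpoly g x"
  by (simp add: qpoly_def qh.hom_add)

lemma qpoly_diff: "qpoly (f - g) x = qpoly f x - qpoly g x"
  by (simp add: qpoly_def qh.hom_minus)

lemma qpoly_minus: "qpoly (- f) x = - qpoly f x"
  by (simp add: qpoly_def qh.hom_uminus)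

lemma qpoly_mult: "qpoly (f * g) x = qpoly f x * qpoly g x"
  by (simp add: qpoly_def qh.hom_mult)

lemma qpoly_const: "qpoly [:c:] x = of_rat c"
  by (simp add: qpoly_def of_rat_hom.map_poly_pCons_hom)

lemma qpoly_1: "qpoly 1 x = 1" by (simp add: qpoly_def)

lemma qpoly_monom: "qpoly (monom c k) x = of_rat c * x ^ k"
  by (simp add: qpoly_def poly_monom)

lemma qpoly_altdef: "qpoly f x = (\<Sum>i\<le>degree f. of_rat (coeff f i) * x ^ i)"
  by (simp add: qpoly_def poly_altdef)

lemma qpoly_pcompose: "qpoly (pcompose f g) x = qpoly f (qpoly g x)"
proof -
  have "map_poly of_rat (pcompose f g) = pcompose (map_poly of_rat f) (map_poly (of_rat :: rat \<Rightarrow> complex) g)"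
    by (rule of_rat_hom.map_poly_pcompose)
  then show ?thesis by (simp add: qpoly_def poly_pcompose)
qed

lemma algebraic_int_qpoly:
  assumes "\<And>i. coeff f i \<in> \<int>" "algebraic_int x" shows "algebraic_int (qpoly f x)"
  unfolding qpoly_altdef
proof (intro algebraic_int_sum algebraic_int_mult algebraic_int_power assms(2))
  fix i
  obtain k where "coeff f i = of_int k" using assms(1)[of i] by (auto elim: Ints_cases)
  then show "algebraic_int (of_rat (coeff f i) :: complex)" by (simp add: algebraic_int_of_int)
qed

text \<open>A case of Gauss's lemma: all roots of \<open>g\<close> are roots of unity, so its
  coefficients are algebraic integers, and rational algebraic integers are integers.\<close>

lemma monic_divisor_unity_poly_Ints:
  fixes g :: "rat poly"
  assumes "g dvd monom 1 n - 1" "lead_coeff g = 1" "n > 0"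
  shows "coeff g i \<in> \<int>"
proof -
  have "algebraic_int (coeff (map_poly (of_rat :: rat \<Rightarrow> complex) g) i)"
  proof (rule algebraic_int_coeff_monic)
    show "lead_coeff (map_poly (of_rat :: rat \<Rightarrow> complex) g) = 1" using assms(2) by simp
    fix x :: complex assume "poly (map_poly of_rat g) x = 0"
    then have "qpoly g x = 0" by (simp add: qpoly_def)
    then have "qpoly (monom 1 n - 1) x = 0" using assms(1) by (auto elim!: dvdE simp: qpoly_mult)
    then have "x ^ n = 1" by (simp add: qpoly_diff qpoly_monom qpoly_1)
    then show "algebraic_int x" using algebraic_int_rootof[of x n] assms(3) algebraic_int_1 by simp
  qed
  then have "algebraic_int (of_rat (coeff g i) :: complex)" by simp
  then have "of_rat (coeff g i) \<in> (\<int> :: complex set)"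
    by (rule rational_algebraic_int_is_int) simp
  then obtain k where "of_rat (coeff g i) = (of_int k :: complex)" by (auto elim: Ints_cases)
  then have "of_rat (coeff g i) = (of_rat (of_int k) :: complex)" by simp
  then have "coeff g i = of_int k" by (simp only: of_rat_eq_iff)
  then show ?thesis by simp
qed

text \<open>The annihilating polynomials form an ideal of the Euclidean ring of rational
  polynomials; an element of least degree generates it and is then made monic. \<open>f0\<close>
  ensures that the ideal is nonzero.\<close>

lemma minimal_annihilator:
  assumes "qpoly f0 x = 0" "f0 \<noteq> 0"
  obtains g :: "rat poly" where "lead_coeff g = 1" "qpoly g x = 0" "\<And>f. qpoly f x = 0 \<Longrightarrow> g dvd f"
proof -
  define P where "P = (\<lambda>g :: rat poly. qpoly g x = 0 \<and> g \<noteq> 0)"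
  have "\<exists>g. P g \<and> (\<forall>f. P f \<longrightarrow> degree g \<le> degree f)"
    by (rule ex_has_least_nat[of P f0 degree]) (use assms in \<open>simp add: P_def\<close>)
  then obtain g where g: "P g" "\<And>f. P f \<Longrightarrow> degree g \<le> degree f" by blast
  have g0: "g \<noteq> 0" "qpoly g x = 0" using g(1) by (auto simp: P_def)
  define g' where "g' = smult (inverse (lead_coeff g)) g"
  have dv: "g' dvd f" if f: "qpoly f x = 0" for f
  proof -
    have "f = g * (f div g) + f mod g" by simp
    then have "qpoly f x = qpoly g x * qpoly (f div g) x + qpoly (f mod g) x"
      by (metis qpoly_add qpoly_mult)
    with f g0 have "qpoly (f mod g) x = 0" by simp
    moreover have "f mod g = 0 \<or> degree (f mod g) < degree g"
      using degree_mod_less[OF g0(1)] by blast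
    ultimately have "f mod g = 0" using g(2)[of "f mod g"] unfolding P_def by linarith
    then have "g dvd f" by (rule mod_0_imp_dvd)
    then show ?thesis unfolding g'_def using g0 by (simp add: smult_dvd_iff)
  qed
  have "lead_coeff g' = 1" using g0 by (simp add: g'_def)
  moreover have "qpoly g' x = 0"
  proof -
    have "g' = [:inverse (lead_coeff g):] * g" by (simp add: g'_def)
    then show ?thesis using g0 by (simp only: qpoly_mult mult_zero_right)
  qed
  ultimately show thesis using dv that by blast
qed

text \<open>
  If the minimal polynomial \<open>g\<close> of \<open>x\<close> did not vanish at \<open>y = x ^ p\<close>, differentiating
  \<open>X ^ n - 1 = g * h\<close> would show that \<open>g(y)\<close> divides \<open>n\<close>, while \<open>g(y)\<close> is congruent to
  \<open>g(x) ^ p = 0\<close> modulo \<open>p\<close>.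
\<close>

lemma unity_root_conjugate_prime:
  assumes x: "x ^ n = 1" and n: "n > 0" and p: "Factorial_Ring.prime p" "\<not> p dvd n" and f: "qpoly f x = 0"
  shows "qpoly f (x ^ p) = 0"
proof -
  let ?X = "monom 1 n - 1 :: rat poly"
  have X0: "?X \<noteq> 0"
  proof
    assume "?X = 0"
    then have "coeff ?X n = 0" by simp
    then show False using n by (simp add: coeff_1)
  qed
  have lcX: "lead_coeff ?X = 1" and degX: "degree ?X = n"
  proof -
    have "degree (1 :: rat poly) < degree (monom (1::rat) n)" using n by (simp add: degree_monom_eq)
    then have "degree (monom (1::rat) n + (- 1)) = degree (monom (1::rat) n)"
      by (intro degree_add_eq_left) simp
    then show d: "degree ?X = n" by (simp add: degree_monom_eq)
    show "lead_coeff ?X = 1" using n unfolding d by (simp add: coeff_1)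
  qed
  have Xx: "qpoly ?X x = 0" using x by (simp add: qpoly_diff qpoly_monom qpoly_1)
  obtain g where g: "lead_coeff g = 1" "qpoly g x = 0" "\<And>f. qpoly f x = 0 \<Longrightarrow> g dvd f"
    using minimal_annihilator[OF Xx X0] by blast
  obtain h where h: "?X = g * h" using g(3)[OF Xx] by blast
  have "lead_coeff h = 1" using lcX g(1) unfolding h by (simp add: lead_coeff_mult)
  have gI: "coeff g i \<in> \<int>" for i using h g(1) n by (intro monic_divisor_unity_poly_Ints[of g n]) auto
  have hI: "coeff h i \<in> \<int>" for i using h \<open>lead_coeff h = 1\<close> n by (intro monic_divisor_unity_poly_Ints[of h n]) auto
  define y where "y = x ^ p"
  have xA: "algebraic_int x" using algebraic_int_rootof[of x n] x n algebraic_int_1 by simp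
  have yA: "algebraic_int y" unfolding y_def by (intro algebraic_int_power xA)
  have yn: "y ^ n = 1" unfolding y_def by (metis x power_mult mult.commute power_one)
  have "qpoly g y = 0"
  proof (rule ccontr)
    assume gy: "qpoly g y \<noteq> 0"
    have "qpoly ?X y = 0" using yn by (simp add: qpoly_diff qpoly_monom qpoly_1)
    then have hy: "qpoly h y = 0" using gy unfolding h by (simp add: qpoly_mult)
    have "qpoly (pderiv ?X) y = qpoly g y * qpoly (pderiv h) y"
      unfolding h pderiv_mult using hy by (simp add: qpoly_add qpoly_mult)
    then have D: "of_nat n * y ^ (n - 1) = qpoly g y * qpoly (pderiv h) y"
      by (simp add: pderiv_diff pderiv_monom qpoly_monom)
    define c :: "nat \<Rightarrow> int" where "c i = \<lfloor>coeff g i\<rfloor>" for i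
    have c: "coeff g i = of_int (c i)" for i unfolding c_def using gI[of i] by (auto elim!: Ints_cases)
    have gev: "qpoly g w = (\<Sum>i\<le>degree g. of_int (c i) * w ^ i)" for w
      by (simp add: qpoly_altdef c)
    have "ai_cong p (qpoly g x ^ (p ^ 1)) (\<Sum>i\<le>degree g. of_int (c i) * (x ^ i) ^ (p ^ 1))"
      unfolding gev by (intro ai_cong_frobenius_int_combination p(1)) (auto intro: algebraic_int_power xA)
    also have "(\<Sum>i\<le>degree g. of_int (c i) * (x ^ i) ^ (p ^ 1)) = qpoly g y"
      unfolding gev y_def by (simp add: power_mult[symmetric] mult.commute)
    finally have "ai_cong p 0 (qpoly g y)" using g(2) prime_gt_0_nat[OF p(1)] by (simp add: power_0_left)
    then have "ai_cong p (qpoly g y) 0" by (rule ai_cong_sym)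
    then have A1: "algebraic_int (qpoly g y / of_nat p)" by (simp add: ai_cong_def)
    have A2: "algebraic_int (qpoly (pderiv h) y)"
      by (intro algebraic_int_qpoly yA) (simp add: coeff_pderiv hI)
    have "y ^ (n - 1) * y = 1" using yn power_minus_mult[OF n, of y] by simp
    then have "of_int (int n) / of_int (int p) = (of_nat n * y ^ (n - 1)) * y / of_nat p" by (simp add: mult.assoc)
    also have "\<dots> = (qpoly g y / of_nat p) * qpoly (pderiv h) y * y" unfolding D by simp
    finally have eq: "of_int (int n) / of_int (int p) = (qpoly g y / of_nat p) * qpoly (pderiv h) y * y" .
    have "algebraic_int (of_int (int n) / of_int (int p) :: complex)"
      unfolding eq by (intro algebraic_int_mult A1 A2 yA)
    then have "int p dvd int n"
      by (rule algebraic_int_of_int_quotient) (use prime_gt_0_nat[OF p(1)] in simp)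
    then show False using p(2) by (simp only: int_dvd_int_iff)
  qed
  then show ?thesis using g(3)[OF f] unfolding y_def by (auto elim!: dvdE simp: qpoly_mult)
qed

text \<open>Induction over the prime factors of \<open>j\<close>, each step replacing
  \<open>x\<close> by \<open>x ^ p\<close>, again an \<open>n\<close>-th root of unity; hence
  \<open>x\<close> is left arbitrary. This is the irreducibility of the cyclotomic polynomial in the
  form used below: every rational relation for a primitive root also holds for its
  conjugates.\<close>

lemma unity_root_conjugate:
  assumes "x ^ n = 1" "n > 0" "coprime j n" "qpoly f x = 0"
  shows "qpoly f (x ^ j) = 0"
  using assms(1,3,4)
proof (induction j arbitrary: x rule: prime_divisors_induct)
  case zero
  \<comment> \<open>\<open>coprime 0 n\<close> forces \<open>n = 1\<close>, so \<open>x = 1\<close>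
    and \<open>x ^ 0 = x\<close>.\<close>
  then have "n = 1" by simp
  with zero show ?case by simp
next
  case (unit j)
  then show ?case by simp
next
  case (factor p j)
  have "\<not> p dvd n"
  proof
    assume "p dvd n"
    then have "is_unit p" using coprime_common_divisor[OF factor.prems(2)] by simp
    then show False using not_prime_unit factor.hyps(1) by blast
  qed
  then have "qpoly f (x ^ p) = 0"
    using unity_root_conjugate_prime[OF factor.prems(1) assms(2) factor.hyps(1)] factor.prems by blast
  moreover have "(x ^ p) ^ n = 1" using factor.prems(1) by (metis power_mult mult.commute power_one)
  ultimately show ?case using factor.IH[of "x ^ p"] factor.prems(2) by (simp add: power_mult)
qed

section \<open>Cyclotomic fields\<close>

locale cyclotomic =
  fixes n :: nat
  assumes n_gt_1: "n > 1"
begin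

definition z :: complex where "z = cis (2 * pi / real n)"

definition QZ :: "complex set" where "QZ = range (\<lambda>f. qpoly f z)"

lemma z_power: "z ^ k = cis (2 * pi * real k / real n)"
  by (simp add: z_def DeMoivre mult.commute)

lemma z_n: "z ^ n = 1"
  using n_gt_1 by (simp add: z_power)

lemma z_mod: "z ^ (k mod n) = z ^ k"
proof -
  have "z ^ k = z ^ (n * (k div n) + k mod n)" by simp
  also have "\<dots> = z ^ (k mod n)" by (simp only: power_add power_mult z_n power_one mult_1)
  finally show ?thesis ..
qed

lemma z_bij: "bij_betw ((^) z) {..<n} {w. w ^ n = 1}"
  using bij_betw_roots_unity[of n] n_gt_1 by (simp add: z_power cong: bij_betw_cong)

lemma z_inj: "a < n \<Longrightarrow> b < n \<Longrightarrow> z ^ a = z ^ b \<Longrightarrow> a = b"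
  using z_bij by (auto simp: bij_betw_def inj_on_def)

lemma z_eq_iff: "z ^ a = z ^ b \<longleftrightarrow> [a = b] (mod n)"
  using z_inj[of "a mod n" "b mod n"] n_gt_1 by (auto simp: cong_def z_mod) (metis z_mod)

lemma z_eq_1_iff: "z ^ a = 1 \<longleftrightarrow> n dvd a"
  using z_eq_iff[of a 0] by (simp add: cong_0_iff)

lemma z_nz [simp]: "z \<noteq> 0" by (simp add: z_def)

lemma cnj_z: "cnj z = inverse z" by (simp add: z_def cis_cnj)

lemma z_inverse: "k \<le> n \<Longrightarrow> inverse (z ^ k) = z ^ (n - k)"
  using z_n by (simp add: power_diff inverse_eq_divide)

lemma z_AI: "algebraic_int z"
  using algebraic_int_rootof[of z n] z_n algebraic_int_1 n_gt_1 by simp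

text \<open>Both sides have degree at most \<open>n\<close> and the same coefficient at
  \<open>n\<close>, and they agree at \<open>n\<close> distinct points.\<close>

lemma unity_poly: "monom 1 n - 1 = (\<Prod>k<n. [:- (z ^ k), 1:])"
proof (rule poly_eqI_degree_lead_coeff[where n = n and A = "(^) z ` {..<n}"])
  have card: "card ((^) z ` {..<n}) = n"
    using card_image[of "(^) z" "{..<n}"] z_bij by (simp add: bij_betw_def)
  then show "n \<le> card ((^) z ` {..<n})" by simp
  have dp: "degree (\<Prod>k<n. [:- (z ^ k), 1:]) = n"
    by (subst degree_prod_eq_sum_degree) auto
  then show "degree (\<Prod>k<n. [:- (z ^ k), 1:]) \<le> n" by simp
  show "degree (monom (1::complex) n - 1) \<le> n"
    by (rule degree_diff_le) (auto simp: degree_monom_le)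
  have "coeff (\<Prod>k<n. [:- (z ^ k), 1:]) n = lead_coeff (\<Prod>k<n. [:- (z ^ k), 1:])" by (simp only: dp)
  also have "\<dots> = 1" by (simp add: lead_coeff_prod)
  finally show "coeff (monom 1 n - 1) n = coeff (\<Prod>k<n. [:- (z ^ k), 1:]) n"
    using n_gt_1 by (simp add: coeff_1)
  fix w assume "w \<in> (^) z ` {..<n}"
  then obtain k where k: "k < n" "w = z ^ k" by auto
  have "w ^ n = 1" using k z_n by (metis power_mult mult.commute power_one)
  moreover have "(\<Prod>l<n. w - z ^ l) = 0"
    using k by (intro prod_zero) auto
  ultimately show "poly (monom 1 n - 1) w = poly (\<Prod>k<n. [:- (z ^ k), 1:]) w"
    by (simp add: poly_monom poly_prod)
qed

text \<open>The value at 1 of \<open>(X ^ n - 1) / (X - 1)\<close>, computed once from the sum of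
  powers and once from the linear factors.\<close>

lemma prod_one_minus_z: "(\<Prod>k\<in>{1..<n}. 1 - z ^ k) = of_nat n"
proof -
  have "[:-1, 1:] * (\<Sum>i<n. monom 1 i) = (monom 1 n - 1 :: complex poly)"
  proof -
    have "monom (1::complex) 1 = [:0, 1:]" by (simp add: monom_Suc monom_0)
    then have m: "monom (1::complex) i = [:0,1:] ^ i" for i
      by (metis monom_power mult_1 power_one)
    have "([:0,1:] :: complex poly) ^ n - 1 = ([:0,1:] - 1) * (\<Sum>i<n. [:0,1:] ^ i)"
      by (rule power_diff_1_eq)
    moreover have "[:0,1:] - 1 = ([:-1,1:] :: complex poly)" by (simp add: one_pCons)
    ultimately show ?thesis by (simp only: m)
  qed
  also have "\<dots> = [:-1, 1:] * (\<Prod>k\<in>{1..<n}. [:- (z ^ k), 1:])"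
  proof -
    have "{..<n} = insert 0 {1..<n}" using n_gt_1 by auto
    then show ?thesis unfolding unity_poly by (simp del: mult_pCons_left)
  qed
  finally have "(\<Sum>i<n. monom 1 i) = (\<Prod>k\<in>{1..<n}. [:- (z ^ k), 1:])"
    by (subst (asm) mult_left_cancel) auto
  then have "poly (\<Sum>i<n. monom 1 i) 1 = poly (\<Prod>k\<in>{1..<n}. [:- (z ^ k), 1:]) 1" by simp
  then show ?thesis by (simp add: poly_sum poly_monom poly_prod)
qed

text \<open>The quotient is the product of the remaining factors in \<open>prod_one_minus_z\<close>.
  It limits the primes dividing differences of roots of unity to those above divisors of
  \<open>n\<close>.\<close>

lemma one_minus_z_dvd:
  assumes "\<not> n dvd a" shows "algebraic_int (of_nat n / (1 - z ^ a))"
proof -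
  define k where "k = a mod n"
  have k: "k \<in> {1..<n}" using assms n_gt_1 unfolding k_def
    by (simp add: Suc_le_eq) (metis mod_0_imp_dvd gr0I)
  have "of_nat n = (1 - z ^ k) * (\<Prod>l\<in>{1..<n} - {k}. 1 - z ^ l)"
    unfolding prod_one_minus_z[symmetric] using k by (intro prod.remove) auto
  moreover have "1 - z ^ k \<noteq> 0" using k z_eq_1_iff[of k] by (auto dest: dvd_imp_le)
  ultimately have "of_nat n / (1 - z ^ k) = (\<Prod>l\<in>{1..<n} - {k}. 1 - z ^ l)"
    by (simp add: field_simps)
  moreover have "algebraic_int (\<Prod>l\<in>{1..<n} - {k}. 1 - z ^ l)"
    by (intro algebraic_int_prod algebraic_int_intros z_AI)
  ultimately show ?thesis by (simp add: k_def z_mod)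
qed

text \<open>The automorphism sending \<open>z\<close> to \<open>z ^ j\<close>, defined through an
  arbitrary polynomial expression in \<open>z\<close>. It is meaningful for \<open>j\<close> coprime
  to \<open>n\<close> and arguments in \<open>QZ\<close>; exponents are natural numbers, so
  \<open>n - 1\<close> stands for -1.\<close>

definition conj_map :: "nat \<Rightarrow> complex \<Rightarrow> complex" where
  "conj_map j x = qpoly (SOME f. qpoly f z = x) (z ^ j)"

lemma QZ_qpoly: "qpoly f z \<in> QZ" by (simp add: QZ_def)

text \<open>Independence of the chosen polynomial: two choices differ by a polynomial vanishing at
  \<open>z\<close>, hence at \<open>z ^ j\<close>.\<close>

lemma conj_qpoly:
  assumes "coprime j n" shows "conj_map j (qpoly f z) = qpoly f (z ^ j)"
proof -
  define g where "g = (SOME g. qpoly g z = qpoly f z)"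
  have "qpoly g z = qpoly f z" unfolding g_def by (rule someI[of _ f]) simp
  then have "qpoly (g - f) z = 0" by (simp add: qpoly_diff)
  then have "qpoly (g - f) (z ^ j) = 0"
    using unity_root_conjugate[OF z_n _ assms] n_gt_1 by simp
  then show ?thesis by (simp add: conj_map_def g_def qpoly_diff)
qed

lemma QZ_add: "x \<in> QZ \<Longrightarrow> y \<in> QZ \<Longrightarrow> x + y \<in> QZ"
  unfolding QZ_def by (auto simp: qpoly_add[symmetric])
lemma QZ_diff: "x \<in> QZ \<Longrightarrow> y \<in> QZ \<Longrightarrow> x - y \<in> QZ"
  unfolding QZ_def by (auto simp: qpoly_diff[symmetric])
lemma QZ_mult: "x \<in> QZ \<Longrightarrow> y \<in> QZ \<Longrightarrow> x * y \<in> QZ"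
  unfolding QZ_def by (auto simp: qpoly_mult[symmetric])
lemma QZ_minus: "x \<in> QZ \<Longrightarrow> - x \<in> QZ"
  unfolding QZ_def by (auto simp: qpoly_minus[symmetric])
lemma QZ_of_rat: "of_rat r \<in> QZ"
  unfolding QZ_def by (auto simp: qpoly_const[symmetric, of _ z])
lemma QZ_Rats: "x \<in> \<rat> \<Longrightarrow> x \<in> QZ"
  by (metis QZ_of_rat Rats_cases)
lemma QZ_of_int: "of_int k \<in> QZ" by (rule QZ_Rats) simp
lemma QZ_of_nat: "of_nat k \<in> QZ" by (rule QZ_Rats) simp
lemma QZ_0: "0 \<in> QZ" by (rule QZ_Rats) simp
lemma QZ_1: "1 \<in> QZ" by (rule QZ_Rats) simp
lemma QZ_z: "z \<in> QZ" using QZ_qpoly[of "monom 1 1"] by (simp add: qpoly_monom)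
lemma QZ_power: "x \<in> QZ \<Longrightarrow> x ^ k \<in> QZ"
  by (induction k) (auto simp: QZ_1 QZ_mult)
lemma QZ_sum: "(\<And>i. i \<in> I \<Longrightarrow> f i \<in> QZ) \<Longrightarrow> sum f I \<in> QZ"
  by (induction I rule: infinite_finite_induct) (auto simp: QZ_0 QZ_add)
lemma QZ_prod: "(\<And>i. i \<in> I \<Longrightarrow> f i \<in> QZ) \<Longrightarrow> prod f I \<in> QZ"
  by (induction I rule: infinite_finite_induct) (auto simp: QZ_1 QZ_mult)

lemmas QZ_intros = QZ_add QZ_diff QZ_mult QZ_minus QZ_of_rat QZ_of_int QZ_of_nat QZ_0 QZ_1 QZ_z
  QZ_power

context
  fixes j :: nat
  assumes j: "coprime j n"
begin

lemma conj_add: "x \<in> QZ \<Longrightarrow> y \<in> QZ \<Longrightarrow> conj_map j (x + y) = conj_map j x + conj_map j y"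
  unfolding QZ_def by (auto simp: qpoly_add[symmetric] conj_qpoly[OF j])

lemma conj_diff: "x \<in> QZ \<Longrightarrow> y \<in> QZ \<Longrightarrow> conj_map j (x - y) = conj_map j x - conj_map j y"
  unfolding QZ_def by (auto simp: qpoly_diff[symmetric] conj_qpoly[OF j])

lemma conj_mult: "x \<in> QZ \<Longrightarrow> y \<in> QZ \<Longrightarrow> conj_map j (x * y) = conj_map j x * conj_map j y"
  unfolding QZ_def by (auto simp: qpoly_mult[symmetric] conj_qpoly[OF j])

lemma conj_Rats: "x \<in> \<rat> \<Longrightarrow> conj_map j x = x"
proof -
  assume "x \<in> \<rat>"
  then obtain r where "x = of_rat r" by (auto elim: Rats_cases)
  then show ?thesis using conj_qpoly[OF j, of "[:r:]"] by (simp add: qpoly_const)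
qed

lemma conj_0: "conj_map j 0 = 0" and conj_1: "conj_map j 1 = 1"
  and conj_of_int: "conj_map j (of_int k) = of_int k"
  and conj_of_nat: "conj_map j (of_nat l) = of_nat l"
  by (intro conj_Rats, simp)+

lemma conj_minus: "x \<in> QZ \<Longrightarrow> conj_map j (- x) = - conj_map j x"
  using conj_diff[OF QZ_0, of x] by (simp add: conj_0)

lemma conj_power: "x \<in> QZ \<Longrightarrow> conj_map j (x ^ k) = conj_map j x ^ k"
  by (induction k) (auto simp: conj_1 conj_mult QZ_power)

lemma conj_sum: "(\<And>i. i \<in> I \<Longrightarrow> f i \<in> QZ) \<Longrightarrow> conj_map j (sum f I) = (\<Sum>i\<in>I. conj_map j (f i))"
  by (induction I rule: infinite_finite_induct) (auto simp: conj_0 conj_add QZ_sum)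

lemma conj_prod: "(\<And>i. i \<in> I \<Longrightarrow> f i \<in> QZ) \<Longrightarrow> conj_map j (prod f I) = (\<Prod>i\<in>I. conj_map j (f i))"
  by (induction I rule: infinite_finite_induct) (auto simp: conj_1 conj_mult QZ_prod)

lemma conj_z: "conj_map j (z ^ k) = z ^ (j * k)"
  using conj_qpoly[OF j, of "monom 1 k"] by (simp add: qpoly_monom power_mult)

lemma conj_in_QZ: assumes "x \<in> QZ" shows "conj_map j x \<in> QZ"
proof -
  obtain f where "x = qpoly f z" using assms by (auto simp: QZ_def)
  then have "conj_map j x = qpoly (pcompose f (monom 1 j)) z"
    by (simp add: conj_qpoly[OF j] qpoly_pcompose qpoly_monom)
  then show ?thesis by (simp add: QZ_qpoly)
qed

text \<open>The automorphism fixes integers, so the image satisfies the same monic equation.\<close>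

lemma conj_AI: assumes "x \<in> QZ" "algebraic_int x" shows "algebraic_int (conj_map j x)"
proof -
  obtain p where p: "poly (map_poly of_int p) x = 0" "lead_coeff p = 1"
    using assms(2) unfolding algebraic_int_altdef_ipoly by blast
  have "poly (map_poly of_int p) (conj_map j x) = (\<Sum>i\<le>degree p. of_int (coeff p i) * conj_map j x ^ i)"
    by (simp add: poly_altdef)
  also have "\<dots> = conj_map j (\<Sum>i\<le>degree p. of_int (coeff p i) * x ^ i)"
    using assms(1) by (simp add: conj_sum conj_mult conj_power conj_of_int QZ_intros)
  also have "\<dots> = conj_map j (poly (map_poly of_int p) x)" by (simp add: poly_altdef)
  also have "\<dots> = 0" using p(1) by (simp add: conj_0)
  finally show ?thesis using p(2) unfolding algebraic_int_altdef_ipoly by blast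
qed

end

lemma conj_conj:
  assumes "coprime i n" "coprime j n" "x \<in> QZ"
  shows "conj_map i (conj_map j x) = conj_map (i * j) x"
proof -
  obtain f where f: "x = qpoly f z" using assms by (auto simp: QZ_def)
  define g where "g = pcompose f (monom 1 j)"
  have g: "qpoly g w = qpoly f (w ^ j)" for w by (simp add: g_def qpoly_pcompose qpoly_monom)
  have "conj_map j x = qpoly g z" by (simp only: f g conj_qpoly[OF assms(2)])
  then have "conj_map i (conj_map j x) = qpoly g (z ^ i)" by (simp only: conj_qpoly[OF assms(1)])
  also have "\<dots> = qpoly f (z ^ (i * j))" by (simp only: g power_mult)
  also have "\<dots> = conj_map (i * j) x"
    unfolding f using assms by (subst conj_qpoly) auto
  finally show ?thesis .
qed

lemma conj_cong:
  assumes "coprime i n" "coprime j n" "[i = j] (mod n)" "x \<in> QZ"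
  shows "conj_map i x = conj_map j x"
proof -
  obtain f where f: "x = qpoly f z" using assms by (auto simp: QZ_def)
  have "z ^ i = z ^ j" using assms(3) z_eq_iff by blast
  then show ?thesis unfolding f by (simp add: conj_qpoly assms)
qed

lemma conj_one: "x \<in> QZ \<Longrightarrow> conj_map (Suc 0) x = x"
  by (auto simp: QZ_def conj_qpoly)

text \<open>The residue inverse to \<open>j\<close> provides an inverse automorphism.\<close>

lemma conj_eq_0_iff:
  assumes "coprime j n" "x \<in> QZ" shows "conj_map j x = 0 \<longleftrightarrow> x = 0"
proof
  assume 0: "conj_map j x = 0"
  obtain i where i: "[j * i = 1] (mod n)"
    using assms(1) by (metis cong_solve_coprime_nat One_nat_def)
  then have ci: "coprime i n"
    by (metis cong_imp_coprime cong_sym coprime_1_left coprime_mult_left_iff)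
  have "conj_map (i * j) x = 0"
    using conj_conj[OF ci assms] 0 conj_0[OF ci] by simp
  moreover have "conj_map (i * j) x = conj_map (Suc 0) x"
    using i ci assms by (intro conj_cong) (auto simp: mult.commute)
  ultimately show "x = 0" using conj_one[OF assms(2)] by simp
next
  assume "x = 0" then show "conj_map j x = 0" using conj_0 assms by simp
qed

text \<open>Complex conjugation inverts \<open>z\<close> and fixes rational coefficients, and
  \<open>n - 1\<close> is -1 modulo \<open>n\<close>.\<close>

lemma conj_minus_one_cnj: "x \<in> QZ \<Longrightarrow> conj_map (n - 1) x = cnj x"
proof -
  assume "x \<in> QZ"
  then obtain f where f: "x = qpoly f z" by (auto simp: QZ_def)
  have "coprime (n - 1) n" using n_gt_1 coprime_diff_one_left_nat[of n] by simp
  moreover have "z ^ (n - 1) = cnj z"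
    using z_inverse[of 1] n_gt_1 by (simp add: cnj_z)
  ultimately have "conj_map (n - 1) x = qpoly f (cnj z)" unfolding f by (simp add: conj_qpoly)
  also have "\<dots> = cnj x"
  proof -
    have "cnj (of_rat r) = of_rat r" for r by (cases r) (simp add: of_rat_rat)
    then show ?thesis unfolding f by (simp add: qpoly_altdef)
  qed
  finally show ?thesis .
qed

section \<open>Traces, Ramanujan sums and rationality\<close>

lemma totatives_reindex:
  assumes "coprime i n"
  shows "bij_betw (\<lambda>j. (i * j) mod n) (totatives n) (totatives n)"
proof -
  have "inj_on (\<lambda>j. (i * j) mod n) (totatives n)"
  proof (rule inj_onI)
    fix a b assume ab: "a \<in> totatives n" "b \<in> totatives n" "(i * a) mod n = (i * b) mod n"
    then have "[a = b] (mod n)" using assms by (simp add: cong_def[symmetric] cong_mult_lcancel_nat)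
    then show "a = b" using ab totatives_less[of _ n] n_gt_1 by (simp add: cong_def)
  qed
  moreover have "(\<lambda>j. (i * j) mod n) ` totatives n \<subseteq> totatives n"
  proof safe
    fix j assume "j \<in> totatives n"
    then have c: "coprime (i * j mod n) n" using assms by (auto simp: in_totatives_iff)
    then have "i * j mod n > 0" using n_gt_1 by (intro Nat.gr0I) auto
    moreover have "i * j mod n \<le> n" using n_gt_1 by (intro less_imp_le mod_less_divisor) simp
    ultimately show "i * j mod n \<in> totatives n" using c by (simp add: in_totatives_iff)
  qed
  ultimately show ?thesis by (simp add: bij_betw_def endo_inj_surj)
qed

text \<open>The multiples of \<open>D\<close> turn the sum into a full geometric sum for a root of
  unity of order dividing \<open>N = n / D\<close>: its value is \<open>N\<close> or 0.\<close>

lemma sum_roots_dvd: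
  assumes "D > 0" "D dvd n"
  shows "(\<Sum>j\<in>{j\<in>{1..n}. D dvd j}. (z ^ i) ^ j) \<in> \<int>"
proof -
  obtain N where N: "n = D * N" using assms by blast
  have "{j\<in>{1..n}. D dvd j} = (\<lambda>l. D * l) ` {1..N}"
    using assms N n_gt_1 by (auto simp: image_iff elim!: dvdE)
  moreover have "inj_on (\<lambda>l. D * l) {1..N}" using assms by (auto simp: inj_on_def)
  ultimately have "(\<Sum>j\<in>{j\<in>{1..n}. D dvd j}. (z ^ i) ^ j) = (\<Sum>l\<in>{1..N}. ((z ^ i) ^ D) ^ l)"
    by (simp add: sum.reindex power_mult)
  also have "\<dots> \<in> \<int>"
  proof -
    define u where "u = (z ^ i) ^ D"
    have uN: "u ^ N = 1" unfolding u_def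
      by (metis N z_n power_mult mult.commute power_one)
    show ?thesis
    proof (cases "u = 1")
      case True then show ?thesis by (simp add: u_def[symmetric])
    next
      case False
      have "(\<Sum>l\<in>{1..N}. u ^ l) = (\<Sum>l<N. u ^ Suc l)"
        by (rule sum.reindex_bij_witness[of _ Suc "\<lambda>l. l - 1"]) auto
      also have "\<dots> = u * (\<Sum>l<N. u ^ l)" by (simp add: sum_distrib_left)
      also have "\<dots> = 0" using False uN by (simp add: geometric_sum)
      finally show ?thesis by (simp add: u_def[symmetric])
    qed
  qed
  finally show ?thesis .
qed

text \<open>Inclusion-exclusion, one prime at a time: excluding the multiples of \<open>p\<close>
  subtracts the sum over indices divisible by \<open>p * D\<close>. Therefore \<open>D\<close>
  varies in the induction and stays coprime to the primes that are left.\<close>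

lemma sum_roots_sieve:
  assumes "finite A" "\<And>p. p \<in> A \<Longrightarrow> p dvd n \<and> Factorial_Ring.prime p" "D > 0" "D dvd n" "\<And>p. p \<in> A \<Longrightarrow> coprime p D"
  shows "(\<Sum>j\<in>{j\<in>{1..n}. D dvd j \<and> (\<forall>p\<in>A. \<not> p dvd j)}. (z ^ i) ^ j) \<in> \<int>"
  using assms
proof (induction A arbitrary: D rule: finite_induct)
  case empty
  then show ?case using sum_roots_dvd by simp
next
  case (insert p A)
  define S where "S = (\<lambda>D. {j\<in>{1..n}. D dvd j \<and> (\<forall>p\<in>A. \<not> p dvd j)})"
  have cop: "coprime p D" using insert by auto
  have pp: "Factorial_Ring.prime p" using insert by auto
  have eq: "{j\<in>{1..n}. D dvd j \<and> (\<forall>p\<in>insert p A. \<not> p dvd j)} = S D - S (p * D)"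
    unfolding S_def using cop by (auto dest: dvd_mult_left dvd_mult_right simp: divides_mult)
  have "(\<Sum>j\<in>S D - S (p * D). (z ^ i) ^ j) = (\<Sum>j\<in>S D. (z ^ i) ^ j) - (\<Sum>j\<in>S (p * D). (z ^ i) ^ j)"
    by (rule sum_diff) (auto simp: S_def intro: dvd_mult_right)
  moreover have "(\<Sum>j\<in>S D. (z ^ i) ^ j) \<in> \<int>"
    unfolding S_def using insert by (intro insert.IH) auto
  moreover have "(\<Sum>j\<in>S (p * D). (z ^ i) ^ j) \<in> \<int>"
    unfolding S_def
  proof (intro insert.IH)
    show "p * D > 0" using insert pp prime_gt_0_nat by auto
    show "p * D dvd n" using insert cop by (auto intro: divides_mult)
    fix r assume r: "r \<in> A"
    then have "coprime r p" using insert pp primes_coprime[of r p] by auto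
    moreover have "coprime r D" using insert r by auto
    ultimately show "coprime r (p * D)" by simp
  qed (use insert in auto)
  ultimately show ?case unfolding eq by simp
qed

text \<open>A Ramanujan sum, obtained by sieving out the indices divisible by a prime factor of
  \<open>n\<close>.\<close>

lemma sum_totatives_Ints: "(\<Sum>j\<in>totatives n. (z ^ i) ^ j) \<in> \<int>"
proof -
  have "totatives n = {j\<in>{1..n}. 1 dvd j \<and> (\<forall>p\<in>prime_factors n. \<not> p dvd j)}"
  proof (intro subset_antisym subsetI)
    fix j assume j: "j \<in> totatives n"
    have "\<not> p dvd j" if "p \<in> prime_factors n" for p
    proof
      assume "p dvd j"
      moreover have "p dvd n" "Factorial_Ring.prime p" using that by (auto simp: in_prime_factors_iff)
      ultimately show False using j
        by (auto simp: in_totatives_iff dest!: coprime_common_divisor_nat[of j n p])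
    qed
    then show "j \<in> {j\<in>{1..n}. 1 dvd j \<and> (\<forall>p\<in>prime_factors n. \<not> p dvd j)}"
      using j by (auto simp: in_totatives_iff)
  next
    fix j assume j: "j \<in> {j\<in>{1..n}. 1 dvd j \<and> (\<forall>p\<in>prime_factors n. \<not> p dvd j)}"
    have "coprime j n"
    proof (rule ccontr)
      assume "\<not> coprime j n"
      then have "gcd j n \<noteq> 1" by (simp add: coprime_iff_gcd_eq_1)
      then obtain p where p: "Factorial_Ring.prime p" "p dvd gcd j n" using prime_factor_nat by blast
      then have "p \<in> prime_factors n" using n_gt_1 by (auto simp: in_prime_factors_iff)
      then show False using j p by auto
    qed
    then show "j \<in> totatives n" using j by (auto simp: in_totatives_iff)
  qed
  then show ?thesis using sum_roots_sieve[of "prime_factors n" 1 i]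
    by (simp add: in_prime_factors_iff)
qed

text \<open>By linearity the trace of \<open>x\<close> is a rational combination of Ramanujan
  sums.\<close>

lemma trace_rational:
  assumes "x \<in> QZ" shows "(\<Sum>j\<in>totatives n. conj_map j x) \<in> \<rat>"
proof -
  obtain f where f: "x = qpoly f z" using assms by (auto simp: QZ_def)
  have "(\<Sum>j\<in>totatives n. conj_map j x) = (\<Sum>j\<in>totatives n. qpoly f (z ^ j))"
    unfolding f by (intro sum.cong refl conj_qpoly) (auto simp: in_totatives_iff)
  also have "\<dots> = (\<Sum>i\<le>degree f. of_rat (coeff f i) * (\<Sum>j\<in>totatives n. (z ^ i) ^ j))"
    unfolding qpoly_altdef sum_distrib_left
    by (subst sum.swap) (simp add: power_mult[symmetric] mult.commute)
  also have "\<dots> \<in> \<rat>"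
    using sum_totatives_Ints Ints_subset_Rats by (intro Rats_sum[of _ "\<lambda>i. of_rat (coeff f i) * _ i"] Rats_mult) auto
  finally show ?thesis .
qed

text \<open>A fixed element is its trace divided by \<open>totient n\<close>. This takes the place
  of the Galois correspondence over the rationals.\<close>

lemma fixed_imp_rational:
  assumes "x \<in> QZ" "\<And>j. j \<in> totatives n \<Longrightarrow> conj_map j x = x"
  shows "x \<in> \<rat>"
proof -
  have "(\<Sum>j\<in>totatives n. conj_map j x) = of_nat (card (totatives n)) * x"
    using assms(2) by simp
  then have "x = (\<Sum>j\<in>totatives n. conj_map j x) / of_nat (card (totatives n))"
    using n_gt_1 by simp
  then show ?thesis using trace_rational[OF assms(1)] by (metis Rats_divide Rats_of_nat)
qed

lemma prod_conj_rational:
  assumes "x \<in> QZ" shows "(\<Prod>j\<in>totatives n. conj_map j x) \<in> \<rat>"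
proof (rule fixed_imp_rational)
  have cj: "conj_map j x \<in> QZ" if "j \<in> totatives n" for j
    using that assms by (intro conj_in_QZ) (auto simp: in_totatives_iff)
  then show "(\<Prod>j\<in>totatives n. conj_map j x) \<in> QZ" by (rule QZ_prod)
  fix i assume "i \<in> totatives n"
  then have i: "coprime i n" by (simp add: in_totatives_iff)
  have "conj_map i (\<Prod>j\<in>totatives n. conj_map j x) = (\<Prod>j\<in>totatives n. conj_map i (conj_map j x))"
    by (rule conj_prod[OF i cj])
  also have "\<dots> = (\<Prod>j\<in>totatives n. conj_map ((i * j) mod n) x)"
    using i assms by (intro prod.cong refl) (auto simp: conj_conj in_totatives_iff intro!: conj_cong)
  also have "\<dots> = (\<Prod>j\<in>totatives n. conj_map j x)"
    by (rule prod.reindex_bij_betw[OF totatives_reindex[OF i]])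
  finally show "conj_map i (\<Prod>j\<in>totatives n. conj_map j x) = (\<Prod>j\<in>totatives n. conj_map j x)" .
qed

text \<open>The product of all conjugates is a nonzero rational, and dividing it by the factor
  \<open>x\<close> leaves an element \<open>M\<close> of \<open>QZ\<close>.\<close>

lemma QZ_inverse:
  assumes "x \<in> QZ" shows "inverse x \<in> QZ"
proof (cases "x = 0")
  case False
  define M where "M = (\<Prod>j\<in>totatives n - {1}. conj_map j x)"
  define N where "N = (\<Prod>j\<in>totatives n. conj_map j x)"
  have cj: "coprime j n" if "j \<in> totatives n" for j using that by (simp add: in_totatives_iff)
  have "N \<noteq> 0" unfolding N_def using False assms cj by (auto simp: conj_eq_0_iff)
  have "1 \<in> totatives n" using n_gt_1 by simp
  then have "N = conj_map 1 x * M" unfolding N_def M_def by (intro prod.remove) auto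
  then have "N = x * M" using conj_one[OF assms] by simp
  then have "inverse x = M * inverse N" using False \<open>N \<noteq> 0\<close> by (simp add: field_simps)
  moreover have "M \<in> QZ" unfolding M_def using cj assms by (intro QZ_prod conj_in_QZ) auto
  moreover have "inverse N \<in> QZ" using prod_conj_rational[OF assms] unfolding N_def
    by (intro QZ_Rats) simp
  ultimately show ?thesis by (simp add: QZ_mult)
qed (simp add: QZ_0)

lemma QZ_divide: "x \<in> QZ \<Longrightarrow> y \<in> QZ \<Longrightarrow> x / y \<in> QZ"
  by (simp add: divide_inverse QZ_mult QZ_inverse)

text \<open>Fourier inversion on the group of \<open>n\<close>-th roots of unity; the coefficients are traces.\<close>

lemma AI_expansion:
  assumes x: "x \<in> QZ" "algebraic_int x"
  obtains c :: "nat \<Rightarrow> int" where "of_nat n * x = (\<Sum>k<n. of_int (c k) * z ^ k)"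
proof -
  \<comment> \<open>The exponent \<open>(n - 1) * k\<close> is -k modulo \<open>n\<close>, so
    \<open>t k\<close> is the trace of \<open>x\<close> divided by \<open>z ^ k\<close>.\<close>
  define t where "t k = (\<Sum>j\<in>totatives n. conj_map j (x * z ^ ((n - 1) * k)))" for k
  have cj: "coprime j n" if "j \<in> totatives n" for j using that by (simp add: in_totatives_iff)
  have tI: "t k \<in> \<int>" for k
  proof (rule rational_algebraic_int_is_int)
    show "algebraic_int (t k)" unfolding t_def
      by (intro algebraic_int_sum conj_AI) (auto intro!: cj QZ_intros x algebraic_int_intros z_AI)
    show "t k \<in> \<rat>" unfolding t_def by (intro trace_rational QZ_intros x)
  qed
  have "\<forall>k. \<exists>i. t k = of_int i" using tI by (blast elim: Ints_cases)
  from choice[OF this] obtain c :: "nat \<Rightarrow> int" where c: "\<And>k. t k = of_int (c k)" by blast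
  \<comment> \<open>Orthogonality: the base is \<open>z\<close> to the exponent 1 - j modulo
    \<open>n\<close>, so its powers sum to 0 unless \<open>j = 1\<close>, and only the identity
    conjugate of \<open>x\<close> survives.\<close>
  have inner: "(\<Sum>k<n. (z ^ (j * (n - 1) + 1)) ^ k) = (if j = 1 then of_nat n else 0)"
    if "j \<in> totatives n" for j
  proof -
    define u where "u = z ^ (j * (n - 1) + 1)"
    have "j < n" "j > 0" using that totatives_less[of j n] n_gt_1 by (auto simp: in_totatives_iff)
    have e: "j * (n - 1) + 1 + j = 1 + j * n"
      using n_gt_1 by (simp add: diff_mult_distrib2)
    have "u * z ^ j = z ^ (1 + j * n)" unfolding u_def e[symmetric] power_add by simp
    also have "\<dots> = z" by (simp only: power_add power_mult mult.commute[of j n] z_n power_one power_one_right mult_1_right)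
    finally have uz: "u * z ^ j = z ^ 1" by simp
    have un: "u ^ n = 1" unfolding u_def by (metis z_n power_mult mult.commute power_one)
    show ?thesis
    proof (cases "j = 1")
      case True
      then have "u = 1" using uz by simp
      then show ?thesis unfolding u_def[symmetric] using True by simp
    next
      case False
      then have "u \<noteq> 1" using z_inj[of j 1] uz \<open>j < n\<close> n_gt_1 by auto
      then show ?thesis unfolding u_def[symmetric] using False un by (simp add: geometric_sum)
    qed
  qed
  have "(\<Sum>k<n. of_int (c k) * z ^ k) = (\<Sum>k<n. t k * z ^ k)" by (simp add: c)
  also have "\<dots> = (\<Sum>j\<in>totatives n. \<Sum>k<n. conj_map j x * (z ^ (j * (n - 1) + 1)) ^ k)"
  proof -
    have "conj_map j (x * z ^ ((n - 1) * k)) * z ^ k = conj_map j x * (z ^ (j * (n - 1) + 1)) ^ k"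
      if "j \<in> totatives n" for j k
      using cj[OF that] x(1)
      by (simp add: conj_mult QZ_intros conj_z power_mult[symmetric] power_add[symmetric] algebra_simps)
    then show ?thesis unfolding t_def sum_distrib_right by (subst sum.swap) simp
  qed
  also have "\<dots> = (\<Sum>j\<in>totatives n. conj_map j x * (if j = 1 then of_nat n else 0))"
    by (intro sum.cong refl) (simp only: sum_distrib_left[symmetric] inner)
  also have "\<dots> = (\<Sum>j\<in>totatives n. if j = 1 then x * of_nat n else 0)"
    using conj_one[OF x(1)] by (intro sum.cong refl) auto
  also have "\<dots> = of_nat n * x" using n_gt_1 by simp
  finally show thesis using that by metis
qed

text \<open>By Euler's theorem the exponent \<open>q ^ totient n\<close> fixes every power of
  \<open>z\<close>, so Frobenius fixes the integral combination \<open>of_nat n * x\<close> modulo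
  \<open>q\<close>; the factor \<open>n\<close> is then removed.\<close>

lemma frobenius_power_AI:
  assumes x: "x \<in> QZ" "algebraic_int x" and q: "Factorial_Ring.prime q" "\<not> q dvd n"
  shows "ai_cong q (x ^ (q ^ totient n)) x"
proof -
  let ?Q = "q ^ totient n"
  obtain c where c: "of_nat n * x = (\<Sum>k<n. of_int (c k) * z ^ k)"
    using AI_expansion[OF x] by blast
  have "coprime q n" using q by (simp add: prime_imp_coprime)
  then have "[?Q = 1] (mod n)" by (rule euler_theorem)
  have zQ: "(z ^ k) ^ ?Q = z ^ k" for k
  proof -
    have "[k * ?Q = k * 1] (mod n)" using \<open>[?Q = 1] (mod n)\<close> by (rule cong_scalar_left)
    then have "z ^ (k * ?Q) = z ^ k" using z_eq_iff by simp
    then show ?thesis by (simp only: power_mult)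
  qed
  have "ai_cong q ((of_nat n * x) ^ ?Q) (\<Sum>k<n. of_int (c k) * (z ^ k) ^ ?Q)"
    unfolding c by (intro ai_cong_frobenius_int_combination q) (auto intro: algebraic_int_power z_AI)
  then have 1: "ai_cong q (of_nat n ^ ?Q * x ^ ?Q) (of_nat n * x)"
    by (simp only: zQ c[symmetric] power_mult_distrib)
  have "ai_cong q ((\<Sum>k\<in>{0::nat}. of_int (int n) * 1) ^ ?Q) (\<Sum>k\<in>{0::nat}. of_int (int n) * 1 ^ ?Q)"
    by (intro ai_cong_frobenius_int_combination q) (auto intro: algebraic_int_1)
  then have "ai_cong q (of_nat n ^ ?Q) (of_nat n)" by simp
  then have "ai_cong q (of_nat n ^ ?Q * x ^ ?Q) (of_nat n * x ^ ?Q)"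
    by (intro ai_cong_mult ai_cong_refl algebraic_int_intros x)
  with 1 have "ai_cong q (of_nat n * x ^ ?Q) (of_nat n * x)"
    using ai_cong_sym ai_cong_trans by blast
  then have 2: "algebraic_int (of_nat n * ((x ^ ?Q - x) / of_nat q))"
    by (simp add: ai_cong_def right_diff_distrib)
  \<comment> \<open>Bezout inverts \<open>n\<close> modulo \<open>q\<close>: both \<open>n\<close>
    times and \<open>q\<close> times the quotient in question are algebraic integers.\<close>
  have "coprime (int n) (int q)" using \<open>coprime q n\<close> by (simp add: coprime_commute)
  then obtain a b where ab: "a * int n + b * int q = 1"
    using bezout_int[of "int n" "int q"] by (auto simp: coprime_iff_gcd_eq_1)
  have "algebraic_int (of_int a * (of_nat n * ((x ^ ?Q - x) / of_nat q)) + of_int b * (x ^ ?Q - x))"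
    by (intro algebraic_int_intros 2 x)
  also have "of_int a * (of_nat n * ((x ^ ?Q - x) / of_nat q)) + of_int b * (x ^ ?Q - x) =
     of_int (a * int n + b * int q) * ((x ^ ?Q - x) / of_nat q)"
    using prime_gt_0_nat[OF q(1)] by (simp add: field_simps)
  finally show ?thesis unfolding ab ai_cong_def by simp
qed

text \<open>The integers modulo \<open>q\<close> have no nilpotents: \<open>q\<close> divides
  \<open>x ^ 2\<close>, hence \<open>x ^ (q ^ totient n)\<close>, which is congruent to
  \<open>x\<close>. This is the form in which \<open>q\<close> is seen not to ramify.\<close>

lemma reduced_mod_prime:
  assumes x: "x \<in> QZ" "algebraic_int x" and q: "Factorial_Ring.prime q" "\<not> q dvd n"
    and sq: "algebraic_int (x ^ 2 / of_nat q)"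
  shows "algebraic_int (x / of_nat q)"
proof -
  have "totient n > 0" using n_gt_1 by simp
  then have "q ^ 1 \<le> q ^ totient n" using prime_gt_0_nat[OF q(1)] \<open>totient n > 0\<close> by (intro power_increasing) (auto simp: Suc_le_eq)
  then have "q ^ totient n \<ge> 2" using prime_ge_2_nat[OF q(1)] by simp
  then obtain e where e: "q ^ totient n = 2 + e" using le_Suc_ex by blast
  have eq: "x ^ (q ^ totient n) / of_nat q = (x ^ 2 / of_nat q) * x ^ e"
    unfolding e power_add by simp
  have "algebraic_int (x ^ (q ^ totient n) / of_nat q)"
    unfolding eq by (intro algebraic_int_intros sq x)
  moreover have "algebraic_int ((x ^ (q ^ totient n) - x) / of_nat q)"
    using frobenius_power_AI[OF x q] by (simp add: ai_cong_def)
  ultimately have "algebraic_int (x ^ (q ^ totient n) / of_nat q - (x ^ (q ^ totient n) - x) / of_nat q)"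
    by (rule algebraic_int_diff)
  then show ?thesis by (simp add: diff_divide_distrib)
qed

text \<open>A product formula in place of a Gauss sum, valid for composite \<open>n\<close>: in the
  product \<open>n\<close> of all \<open>1 - z ^ k\<close> the factors for \<open>k\<close> and
  \<open>n - k\<close> combine to minus a square. There are \<open>2 * r\<close> such pairs, so the
  signs cancel.\<close>

lemma sqrt_in_QZ:
  assumes "n mod 4 = 1"
  shows "complex_of_real (sqrt (real n)) \<in> QZ"
proof -
  define r where "r = n div 4"
  have n: "n = 4 * r + 1" using assms unfolding r_def by presburger
  \<comment> \<open>Here \<open>2 * r + 1 = (n + 1) / 2\<close>, so \<eta> is the square root of
    \<open>z\<close> among the powers of \<open>z\<close>.\<close>
  define \<eta> where "\<eta> = z ^ (2 * r + 1)"
  have \<eta>2: "\<eta> ^ 2 = z"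
  proof -
    have "\<eta> ^ 2 = z ^ (n + 1)" unfolding \<eta>_def n power_mult[symmetric] by (simp add: algebra_simps)
    then show ?thesis by (simp add: power_add z_n)
  qed
  have \<eta>0: "\<eta> \<noteq> 0" by (simp add: \<eta>_def)
  define s where "s = (\<Prod>i\<in>{1..2*r}. \<eta> ^ i - inverse \<eta> ^ i)"
  have "s \<in> QZ" unfolding s_def \<eta>_def by (intro QZ_prod QZ_intros QZ_inverse)
  have fac: "(1 - z ^ i) * (1 - z ^ (n - i)) = - ((\<eta> ^ i - inverse \<eta> ^ i) ^ 2)" if "i \<in> {1..2*r}" for i
  proof -
    have "z ^ (n - i) = inverse (z ^ i)" using that n by (intro z_inverse[symmetric]) auto
    also have "\<dots> = (inverse \<eta> ^ i) ^ 2"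
      unfolding \<eta>2[symmetric] by (simp add: power_inverse power_mult[symmetric] mult.commute)
    finally have a: "z ^ (n - i) = (inverse \<eta> ^ i) ^ 2" .
    have b: "z ^ i = (\<eta> ^ i) ^ 2" unfolding \<eta>2[symmetric] by (simp add: power_mult[symmetric] mult.commute)
    have c: "\<eta> ^ i * inverse \<eta> ^ i = 1" using \<eta>0 by (simp add: power_mult_distrib[symmetric])
    have "(1 - A ^ 2) * (1 - B ^ 2) = - ((A - B) ^ 2)" if "A * B = 1" for A B :: complex
    proof -
      have "A ^ 2 * B ^ 2 = 1" using that by (metis power_mult_distrib power_one)
      moreover have "(1 - A ^ 2) * (1 - B ^ 2) = 1 - A ^ 2 - B ^ 2 + A ^ 2 * B ^ 2"
        by (simp add: algebra_simps)
      moreover have "(A - B) ^ 2 = A ^ 2 + B ^ 2 - 2 * (A * B)"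
        by (simp add: power2_eq_square algebra_simps)
      ultimately show ?thesis using that by simp
    qed
    then show ?thesis using a b c by simp
  qed
  have "of_nat n = (\<Prod>k\<in>{1..<n}. 1 - z ^ k)" by (rule prod_one_minus_z[symmetric])
  also have "{1..<n} = {1..2*r} \<union> {2*r+1..<n}" using n by auto
  also have "(\<Prod>k\<in>\<dots>. 1 - z ^ k) = (\<Prod>k\<in>{1..2*r}. 1 - z ^ k) * (\<Prod>k\<in>{2*r+1..<n}. 1 - z ^ k)"
    by (rule prod.union_disjoint) auto
  also have "(\<Prod>k\<in>{2*r+1..<n}. 1 - z ^ k) = (\<Prod>k\<in>{1..2*r}. 1 - z ^ (n - k))"
    by (rule prod.reindex_bij_witness[of _ "\<lambda>k. n - k" "\<lambda>k. n - k"]) (use n in auto)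
  also have "(\<Prod>k\<in>{1..2*r}. 1 - z ^ k) * \<dots> = (\<Prod>k\<in>{1..2*r}. - ((\<eta> ^ k - inverse \<eta> ^ k) ^ 2))"
    unfolding prod.distrib[symmetric] by (intro prod.cong refl fac)
  also have "\<dots> = (\<Prod>k\<in>{1..2*r}. (-1) * (\<eta> ^ k - inverse \<eta> ^ k) ^ 2)"
    by (intro prod.cong refl) simp
  also have "\<dots> = s ^ 2"
    unfolding prod.distrib s_def prod_power_distrib by simp
  finally have "s ^ 2 = of_nat n" ..
  moreover have "complex_of_real (sqrt (real n)) ^ 2 = of_nat n"
    by (simp flip: of_real_power)
  ultimately have "complex_of_real (sqrt (real n)) = s \<or> complex_of_real (sqrt (real n)) = - s"
    by (metis power2_eq_iff)
  then show ?thesis using \<open>s \<in> QZ\<close> by (auto intro: QZ_minus)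
qed

end

section \<open>Ideals in rings of integers\<close>

lemma CC_simps [simp]:
  "carrier CC = UNIV" "x \<otimes>\<^bsub>CC\<^esub> y = x * y" "x \<oplus>\<^bsub>CC\<^esub> y = x + y" "\<one>\<^bsub>CC\<^esub> = 1" "\<zero>\<^bsub>CC\<^esub> = 0"
  by (simp_all add: ring_of_type_algebra_def)

abbreviation set_prod :: "complex set \<Rightarrow> complex set \<Rightarrow> complex set" (infixl "\<star>" 70) where
  "I \<star> J \<equiv> ideal_prod CC I J"

abbreviation scale :: "complex \<Rightarrow> complex set \<Rightarrow> complex set" where
  "scale a I \<equiv> (\<lambda>x. a * x) ` I"

section \<open>Products and scalings of sets of complex numbers\<close>

lemma set_prod_prod: "i \<in> I \<Longrightarrow> j \<in> J \<Longrightarrow> i * j \<in> I \<star> J"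
  using ideal_prod.prod[of i I j J CC] by simp

lemma set_prod_add: "x \<in> I \<star> J \<Longrightarrow> y \<in> I \<star> J \<Longrightarrow> x + y \<in> I \<star> J"
  using ideal_prod.sum[of x CC I J y] by simp

lemma set_prod_induct [consumes 1, case_names prod sum]:
  assumes "x \<in> I \<star> J"
    and "\<And>i j. i \<in> I \<Longrightarrow> j \<in> J \<Longrightarrow> P (i * j)"
    and "\<And>x y. x \<in> I \<star> J \<Longrightarrow> y \<in> I \<star> J \<Longrightarrow> P x \<Longrightarrow> P y \<Longrightarrow> P (x + y)"
  shows "P x"
  using assms(1)
  by (induction rule: ideal_prod.induct) (use assms(2,3) in auto)

lemma set_prod_commute: "I \<star> J = J \<star> I"
proof -
  have "x \<in> J \<star> I" if "x \<in> I \<star> J" for x I J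
    using that by (induction rule: set_prod_induct)
      (auto simp: mult.commute[of _ "_::complex"] intro: set_prod_add, metis mult.commute set_prod_prod)
  then show ?thesis by blast
qed

lemma set_prod_mono: "I \<subseteq> I' \<Longrightarrow> J \<subseteq> J' \<Longrightarrow> I \<star> J \<subseteq> I' \<star> J'"
proof
  fix x assume "I \<subseteq> I'" "J \<subseteq> J'" "x \<in> I \<star> J"
  show "x \<in> I' \<star> J'" using \<open>x \<in> I \<star> J\<close>
    by (induction rule: set_prod_induct)
       (use \<open>I \<subseteq> I'\<close> \<open>J \<subseteq> J'\<close> in \<open>auto intro: set_prod_prod set_prod_add\<close>)
qed

lemma set_prod_subsetI:
  assumes "\<And>i j. i \<in> I \<Longrightarrow> j \<in> J \<Longrightarrow> i * j \<in> M" "\<And>x y. x \<in> M \<Longrightarrow> y \<in> M \<Longrightarrow> x + y \<in> M"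
  shows "I \<star> J \<subseteq> M"
proof
  fix x assume "x \<in> I \<star> J"
  then show "x \<in> M" by (induction rule: set_prod_induct) (auto intro: assms)
qed

lemma set_prod_assoc: "(I \<star> J) \<star> K = I \<star> (J \<star> K)"
proof -
  have le: "(I \<star> J) \<star> K \<subseteq> I \<star> (J \<star> K)" for I J K
  proof (rule set_prod_subsetI)
    fix x k assume "x \<in> I \<star> J" "k \<in> K"
    then show "x * k \<in> I \<star> (J \<star> K)"
      by (induction rule: set_prod_induct)
         (auto simp: mult.assoc distrib_right intro: set_prod_prod set_prod_add)
  qed (rule set_prod_add)
  have "I \<star> (J \<star> K) = (K \<star> J) \<star> I" by (metis set_prod_commute)
  also have "\<dots> \<subseteq> K \<star> (J \<star> I)" by (rule le)
  also have "\<dots> = (I \<star> J) \<star> K" by (metis set_prod_commute)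
  finally show ?thesis using le by blast
qed

lemma set_prod_scale: "scale a I \<star> J = scale a (I \<star> J)"
proof
  show "scale a I \<star> J \<subseteq> scale a (I \<star> J)"
  proof (rule set_prod_subsetI)
    fix x y assume "x \<in> scale a (I \<star> J)" "y \<in> scale a (I \<star> J)"
    then show "x + y \<in> scale a (I \<star> J)"
      by (auto simp: distrib_left[symmetric] intro: set_prod_add)
  qed (auto simp: mult.assoc intro: set_prod_prod)
  have "a * x \<in> scale a I \<star> J" if "x \<in> I \<star> J" for x
    using that
  proof (induction rule: set_prod_induct)
    case (prod i j)
    then have "a * i \<in> scale a I" by blast
    from set_prod_prod[OF this prod(2)] show ?case by (simp add: mult.assoc)
  qed (auto simp: distrib_left intro: set_prod_add)
  then show "scale a (I \<star> J) \<subseteq> scale a I \<star> J" by blast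
qed

lemma scale_scale: "scale a (scale b I) = scale (a * b) I"
  by (simp add: image_image mult.assoc)

lemma scale_1 [simp]: "scale 1 I = I" by simp

lemma sequence_in_finite_set_repeats:
  fixes g :: "nat \<Rightarrow> 'a"
  assumes "finite C" "\<And>i. g i \<in> C"
  obtains k l where "k < l" "g k = g l"
proof -
  have "\<not> inj g"
  proof
    assume "inj g"
    moreover have "finite (range g)" using assms by (meson finite_subset image_subsetI)
    ultimately show False using finite_imageD infinite_UNIV_nat by blast
  qed
  then show thesis using that by (metis injI linorder_neqE_nat)
qed

text \<open>The representatives in \<open>finite_residues\<close> may lie outside \<open>F\<close>
  and may fail to be integral. In this form the last two axioms pass from the cyclotomic field to
  any subset, and so to all its subfields.\<close>

locale integer_ring =
  fixes F :: "complex set"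
  assumes F_1: "1 \<in> F"
    and F_diff: "\<And>x y. x \<in> F \<Longrightarrow> y \<in> F \<Longrightarrow> x - y \<in> F"
    and F_mult: "\<And>x y. x \<in> F \<Longrightarrow> y \<in> F \<Longrightarrow> x * y \<in> F"
    and F_inverse: "\<And>x. x \<in> F \<Longrightarrow> inverse x \<in> F"
    and integral_multiple: "\<And>x. x \<in> F \<Longrightarrow> \<exists>m>0. algebraic_int (of_nat m * x)"
    and finite_residues: "\<And>m. m > 0 \<Longrightarrow>
      \<exists>C. finite C \<and> (\<forall>x\<in>F. algebraic_int x \<longrightarrow> (\<exists>c\<in>C. algebraic_int ((x - c) / of_nat m)))"
begin

definition R :: "complex set" where "R = {x \<in> F. algebraic_int x}"

lemma F_0: "0 \<in> F" using F_diff[OF F_1 F_1] by simp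
lemma F_minus: "x \<in> F \<Longrightarrow> - x \<in> F" using F_diff[OF F_0, of x] by simp
lemma F_add: "x \<in> F \<Longrightarrow> y \<in> F \<Longrightarrow> x + y \<in> F" using F_diff[of x "- y"] F_minus[of y] by simp
lemma F_divide: "x \<in> F \<Longrightarrow> y \<in> F \<Longrightarrow> x / y \<in> F" by (simp add: divide_inverse F_mult F_inverse)
lemma F_power: "x \<in> F \<Longrightarrow> x ^ k \<in> F" by (induction k) (auto simp: F_1 F_mult)
lemma F_of_nat: "of_nat k \<in> F" by (induction k) (auto simp: F_0 F_1 F_add)
lemma F_of_int: "of_int k \<in> F"
  by (cases k) (simp_all add: F_of_nat F_minus del: of_nat_Suc)

lemma R_F: "x \<in> R \<Longrightarrow> x \<in> F" by (simp add: R_def)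
lemma R_AI: "x \<in> R \<Longrightarrow> algebraic_int x" by (simp add: R_def)
lemma R_0: "0 \<in> R" by (simp add: R_def F_0)
lemma R_1: "1 \<in> R" by (simp add: R_def F_1 algebraic_int_1)
lemma R_add: "x \<in> R \<Longrightarrow> y \<in> R \<Longrightarrow> x + y \<in> R" by (simp add: R_def F_add algebraic_int_add)
lemma R_diff: "x \<in> R \<Longrightarrow> y \<in> R \<Longrightarrow> x - y \<in> R" by (simp add: R_def F_diff algebraic_int_diff)
lemma R_mult: "x \<in> R \<Longrightarrow> y \<in> R \<Longrightarrow> x * y \<in> R" by (simp add: R_def F_mult algebraic_int_mult)
lemma R_minus: "x \<in> R \<Longrightarrow> - x \<in> R" using R_diff[OF R_0, of x] by simp
lemma R_power: "x \<in> R \<Longrightarrow> x ^ k \<in> R" by (induction k) (auto simp: R_1 R_mult)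
lemma R_of_nat: "of_nat k \<in> R" by (simp add: R_def F_of_nat algebraic_int_of_nat)
lemma R_of_int: "of_int k \<in> R" by (simp add: R_def F_of_int algebraic_int_of_int)

lemmas R_intros = R_0 R_1 R_add R_diff R_mult R_minus R_power R_of_nat R_of_int

text \<open>A positive integer \<open>m\<close> that is a multiple of \<open>a\<close> reduces
  residues modulo \<open>a\<close> to residues modulo \<open>m\<close>; the given representatives
  are then exchanged for elements of \<open>R\<close> in the same class.\<close>

lemma residues:
  assumes "a \<in> R" "a \<noteq> 0"
  obtains C where "finite C" "C \<subseteq> R" "\<And>x. x \<in> R \<Longrightarrow> \<exists>c\<in>C. (x - c) / a \<in> R"
proof -
  obtain m where m: "m > 0" "algebraic_int (of_nat m * inverse a)"
    using integral_multiple[OF F_inverse[OF R_F[OF assms(1)]]] by blast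
  have "of_nat m / a \<in> F" by (intro F_divide F_of_nat R_F assms)
  moreover have "algebraic_int (of_nat m / a)" using m(2) by (simp only: divide_inverse)
  ultimately have ma: "of_nat m / a \<in> R" by (simp add: R_def)
  obtain C where C: "finite C" "\<forall>x\<in>F. algebraic_int x \<longrightarrow> (\<exists>c\<in>C. algebraic_int ((x - c) / of_nat m))"
    using finite_residues[OF m(1)] by blast
  define rep where "rep c = (SOME x. x \<in> R \<and> algebraic_int ((x - c) / of_nat m))" for c
  define D where "D = rep ` {c \<in> C. \<exists>x\<in>R. algebraic_int ((x - c) / of_nat m)}"
  have rep: "rep c \<in> R \<and> algebraic_int ((rep c - c) / of_nat m)"
    if "\<exists>x\<in>R. algebraic_int ((x - c) / of_nat m)" for c
    unfolding rep_def by (rule someI_ex) (use that in blast)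
  show thesis
  proof (rule that[of D])
    show "finite D" using C(1) by (simp add: D_def)
    show "D \<subseteq> R" using rep by (auto simp: D_def)
    fix x assume x: "x \<in> R"
    then obtain c where c: "c \<in> C" "algebraic_int ((x - c) / of_nat m)"
      using C(2) R_F R_AI by blast
    then have ex: "\<exists>x\<in>R. algebraic_int ((x - c) / of_nat m)" using x by blast
    have "algebraic_int ((x - c) / of_nat m - (rep c - c) / of_nat m)"
      using c(2) rep[OF ex] by (blast intro: algebraic_int_diff)
    then have "algebraic_int ((x - rep c) / of_nat m)" by (simp add: diff_divide_distrib[symmetric])
    then have "(x - rep c) / of_nat m \<in> R"
      using x rep[OF ex] by (simp add: R_def F_divide F_diff F_of_nat)
    then have "(x - rep c) / of_nat m * (of_nat m / a) \<in> R" using ma by (rule R_mult)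
    then have "(x - rep c) / a \<in> R" using m(1) by simp
    moreover have "rep c \<in> D" using c(1) ex by (auto simp: D_def)
    ultimately show "\<exists>c\<in>D. (x - c) / a \<in> R" by blast
  qed
qed

section \<open>Fractional ideals\<close>

definition is_frac :: "complex set \<Rightarrow> bool" where
  "is_frac I \<longleftrightarrow> 0 \<in> I \<and> (\<forall>x\<in>I. \<forall>y\<in>I. x + y \<in> I) \<and> (\<forall>r\<in>R. \<forall>x\<in>I. r * x \<in> I) \<and> (\<exists>x\<in>I. x \<noteq> 0)
     \<and> (\<exists>d\<in>R. d \<noteq> 0 \<and> (\<forall>x\<in>I. d * x \<in> R))"

lemma frac_0: "is_frac I \<Longrightarrow> 0 \<in> I" and frac_add: "is_frac I \<Longrightarrow> x \<in> I \<Longrightarrow> y \<in> I \<Longrightarrow> x + y \<in> I"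
  and frac_mult: "is_frac I \<Longrightarrow> r \<in> R \<Longrightarrow> x \<in> I \<Longrightarrow> r * x \<in> I"
  and frac_nz: "is_frac I \<Longrightarrow> \<exists>x\<in>I. x \<noteq> 0" and frac_denom: "is_frac I \<Longrightarrow> \<exists>d\<in>R. d \<noteq> 0 \<and> (\<forall>x\<in>I. d * x \<in> R)"
  by (auto simp: is_frac_def)

lemma frac_diff: "is_frac I \<Longrightarrow> x \<in> I \<Longrightarrow> y \<in> I \<Longrightarrow> x - y \<in> I"
  using frac_add[of I x "- 1 * y"] frac_mult[of I "- 1" y] R_minus[OF R_1] by simp

lemma frac_F: assumes "is_frac I" "x \<in> I" shows "x \<in> F"
proof -
  obtain d where d: "d \<in> R" "d \<noteq> 0" "d * x \<in> R" using frac_denom[OF assms(1)] assms(2) by blast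
  then have "(d * x) / d \<in> F" using R_F by (intro F_divide)
  then show ?thesis using d by simp
qed

lemma frac_R: "is_frac R"
  unfolding is_frac_def using R_0 R_add R_mult R_1 by (auto intro!: bexI[of _ 1])

lemma frac_set_prod:
  assumes I: "is_frac I" and J: "is_frac J" shows "is_frac (I \<star> J)"
  unfolding is_frac_def
proof (intro conjI ballI)
  show "0 \<in> I \<star> J" using set_prod_prod[OF frac_0[OF I] frac_0[OF J]] by simp
  show "x + y \<in> I \<star> J" if "x \<in> I \<star> J" "y \<in> I \<star> J" for x y using that by (rule set_prod_add)
  show "r * x \<in> I \<star> J" if "r \<in> R" "x \<in> I \<star> J" for r x
    using that(2)
  proof (induction rule: set_prod_induct)
    case (prod i j)
    then show ?case using set_prod_prod[OF frac_mult[OF I that(1)]] by (simp add: mult.assoc[symmetric])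
  qed (auto simp: distrib_left intro: set_prod_add)
  obtain x y where "x \<in> I" "x \<noteq> 0" "y \<in> J" "y \<noteq> 0" using frac_nz[OF I] frac_nz[OF J] by blast
  then show "\<exists>x\<in>I \<star> J. x \<noteq> 0" by (intro bexI[of _ "x * y"]) (auto intro: set_prod_prod)
  obtain d e where d: "d \<in> R" "d \<noteq> 0" "\<And>x. x \<in> I \<Longrightarrow> d * x \<in> R"
    and e: "e \<in> R" "e \<noteq> 0" "\<And>x. x \<in> J \<Longrightarrow> e * x \<in> R" using frac_denom[OF I] frac_denom[OF J] by metis
  have "d * e * x \<in> R" if "x \<in> I \<star> J" for x
    using that
  proof (induction rule: set_prod_induct)
    case (prod i j)
    then show ?case using R_mult[OF d(3) e(3), of i j] by (simp add: mult_ac)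
  qed (auto simp: distrib_left intro: R_add)
  then show "\<exists>d\<in>R. d \<noteq> 0 \<and> (\<forall>x\<in>I \<star> J. d * x \<in> R)"
    using d e by (intro bexI[of _ "d * e"]) (auto intro: R_mult)
qed

lemma F_as_quotient: assumes "a \<in> F" obtains d where "d \<in> R" "d \<noteq> 0" "d * a \<in> R"
proof -
  obtain m where "m > 0" "algebraic_int (of_nat m * a)" using integral_multiple[OF assms] by blast
  then have "of_nat m * a \<in> R" using assms by (simp add: R_def F_mult F_of_nat)
  then show thesis using that[of "of_nat m"] \<open>m > 0\<close> R_of_nat by simp
qed

lemma frac_scale:
  assumes I: "is_frac I" and a: "a \<in> F" "a \<noteq> 0" shows "is_frac (scale a I)"
  unfolding is_frac_def
proof (intro conjI ballI)
  show "0 \<in> scale a I" using frac_0[OF I] by (auto intro: image_eqI[of _ _ 0])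
  show "x + y \<in> scale a I" if "x \<in> scale a I" "y \<in> scale a I" for x y
    using that frac_add[OF I] by (auto simp: distrib_left[symmetric])
  show "r * x \<in> scale a I" if "r \<in> R" "x \<in> scale a I" for r x
    using that frac_mult[OF I] by (auto simp: mult.left_commute[of r])
  show "\<exists>x\<in>scale a I. x \<noteq> 0" using frac_nz[OF I] a by auto
  obtain d where d: "d \<in> R" "d \<noteq> 0" "\<And>x. x \<in> I \<Longrightarrow> d * x \<in> R" using frac_denom[OF I] by blast
  obtain e where e: "e \<in> R" "e \<noteq> 0" "e * a \<in> R" using F_as_quotient[OF a(1)] by blast
  have "d * e * (a * x) \<in> R" if "x \<in> I" for x
    using R_mult[OF d(3)[OF that] e(3)] by (simp add: mult_ac)
  then show "\<exists>d\<in>R. d \<noteq> 0 \<and> (\<forall>x\<in>scale a I. d * x \<in> R)"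
    using d e by (intro bexI[of _ "d * e"]) (auto intro: R_mult)
qed

lemma set_prod_R: assumes "is_frac I" shows "I \<star> R = I"
proof
  show "I \<star> R \<subseteq> I" 
  proof (rule set_prod_subsetI)
    show "i * j \<in> I" if "i \<in> I" "j \<in> R" for i j
      using frac_mult[OF assms that(2,1)] by (simp add: mult.commute)
  qed (rule frac_add[OF assms])
  show "I \<subseteq> I \<star> R"
  proof
    fix x assume "x \<in> I"
    then show "x \<in> I \<star> R" using set_prod_prod[of x I 1 R] R_1 by simp
  qed
qed

text \<open>With \<open>d\<close> a denominator of \<open>I\<close> and \<open>i\<close> in
  \<open>I\<close>, all \<open>x ^ k * (d * i)\<close> lie in \<open>R\<close>. By pigeonhole modulo
  \<open>d * i\<close> some \<open>x ^ l - x ^ k\<close> lies in \<open>R\<close>, which is a monic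
  equation for \<open>x\<close> whose constant term is an algebraic integer.\<close>

lemma stable_imp_integral:
  assumes I: "is_frac I" and x: "\<And>i. i \<in> I \<Longrightarrow> x * i \<in> I"
  shows "x \<in> R"
proof -
  obtain i where i: "i \<in> I" "i \<noteq> 0" using frac_nz[OF I] by blast
  obtain d where d: "d \<in> R" "d \<noteq> 0" "\<And>y. y \<in> I \<Longrightarrow> d * y \<in> R" using frac_denom[OF I] by blast
  have "x * i \<in> F" "i \<in> F" using frac_F[OF I] x i by blast+
  then have "(x * i) / i \<in> F" by (rule F_divide)
  then have xF: "x \<in> F" using i by simp
  have xi: "x ^ k * i \<in> I" for k by (induction k) (auto simp: i(1) mult.assoc x)
  define a where "a = d * i"
  have a: "a \<in> R" "a \<noteq> 0" using d i by (auto simp: a_def)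
  obtain C where C: "finite C" "\<And>y. y \<in> R \<Longrightarrow> \<exists>c\<in>C. (y - c) / a \<in> R"
    using residues[OF a] by metis
  have "\<exists>c\<in>C. (x ^ k * a - c) / a \<in> R" for k
  proof (rule C(2))
    show "x ^ k * a \<in> R" using d(3)[OF xi[of k]] by (simp add: a_def mult_ac)
  qed
  then obtain g where g: "\<And>k. g k \<in> C" "\<And>k. (x ^ k * a - g k) / a \<in> R" by metis
  obtain k l where kl: "k < l" "g k = g l" by (rule sequence_in_finite_set_repeats[OF C(1) g(1)])
  have "(x ^ l * a - g l) / a - (x ^ k * a - g k) / a \<in> R" by (intro R_diff g)
  then have "x ^ l - x ^ k \<in> R" using a(2) kl(2) by (simp add: diff_divide_distrib)
  then have A: "algebraic_int (x ^ l - x ^ k)" by (rule R_AI)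
  define p :: "complex poly" where "p = monom 1 l - monom 1 k"
  have cl: "coeff p i \<in> \<int>" for i by (simp add: p_def)
  have dp: "degree p = l"
  proof (rule antisym)
    show "degree p \<le> l" unfolding p_def using kl(1) by (intro degree_diff_le) (auto simp: degree_monom_eq)
    show "l \<le> degree p" using kl(1) by (intro le_degree) (simp add: p_def)
  qed
  have "algebraic_int x"
  proof (rule algebraic_int_root[OF A])
    show "poly p x = x ^ l - x ^ k" by (simp add: p_def poly_monom)
    show "lead_coeff p = 1" unfolding dp using kl(1) by (simp add: p_def)
    show "0 < degree p" using dp kl(1) by simp
  qed (simp add: cl)
  then show ?thesis using xF by (simp add: R_def)
qed

section \<open>Finite generation and Nakayama's lemma\<close>

definition R_span :: "complex set \<Rightarrow> complex set \<Rightarrow> complex set" where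
  "R_span B S = {\<Sum>s\<in>S. r s * s | r. \<forall>s\<in>S. r s \<in> B}"

text \<open>Generators are a nonzero \<open>a\<close> in \<open>I\<close> and one element of
  \<open>I\<close> for each residue class modulo \<open>d * a\<close> that is met by
  \<open>d\<close> times \<open>I\<close>: elements giving the same class differ by a multiple of
  \<open>a\<close>.\<close>

lemma frac_finitely_generated:
  assumes I: "is_frac I"
  obtains S where "finite S" "S \<subseteq> I" "I \<subseteq> R_span R S"
proof -
  obtain a where a: "a \<in> I" "a \<noteq> 0" using frac_nz[OF I] by blast
  obtain d where d: "d \<in> R" "d \<noteq> 0" "\<And>y. y \<in> I \<Longrightarrow> d * y \<in> R" using frac_denom[OF I] by blast
  define b where "b = d * a"
  have b: "b \<in> R" "b \<noteq> 0" using d a by (auto simp: b_def)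
  obtain C where C: "finite C" "\<And>y. y \<in> R \<Longrightarrow> \<exists>c\<in>C. (y - c) / b \<in> R"
    using residues[OF b] by metis
  define rep where "rep c = (SOME x. x \<in> I \<and> (d * x - c) / b \<in> R)" for c
  define T where "T = rep ` {c \<in> C. \<exists>x\<in>I. (d * x - c) / b \<in> R}"
  have rep: "rep c \<in> I \<and> (d * rep c - c) / b \<in> R" if "\<exists>x\<in>I. (d * x - c) / b \<in> R" for c
    unfolding rep_def by (rule someI_ex) (use that in blast)
  define S where "S = insert a T"
  have fin: "finite S" unfolding S_def T_def using C(1) by simp
  show thesis
  proof (rule that[OF fin])
    show "S \<subseteq> I" using a rep by (auto simp: S_def T_def)
    show "I \<subseteq> R_span R S"
    proof
      fix x assume x: "x \<in> I"
      then obtain c where c: "c \<in> C" "(d * x - c) / b \<in> R" using C(2)[OF d(3)[OF x]] by blast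
      then have ex: "\<exists>x\<in>I. (d * x - c) / b \<in> R" using x by blast
      define y where "y = rep c"
      have y: "y \<in> S" using c ex by (auto simp: S_def T_def y_def)
      define r where "r = (d * x - c) / b - (d * y - c) / b"
      have r: "r \<in> R" unfolding r_def y_def using c(2) rep[OF ex] by (blast intro: R_diff)
      have "r = (d * (x - y)) / (d * a)" by (simp add: r_def b_def diff_divide_distrib right_diff_distrib)
      then have "d * (x - y) = d * (r * a)" using d(2) a(2) by simp
      then have "x - y = r * a" using d(2) by (simp only: mult_cancel_left) simp
      then have xe: "x = r * a + 1 * y" by (simp add: algebra_simps)
      have aS: "a \<in> S" by (simp add: S_def)
      have "(\<Sum>s\<in>S. ((if s = a then r else 0) + (if s = y then 1 else 0)) * s) =
         (\<Sum>s\<in>S. if s = a then r * a else 0) + (\<Sum>s\<in>S. if s = y then y else 0)"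
        unfolding sum.distrib[symmetric] by (intro sum.cong) (auto simp: algebra_simps)
      also have "\<dots> = x" using fin aS y xe by simp
      finally show "x \<in> R_span R S" unfolding R_span_def using r
        by (auto intro!: exI[of _ "\<lambda>s. (if s = a then r else 0) + (if s = y then 1 else 0)"] R_intros)
    qed
  qed
qed

text \<open>Generators are eliminated one at a time: the relation for \<open>u\<close> gives
  \<open>c' * u\<close> as a combination of the others, and multiplying their relations by
  \<open>c'\<close> removes \<open>u\<close>. All multipliers stay congruent to 1 modulo
  \<open>B\<close>.\<close>

lemma nakayama_elimination:
  assumes B: "is_frac B" "B \<subseteq> R" and "finite S" "1 - c \<in> B"
    and "\<And>s. s \<in> S \<Longrightarrow> c * s \<in> R_span B S"
  shows "\<exists>e. 1 - e \<in> B \<and> (\<forall>s\<in>S. e * s = 0)"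
  using assms(3-5)
proof (induction S arbitrary: c rule: finite_induct)
  case empty
  then show ?case by auto
next
  case (insert u S)
  have one_minus_mult: "1 - x * y \<in> B" if "1 - x \<in> B" "1 - y \<in> B" for x y
  proof -
    have eq: "1 - x * y = (1 - x) + (1 - y) - (1 - x) * (1 - y)" by (simp add: algebra_simps)
    have "(1 - x) * (1 - y) \<in> B" using B(2) that by (intro frac_mult[OF B(1)]) auto
    from frac_diff[OF B(1) frac_add[OF B(1) that] this] show ?thesis unfolding eq .
  qed
  obtain b where b: "\<And>t. t \<in> insert u S \<Longrightarrow> b t \<in> B" "c * u = (\<Sum>t\<in>insert u S. b t * t)"
    using insert.prems(2)[of u] unfolding R_span_def by auto
  define c' where "c' = c - b u"
  have c': "1 - c' \<in> B" using frac_add[OF B(1) insert.prems(1) b(1)[of u]] by (simp add: c'_def algebra_simps)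
  have c'u: "c' * u = (\<Sum>t\<in>S. b t * t)" using b(2) insert.hyps by (simp add: c'_def algebra_simps)
  have "c' * c * s \<in> R_span B S" if s: "s \<in> S" for s
  proof -
    obtain r where r: "\<And>t. t \<in> insert u S \<Longrightarrow> r t \<in> B" "c * s = (\<Sum>t\<in>insert u S. r t * t)"
      using insert.prems(2)[of s] s unfolding R_span_def by auto
    have "c' * c * s = r u * (c' * u) + (\<Sum>t\<in>S. c' * r t * t)"
      using r(2) insert.hyps by (simp add: mult.assoc distrib_left sum_distrib_left mult.left_commute)
    also have "\<dots> = (\<Sum>t\<in>S. (r u * b t + c' * r t) * t)"
      unfolding c'u by (simp add: sum_distrib_left sum.distrib algebra_simps)
    finally have eq: "c' * c * s = (\<Sum>t\<in>S. (r u * b t + c' * r t) * t)" .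
    have c'R: "c' \<in> R" using c' B(2) R_diff[OF R_1, of "1 - c'"] by auto
    have "r u * b t + c' * r t \<in> B" if "t \<in> S" for t
      using that r(1) b(1) B(2) c'R by (intro frac_add[OF B(1)] frac_mult[OF B(1)]) auto
    then show ?thesis unfolding R_span_def using eq by (auto intro!: exI[of _ "\<lambda>t. r u * b t + c' * r t"])
  qed
  then obtain e where e: "1 - e \<in> B" "\<And>s. s \<in> S \<Longrightarrow> e * s = 0"
    using insert.IH[of "c' * c"] one_minus_mult[OF c' insert.prems(1)] by auto
  have "e * c' * u = (\<Sum>t\<in>S. b t * (e * t))"
    by (simp add: mult.assoc c'u sum_distrib_left mult.left_commute)
  also have "\<dots> = 0" 
  proof (rule sum.neutral, rule ballI)
    fix t assume "t \<in> S"
    from e(2)[OF this] show "b t * (e * t) = 0" by (simp only: mult_zero_right)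
  qed
  finally have "e * c' * u = 0" .
  moreover have "e * c' * s = 0" if "s \<in> S" for s using e(2)[OF that] by (simp add: mult_ac)
  ultimately show ?case using one_minus_mult[OF e(1) c'] by (intro exI[of _ "e * c'"]) auto
qed

text \<open>Some \<open>e\<close> congruent to 1 modulo \<open>B\<close> kills all generators of
  \<open>A\<close>; one of them is a nonzero complex number, so \<open>e = 0\<close>.\<close>

lemma set_prod_eq_self_imp_one:
  assumes A: "is_frac A" and B: "is_frac B" "B \<subseteq> R" and eq: "A \<star> B = A"
  shows "1 \<in> B"
proof -
  obtain S where S: "finite S" "S \<subseteq> A" "A \<subseteq> R_span R S" using frac_finitely_generated[OF A] by blast
  have "x \<in> R_span B S" if "x \<in> A \<star> B" for x
    using that
  proof (induction rule: set_prod_induct)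
    case (prod a b)
    then obtain r where r: "\<And>s. s \<in> S \<Longrightarrow> r s \<in> R" "a = (\<Sum>s\<in>S. r s * s)"
      using S(3) unfolding R_span_def by auto
    have "a * b = (\<Sum>s\<in>S. (r s * b) * s)" unfolding r(2) sum_distrib_right by (intro sum.cong refl) (simp only: mult_ac)
    then show ?case unfolding R_span_def using r(1) frac_mult[OF B(1)] prod
      by (auto intro!: exI[of _ "\<lambda>s. r s * b"])
  next
    case (sum x y)
    then obtain f g where "\<And>s. s \<in> S \<Longrightarrow> f s \<in> B" "x = (\<Sum>s\<in>S. f s * s)"
      "\<And>s. s \<in> S \<Longrightarrow> g s \<in> B" "y = (\<Sum>s\<in>S. g s * s)" unfolding R_span_def by auto
    then show ?case unfolding R_span_def using frac_add[OF B(1)]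
      by (auto intro!: exI[of _ "\<lambda>s. f s + g s"] simp: sum.distrib distrib_right)
  qed
  then have "1 * s \<in> R_span B S" if "s \<in> S" for s using that S(2) eq by auto
  moreover have "1 - 1 \<in> B" using frac_0[OF B(1)] by simp
  ultimately obtain e where e: "1 - e \<in> B" "\<And>s. s \<in> S \<Longrightarrow> e * s = 0"
    using nakayama_elimination[OF B S(1), of 1] by blast
  obtain s where "s \<in> S" "s \<noteq> 0"
  proof (rule ccontr)
    assume "\<not> thesis"
    then have S0: "\<And>s. s \<in> S \<Longrightarrow> s = 0" using that by blast
    have "x = 0" if x: "x \<in> A" for x
    proof -
      obtain r where "x = (\<Sum>s\<in>S. r s * s)" using x S(3) unfolding R_span_def by blast
      moreover have "(\<Sum>s\<in>S. r s * s) = 0"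
      proof (rule sum.neutral, rule ballI)
        fix s assume "s \<in> S"
        from S0[OF this] show "r s * s = 0" by simp
      qed
      ultimately show ?thesis by simp
    qed
    then show False using frac_nz[OF A] by blast
  qed
  then have "e = 0" using e(2) by fastforce
  then show ?thesis using e(1) by simp
qed

section \<open>Integral ideals and prime ideals\<close>

definition is_ideal :: "complex set \<Rightarrow> bool" where
  "is_ideal I \<longleftrightarrow> is_frac I \<and> I \<subseteq> R"

lemma is_idealI:
  assumes "I \<subseteq> R" "0 \<in> I" "\<And>x y. x \<in> I \<Longrightarrow> y \<in> I \<Longrightarrow> x + y \<in> I"
    "\<And>r x. r \<in> R \<Longrightarrow> x \<in> I \<Longrightarrow> r * x \<in> I" "a \<in> I" "a \<noteq> 0"
  shows "is_ideal I"
proof -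
  have "\<exists>d\<in>R. d \<noteq> 0 \<and> (\<forall>x\<in>I. d * x \<in> R)" using R_1 assms(1) by (intro bexI[of _ 1]) auto
  then show ?thesis unfolding is_ideal_def is_frac_def using assms by blast
qed

lemma ideal_frac: "is_ideal I \<Longrightarrow> is_frac I" and ideal_R: "is_ideal I \<Longrightarrow> x \<in> I \<Longrightarrow> x \<in> R"
  by (auto simp: is_ideal_def)

lemma ideal_one: "is_ideal I \<Longrightarrow> 1 \<in> I \<Longrightarrow> I = R"
  using frac_mult[of I _ 1] by (auto simp: is_ideal_def)

text \<open>An ideal containing \<open>a\<close> is determined by which of the finitely many
  representatives modulo \<open>a\<close> it contains.\<close>

lemma finite_ideals_containing:
  assumes a: "a \<in> R" "a \<noteq> 0" shows "finite {I. is_ideal I \<and> a \<in> I}"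
proof -
  obtain C where C: "finite C" "C \<subseteq> R" "\<And>x. x \<in> R \<Longrightarrow> \<exists>c\<in>C. (x - c) / a \<in> R"
    using residues[OF a] by metis
  have eq: "I = {x \<in> R. \<exists>c\<in>C \<inter> I. (x - c) / a \<in> R}" if I: "is_ideal I" "a \<in> I" for I
  proof (intro subset_antisym subsetI)
    fix x assume x: "x \<in> I"
    then have xR: "x \<in> R" using I ideal_R by blast
    obtain c where c: "c \<in> C" "(x - c) / a \<in> R" using C(3)[OF xR] by blast
    have "(x - c) / a * a \<in> I" using frac_mult[OF ideal_frac[OF I(1)] c(2) I(2)] .
    then have "x - c \<in> I" using a by simp
    then have "x - (x - c) \<in> I" using frac_diff[OF ideal_frac[OF I(1)] x] by blast
    then show "x \<in> {x \<in> R. \<exists>c\<in>C \<inter> I. (x - c) / a \<in> R}" using c xR by auto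
  next
    fix x assume "x \<in> {x \<in> R. \<exists>c\<in>C \<inter> I. (x - c) / a \<in> R}"
    then obtain c where c: "c \<in> I" "(x - c) / a \<in> R" by blast
    have "(x - c) / a * a \<in> I" using frac_mult[OF ideal_frac[OF I(1)] c(2) I(2)] .
    then have "x - c \<in> I" using a by simp
    from frac_add[OF ideal_frac[OF I(1)] this c(1)] show "x \<in> I" by simp
  qed
  have "inj_on (\<lambda>I. C \<inter> I) {I. is_ideal I \<and> a \<in> I}"
  proof (rule inj_onI)
    fix I J assume IJ: "I \<in> {I. is_ideal I \<and> a \<in> I}" "J \<in> {I. is_ideal I \<and> a \<in> I}" "C \<inter> I = C \<inter> J"
    have "I = {x \<in> R. \<exists>c\<in>C \<inter> I. (x - c) / a \<in> R}" using IJ(1) by (intro eq) auto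
    also have "\<dots> = {x \<in> R. \<exists>c\<in>C \<inter> J. (x - c) / a \<in> R}" by (simp only: IJ(3))
    also have "\<dots> = J" using IJ(2) by (intro eq[symmetric]) auto
    finally show "I = J" .
  qed
  moreover have "finite ((\<lambda>I. C \<inter> I) ` {I. is_ideal I \<and> a \<in> I})"
    by (rule finite_subset[of _ "Pow C"]) (auto simp: C(1))
  ultimately show ?thesis by (rule finite_imageD[rotated])
qed

definition is_prime :: "complex set \<Rightarrow> bool" where
  "is_prime P \<longleftrightarrow> is_ideal P \<and> 1 \<notin> P \<and> (\<forall>x\<in>R. \<forall>y\<in>R. x * y \<in> P \<longrightarrow> x \<in> P \<or> y \<in> P)"

text \<open>Only finitely many ideals contain a given nonzero element of \<open>I\<close>, so there
  is a maximal proper one above \<open>I\<close>; maximality against the sum of \<open>P\<close> and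
  the multiples of \<open>x\<close> shows that it is prime.\<close>

lemma ideal_contained_in_prime:
  assumes I: "is_ideal I" "1 \<notin> I"
  obtains P where "is_prime P" "I \<subseteq> P"
proof -
  obtain a where a: "a \<in> I" "a \<noteq> 0" using frac_nz[OF ideal_frac[OF I(1)]] by blast
  have aR: "a \<in> R" using a I ideal_R by blast
  define \<A> where "\<A> = {J. is_ideal J \<and> 1 \<notin> J \<and> I \<subseteq> J}"
  have "finite \<A>" by (rule finite_subset[OF _ finite_ideals_containing[OF aR a(2)]]) (use a in \<open>auto simp: \<A>_def\<close>)
  moreover have "I \<in> \<A>" using I by (simp add: \<A>_def)
  ultimately obtain P where P: "P \<in> \<A>" "\<And>J. J \<in> \<A> \<Longrightarrow> P \<subseteq> J \<Longrightarrow> P = J"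
    using finite_has_maximal[of \<A>] by blast
  have Pi: "is_ideal P" "1 \<notin> P" "I \<subseteq> P" using P(1) by (auto simp: \<A>_def)
  note fP = ideal_frac[OF Pi(1)]
  have "x \<in> P \<or> y \<in> P" if xy: "x \<in> R" "y \<in> R" "x * y \<in> P" for x y
  proof (rule ccontr)
    assume n: "\<not> (x \<in> P \<or> y \<in> P)"
    define J where "J = {p + x * r | p r. p \<in> P \<and> r \<in> R}"
    have PJ: "P \<subseteq> J"
    proof
      fix p assume "p \<in> P"
      then show "p \<in> J" unfolding J_def using R_0 by (intro CollectI exI[of _ p] exI[of _ 0]) simp
    qed
    have xJ: "x \<in> J" unfolding J_def using frac_0[OF fP] R_1 by (intro CollectI exI[of _ 0] exI[of _ 1]) simp
    have "is_ideal J"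
    proof (rule is_idealI[of J a])
      show "J \<subseteq> R" unfolding J_def using Pi(1) ideal_R xy(1) by (auto intro!: R_intros)
      show "0 \<in> J" using PJ frac_0[OF fP] by blast
      show "u + v \<in> J" if uv: "u \<in> J" "v \<in> J" for u v
      proof -
        obtain p r where "u = p + x * r" "p \<in> P" "r \<in> R" using uv(1) unfolding J_def by blast
        moreover obtain p' r' where "v = p' + x * r'" "p' \<in> P" "r' \<in> R" using uv(2) unfolding J_def by blast
        ultimately show ?thesis unfolding J_def
          by (intro CollectI exI[of _ "p + p'"] exI[of _ "r + r'"]) (auto simp: algebra_simps intro: frac_add[OF fP] R_add)
      qed
      show "s * u \<in> J" if su: "s \<in> R" "u \<in> J" for s u
      proof -
        obtain p r where "u = p + x * r" and pr: "p \<in> P" "r \<in> R" using su(2) unfolding J_def by blast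
        then have "s * u = s * p + x * (s * r)" by (simp add: algebra_simps)
        then show ?thesis unfolding J_def
          using frac_mult[OF fP su(1) pr(1)] R_mult[OF su(1) pr(2)] by blast
      qed
      show "a \<in> J" using a Pi PJ by blast
    qed (rule a(2))
    moreover have "J \<noteq> P" using xJ n by blast
    ultimately have "1 \<in> J" using P(2)[of J] PJ Pi(3) unfolding \<A>_def by blast
    then obtain p r where pr: "1 = p + x * r" "p \<in> P" "r \<in> R" unfolding J_def by blast
    have "y = y * p + r * (x * y)" using pr(1) by (metis distrib_left mult.commute mult.left_commute mult_1_right)
    also have "\<dots> \<in> P" 
      by (rule frac_add[OF fP frac_mult[OF fP xy(2) pr(2)] frac_mult[OF fP pr(3) xy(3)]])
    finally show False using n by blast
  qed
  then have "is_prime P" using Pi by (simp add: is_prime_def)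
  then show thesis using that Pi(3) by blast
qed

text \<open>Divide \<open>I\<close> by a generator \<open>b\<close> of a prime containing it. The
  quotient is strictly larger, since otherwise \<open>inverse b\<close> would stabilise
  \<open>I\<close> and be integral; as only finitely many ideals contain \<open>a\<close>, the
  process ends at \<open>R\<close>. It is used contrapositively, to extract a non-principal prime
  from a non-principal ideal.\<close>

lemma principal_if_primes_principal:
  assumes a: "a \<in> R" "a \<noteq> 0"
    and pr: "\<And>P. is_prime P \<Longrightarrow> a \<in> P \<Longrightarrow> \<exists>b\<in>F. b \<noteq> 0 \<and> P = scale b R"
    and I: "is_ideal I" "a \<in> I"
  shows "\<exists>b\<in>F. b \<noteq> 0 \<and> I = scale b R"
  using I
proof (induction "card {J. is_ideal J \<and> a \<in> J \<and> I \<subset> J}" arbitrary: I rule: less_induct)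
  case less
  show ?case
  proof (cases "1 \<in> I")
    case True
    then show ?thesis using ideal_one[OF less.prems(1)] F_1 by (intro bexI[of _ 1]) auto
  next
    case False
    obtain P where P: "is_prime P" "I \<subseteq> P" using ideal_contained_in_prime[OF less.prems(1) False] .
    then obtain b where b: "b \<in> F" "b \<noteq> 0" "P = scale b R" using pr less.prems(2) by blast
    have bP: "b \<in> P" using b(3) R_1 by (auto intro: image_eqI[of _ _ 1])
    then have bR: "b \<in> R" using P(1) unfolding is_prime_def using ideal_R by blast
    define J where "J = scale (inverse b) I"
    have IbJ: "I = scale b J" using b(2) by (simp add: J_def scale_scale del: image_image)
    have "is_frac J" unfolding J_def using b by (intro frac_scale ideal_frac less.prems F_inverse) auto
    moreover have "J \<subseteq> R"
    proof
      fix y assume "y \<in> J"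
      then obtain x where x: "x \<in> I" "y = inverse b * x" unfolding J_def by blast
      then obtain r where "r \<in> R" "x = b * r" using P(2) b(3) by blast
      then show "y \<in> R" using b(2) x(2) by (simp add: mult.assoc[symmetric])
    qed
    ultimately have J: "is_ideal J" by (simp add: is_ideal_def)
    have IJ: "I \<subseteq> J" using IbJ frac_mult[OF ideal_frac[OF J] bR] by auto
    have "I \<noteq> J"
    proof
      assume "I = J"
      then have "inverse b * i \<in> I" if "i \<in> I" for i using that J_def by auto
      then have "inverse b \<in> R" by (rule stable_imp_integral[OF ideal_frac[OF less.prems(1)]])
      then have "b * inverse b \<in> P" unfolding b(3) by blast
      then show False using b(2) P(1) by (simp add: is_prime_def)
    qed
    then have "{K. is_ideal K \<and> a \<in> K \<and> J \<subset> K} \<subset> {K. is_ideal K \<and> a \<in> K \<and> I \<subset> K}"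
      using IJ J less.prems(2) by blast
    then have "card {K. is_ideal K \<and> a \<in> K \<and> J \<subset> K} < card {K. is_ideal K \<and> a \<in> K \<and> I \<subset> K}"
      by (intro psubset_card_mono finite_subset[OF _ finite_ideals_containing[OF a]]) auto
    then obtain e where e: "e \<in> F" "e \<noteq> 0" "J = scale e R"
      using less.hyps[of J] J IJ less.prems(2) by blast
    then have "I = scale (b * e) R" using IbJ by (simp add: scale_scale del: image_image)
    then show ?thesis using b e by (intro bexI[of _ "b * e"]) (auto intro: F_mult)
  qed
qed

end

section \<open>The class group\<close>

context integer_ring
begin

section \<open>Translation to the rings, primes and fractional ideals of the definitions\<close>

lemma ring_of_integers_simps [simp]:
  "carrier (ring_of_integers F) = R" "x \<otimes>\<^bsub>ring_of_integers F\<^esub> y = x * y"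
  "x \<oplus>\<^bsub>ring_of_integers F\<^esub> y = x + y" "\<one>\<^bsub>ring_of_integers F\<^esub> = 1" "\<zero>\<^bsub>ring_of_integers F\<^esub> = 0"
  by (simp_all add: ring_of_integers_def R_def ring_of_type_algebra_def)

lemma cring_ring_of_integers: "cring (ring_of_integers F)"
proof (rule cringI)
  show "abelian_group (ring_of_integers F)"
  proof (rule abelian_groupI)
    show "\<exists>y\<in>carrier (ring_of_integers F). y \<oplus>\<^bsub>ring_of_integers F\<^esub> x = \<zero>\<^bsub>ring_of_integers F\<^esub>"
      if "x \<in> carrier (ring_of_integers F)" for x
      using that R_minus by (intro bexI[of _ "- x"]) auto
  qed (auto intro: R_0 R_add)
  show "Group.comm_monoid (ring_of_integers F)"
    by (rule comm_monoidI) (auto intro: R_1 R_mult)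
qed (auto simp: distrib_right)

lemma a_inv_ring_of_integers: "x \<in> R \<Longrightarrow> \<ominus>\<^bsub>ring_of_integers F\<^esub> x = - x"
proof -
  assume x: "x \<in> R"
  interpret cring "ring_of_integers F" by (rule cring_ring_of_integers)
  show ?thesis using minus_equality[of "- x" x] x R_minus by simp
qed

lemma HOL_ideal_iff: "ideal I (ring_of_integers F) \<and> I \<noteq> {0} \<longleftrightarrow> is_ideal I"
proof
  assume I: "ideal I (ring_of_integers F) \<and> I \<noteq> {0}"
  then interpret ideal I "ring_of_integers F" by simp
  have z: "0 \<in> I" using additive_subgroup.zero_closed[OF is_additive_subgroup] by simp
  with I obtain a where "a \<in> I" "a \<noteq> 0" by blast
  moreover have "I \<subseteq> R" using a_subset by simp
  moreover have "x + y \<in> I" if "x \<in> I" "y \<in> I" for x y using additive_subgroup.a_closed[OF is_additive_subgroup that] by simp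
  moreover have "r * x \<in> I" if "r \<in> R" "x \<in> I" for r x using I_l_closed[OF that(2), of r] that by simp
  ultimately show "is_ideal I" using z by (intro is_idealI) auto
next
  assume I: "is_ideal I"
  note f = ideal_frac[OF I]
  interpret cring "ring_of_integers F" by (rule cring_ring_of_integers)
  have "ideal I (ring_of_integers F)"
  proof (rule idealI)
    show "subgroup I (add_monoid (ring_of_integers F))"
    proof (rule group.subgroupI[OF add.group_axioms])
      show "I \<subseteq> carrier (add_monoid (ring_of_integers F))" using ideal_R[OF I] by auto
      show "I \<noteq> {}" using frac_0[OF f] by blast
      show "inv\<^bsub>add_monoid (ring_of_integers F)\<^esub> a \<in> I" if "a \<in> I" for a
      proof -
        have "inv\<^bsub>add_monoid (ring_of_integers F)\<^esub> a = - a"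
          using a_inv_ring_of_integers[OF ideal_R[OF I that]] by (simp add: a_inv_def)
        then show ?thesis using frac_diff[OF f frac_0[OF f] that] by simp
      qed
      show "a \<otimes>\<^bsub>add_monoid (ring_of_integers F)\<^esub> b \<in> I" if "a \<in> I" "b \<in> I" for a b
        using frac_add[OF f that] by simp
    qed
    show "x \<otimes>\<^bsub>ring_of_integers F\<^esub> a \<in> I" if "a \<in> I" "x \<in> carrier (ring_of_integers F)" for a x
      using frac_mult[OF f _ that(1), of x] that(2) by simp
    show "a \<otimes>\<^bsub>ring_of_integers F\<^esub> x \<in> I" if "a \<in> I" "x \<in> carrier (ring_of_integers F)" for a x
      using frac_mult[OF f _ that(1), of x] that(2) by (simp add: mult.commute)
  qed (rule ring_axioms)
  moreover have "I \<noteq> {0}" using frac_nz[OF f] by blast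
  ultimately show "ideal I (ring_of_integers F) \<and> I \<noteq> {0}" by blast
qed

lemma prime_ideals_eq: "prime_ideals F = {P. is_prime P}"
proof (intro subset_antisym subsetI CollectI)
  fix P assume "P \<in> prime_ideals F"
  then have P: "primeideal P (ring_of_integers F)" "P \<noteq> {0}" by (auto simp: prime_ideals_def)
  have I: "is_ideal P" using P HOL_ideal_iff primeideal.axioms(1) by blast
  have "1 \<notin> P" using primeideal.I_notcarr[OF P(1)] ideal_one[OF I] by auto
  moreover have "x \<in> P \<or> y \<in> P" if "x \<in> R" "y \<in> R" "x * y \<in> P" for x y
    using primeideal.I_prime[OF P(1), of x y] that by simp
  ultimately show "is_prime P" using I by (simp add: is_prime_def)
next
  fix P assume "P \<in> {P. is_prime P}"
  then have P: "is_prime P" by simp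
  then have I: "ideal P (ring_of_integers F)" "P \<noteq> {0}" using HOL_ideal_iff by (auto simp: is_prime_def)
  have "primeideal P (ring_of_integers F)"
  proof (rule primeidealI[OF I(1) cring_ring_of_integers])
    show "carrier (ring_of_integers F) \<noteq> P" using P R_1 by (auto simp: is_prime_def)
  qed (use P in \<open>auto simp: is_prime_def\<close>)
  then show "P \<in> prime_ideals F" using I by (simp add: prime_ideals_def)
qed

lemma fractional_ideals_eq: "fractional_ideals F = {I. is_frac I}"
proof (intro subset_antisym subsetI CollectI)
  fix I assume "I \<in> fractional_ideals F"
  then obtain d J where d: "d \<in> R" "d \<noteq> 0" "is_ideal J" "I = (\<lambda>x. x / d) ` J"
    unfolding fractional_ideals_def using HOL_ideal_iff by auto
  have "I = scale (inverse d) J" unfolding d(4) by (simp add: divide_inverse mult.commute)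
  moreover have "is_frac (scale (inverse d) J)"
    using d by (intro frac_scale ideal_frac F_inverse R_F) auto
  ultimately show "is_frac I" by simp
next
  fix I assume "I \<in> {I. is_frac I}"
  then have I: "is_frac I" by simp
  obtain d where d: "d \<in> R" "d \<noteq> 0" "\<And>x. x \<in> I \<Longrightarrow> d * x \<in> R" using frac_denom[OF I] by blast
  have "is_ideal (scale d I)" unfolding is_ideal_def
    using d by (auto intro!: frac_scale I R_F)
  moreover have "I = (\<lambda>x. x / d) ` scale d I" using d(2) by (simp add: image_image)
  ultimately show "I \<in> fractional_ideals F"
    unfolding fractional_ideals_def using d HOL_ideal_iff
    by (intro CollectI exI[of _ d] exI[of _ "scale d I"]) auto
qed

definition principal :: "complex set \<Rightarrow> bool" where
  "principal I \<longleftrightarrow> (\<exists>a\<in>F. a \<noteq> 0 \<and> I = scale a R)"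

lemma principal_eq: "principal_fractional_ideals F = {I. principal I}"
  by (auto simp: principal_fractional_ideals_def principal_def)

lemma principal_frac: "principal I \<Longrightarrow> is_frac I"
  unfolding principal_def using frac_scale[OF frac_R] by blast

lemma ideal_group_simps [simp]:
  "carrier (ideal_group F) = {I. is_frac I}" "I \<otimes>\<^bsub>ideal_group F\<^esub> J = I \<star> J" "\<one>\<^bsub>ideal_group F\<^esub> = R"
  by (simp_all add: ideal_group_def fractional_ideals_eq)

text \<open>Computed directly from the definition of cosets, so that it is available before the
  fractional ideals are known to form a group.\<close>

lemma coset_eq_scales:
  assumes "is_frac I"
  shows "principal_fractional_ideals F #>\<^bsub>ideal_group F\<^esub> I = {scale a I | a. a \<in> F \<and> a \<noteq> 0}"
proof -
  have "scale a R \<star> I = scale a I" for a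
    using set_prod_scale[of a R I] set_prod_R[OF assms] by (simp add: set_prod_commute)
  then show ?thesis unfolding r_coset_def principal_eq principal_def by auto
qed

text \<open>Iterated products, usable before \<open>ideal_group F\<close> is known to be a group;
  \<open>ideal_group_pow\<close> later identifies them with its powers.\<close>

definition ideal_power :: "complex set \<Rightarrow> nat \<Rightarrow> complex set" where
  "ideal_power I k = ((\<star>) I ^^ k) R"

lemma ideal_power_0: "ideal_power I 0 = R" and ideal_power_Suc: "ideal_power I (Suc k) = I \<star> ideal_power I k"
  by (simp_all add: ideal_power_def)

lemma ideal_power_frac: "is_frac I \<Longrightarrow> is_frac (ideal_power I k)"
  by (induction k) (auto simp: ideal_power_0 ideal_power_Suc frac_R frac_set_prod)

lemma ideal_power_add: "is_frac I \<Longrightarrow> ideal_power I (k + l) = ideal_power I k \<star> ideal_power I l"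
proof (induction k)
  case 0
  then show ?case using set_prod_R[OF ideal_power_frac[OF 0], of l] by (simp add: ideal_power_0 set_prod_commute)
qed (simp add: ideal_power_Suc set_prod_assoc)

lemma ideal_power_in: "x \<in> I \<Longrightarrow> x ^ k \<in> ideal_power I k"
  by (induction k) (auto simp: ideal_power_0 ideal_power_Suc R_1 intro: set_prod_prod)

text \<open>
  Finiteness of the set of cosets of the principal ideals is all that is available before the
  fractional ideals are known to form a group: among the powers of \<open>I\<close> two lie in the same coset,
  and Nakayama's lemma cancels the smaller one.
\<close>

lemma frac_invertible:
  assumes cn: "class_number F \<noteq> 0" and I: "is_frac I"
  obtains J where "is_frac J" "I \<star> J = R"
proof -
  define coset where "coset k = principal_fractional_ideals F #>\<^bsub>ideal_group F\<^esub> ideal_power I k" for k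
  \<comment> \<open>The order of an infinite carrier is 0, so a nonzero class number means
    finiteness.\<close>
  have "finite (carrier (class_group F))"
    using cn unfolding class_number_def Coset.order_def by (meson card.infinite)
  moreover have "coset i \<in> carrier (class_group F)" for i
    unfolding coset_def class_group_def carrier_FactGroup using ideal_power_frac[OF I] by auto
  ultimately obtain i j where ij: "i < j" "coset i = coset j" by (rule sequence_in_finite_set_repeats)
  have "ideal_power I i \<in> coset i"
    unfolding coset_def coset_eq_scales[OF ideal_power_frac[OF I]] using F_1 by (intro CollectI exI[of _ 1]) auto
  then obtain x where x: "x \<in> F" "x \<noteq> 0" "ideal_power I i = scale x (ideal_power I j)"
    unfolding ij(2) unfolding coset_def coset_eq_scales[OF ideal_power_frac[OF I]] by auto
  define A where "A = ideal_power I i"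
  define C where "C = scale x (ideal_power I (j - i))"
  have fA: "is_frac A" unfolding A_def by (rule ideal_power_frac[OF I])
  have fC: "is_frac C" unfolding C_def by (intro frac_scale ideal_power_frac I x)
  have "A \<star> C = scale x (ideal_power I (j - i) \<star> ideal_power I i)"
    unfolding C_def A_def using set_prod_scale set_prod_commute by metis
  also have "ideal_power I (j - i) \<star> ideal_power I i = ideal_power I j"
    using ideal_power_add[OF I, of "j - i" i] ij(1) by simp
  finally have AC: "A \<star> C = A" using x(3) by (simp only: A_def)
  \<comment> \<open>By \<open>AC\<close> each element of \<open>C\<close> stabilises
    \<open>A\<close>, hence is integral.\<close>
  have CR: "C \<subseteq> R"
  proof
    fix c assume c: "c \<in> C"
    show "c \<in> R"
    proof (rule stable_imp_integral[OF fA])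
      fix a assume "a \<in> A"
      then show "c * a \<in> A" using set_prod_prod[OF _ c, of a A] AC by (simp add: mult.commute)
    qed
  qed
  have "C = R" using set_prod_eq_self_imp_one[OF fA fC CR AC] ideal_one fC CR by (simp add: is_ideal_def)
  moreover have "C = I \<star> scale x (ideal_power I (j - i - 1))"
  proof -
    have "j - i = Suc (j - i - 1)" using ij(1) by simp
    then have "ideal_power I (j - i) = I \<star> ideal_power I (j - i - 1)" by (metis ideal_power_Suc)
    then have "C = scale x (ideal_power I (j - i - 1) \<star> I)" by (simp add: C_def set_prod_commute)
    then show ?thesis by (metis set_prod_scale set_prod_commute)
  qed
  moreover have "is_frac (scale x (ideal_power I (j - i - 1)))"
    by (intro frac_scale ideal_power_frac I x)
  ultimately show thesis using that by simp
qed

end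

locale finite_class_number = integer_ring +
  assumes class_number_nz: "class_number F \<noteq> 0"
begin

lemma comm_group_ideal_group: "comm_group (ideal_group F)"
proof (rule comm_groupI)
  fix I assume "I \<in> carrier (ideal_group F)"
  then have I: "is_frac I" by simp
  obtain J where "is_frac J" "I \<star> J = R" using frac_invertible[OF class_number_nz I] .
  then show "\<exists>J\<in>carrier (ideal_group F). J \<otimes>\<^bsub>ideal_group F\<^esub> I = \<one>\<^bsub>ideal_group F\<^esub>"
    by (auto simp: set_prod_commute)
next
  fix I assume "I \<in> carrier (ideal_group F)"
  then show "\<one>\<^bsub>ideal_group F\<^esub> \<otimes>\<^bsub>ideal_group F\<^esub> I = I"
    using set_prod_R[of I] by (simp add: set_prod_commute)
qed (simp_all add: frac_set_prod frac_R set_prod_assoc, rule set_prod_commute)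

sublocale IG: comm_group "ideal_group F" by (rule comm_group_ideal_group)

lemma normal_principal: "normal (principal_fractional_ideals F) (ideal_group F)"
proof (rule IG.subgroup_imp_normal, rule IG.subgroupI)
  have RR: "scale a R \<star> scale b R = scale (a * b) R" for a b
  proof -
    have "scale a R \<star> scale b R = scale a (scale b R \<star> R)" by (metis set_prod_scale set_prod_commute)
    also have "\<dots> = scale a (scale b (R \<star> R))" by (simp only: set_prod_scale)
    finally show ?thesis by (simp only: set_prod_R[OF frac_R] scale_scale)
  qed
  show "principal_fractional_ideals F \<subseteq> carrier (ideal_group F)"
    using principal_frac by (auto simp: principal_eq)
  have "principal R" unfolding principal_def using F_1 by (intro bexI[of _ 1]) auto
  then show "principal_fractional_ideals F \<noteq> {}" by (auto simp: principal_eq)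
  show "I \<otimes>\<^bsub>ideal_group F\<^esub> J \<in> principal_fractional_ideals F"
    if IJ: "I \<in> principal_fractional_ideals F" "J \<in> principal_fractional_ideals F" for I J
  proof -
    obtain a b where "a \<in> F" "a \<noteq> 0" "I = scale a R" "b \<in> F" "b \<noteq> 0" "J = scale b R"
      using IJ by (auto simp: principal_eq principal_def)
    then show ?thesis using RR[of a b] by (auto simp: principal_eq principal_def intro!: bexI[of _ "a * b"] F_mult)
  qed
  show "inv\<^bsub>ideal_group F\<^esub> I \<in> principal_fractional_ideals F"
    if I: "I \<in> principal_fractional_ideals F" for I
  proof -
    obtain a where a: "a \<in> F" "a \<noteq> 0" "I = scale a R" using I by (auto simp: principal_eq principal_def)
    have p: "principal (scale (inverse a) R)"
      unfolding principal_def using a by (intro bexI[of _ "inverse a"]) (auto intro: F_inverse)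
    have "inv\<^bsub>ideal_group F\<^esub> I = scale (inverse a) R"
    proof (rule IG.inv_equality)
      show "scale (inverse a) R \<otimes>\<^bsub>ideal_group F\<^esub> I = \<one>\<^bsub>ideal_group F\<^esub>"
        using RR[of "inverse a" a] a by simp
      show "I \<in> carrier (ideal_group F)" "scale (inverse a) R \<in> carrier (ideal_group F)"
        using a p principal_frac by (auto simp: principal_def)
    qed
    then show ?thesis using p by (simp add: principal_eq)
  qed
qed

lemma comm_group_class_group: "comm_group (class_group F)"
  unfolding class_group_def
  using IG.abelian_FactGroup normal_principal normal.axioms(1) by blast

sublocale CG: comm_group "class_group F" by (rule comm_group_class_group)

lemma ideal_class_in_carrier: "is_frac I \<Longrightarrow> ideal_class F I \<in> carrier (class_group F)"
  unfolding ideal_class_def class_group_def carrier_FactGroup by auto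

lemma ideal_class_eq_one_iff:
  assumes "is_frac I" shows "ideal_class F I = \<one>\<^bsub>class_group F\<^esub> \<longleftrightarrow> principal I"
proof
  have sub: "subgroup (principal_fractional_ideals F) (ideal_group F)"
    using normal_principal normal.axioms(1) by blast
  {
    assume "ideal_class F I = \<one>\<^bsub>class_group F\<^esub>"
    then have "principal_fractional_ideals F #>\<^bsub>ideal_group F\<^esub> I = principal_fractional_ideals F"
      by (simp add: ideal_class_def class_group_def)
    then show "principal I" using IG.rcos_self[OF _ sub, of I] assms by (simp add: principal_eq)
  next
    assume "principal I"
    then show "ideal_class F I = \<one>\<^bsub>class_group F\<^esub>"
      using IG.coset_join2[OF _ sub, of I] assms by (simp add: ideal_class_def class_group_def principal_eq)
  }
qed

lemma ideal_group_pow: "is_frac I \<Longrightarrow> I [^]\<^bsub>ideal_group F\<^esub> (k::nat) = ideal_power I k"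
  by (induction k) (auto simp: ideal_power_0 ideal_power_Suc set_prod_commute)

lemma principal_class_number_power:
  assumes "is_frac I" shows "principal (ideal_power I (class_number F))"
proof -
  have "ideal_class F I [^]\<^bsub>class_group F\<^esub> Coset.order (class_group F) = \<one>\<^bsub>class_group F\<^esub>"
    by (rule CG.pow_order_eq_1[OF ideal_class_in_carrier[OF assms]])
  also have "ideal_class F I [^]\<^bsub>class_group F\<^esub> Coset.order (class_group F) =
      ideal_class F (I [^]\<^bsub>ideal_group F\<^esub> Coset.order (class_group F))"
    unfolding class_group_def ideal_class_def
    by (rule normal.FactGroup_pow[OF normal_principal]) (use assms in simp)
  also have "\<dots> = ideal_class F (ideal_power I (class_number F))"
    by (simp add: ideal_group_pow[OF assms] class_number_def)
  finally show ?thesis using ideal_class_eq_one_iff[OF ideal_power_frac[OF assms]] by blast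
qed

text \<open>By Lagrange, a group of prime order has no proper subgroup containing a nontrivial
  element.\<close>

lemma generate_class_group:
  assumes pr: "Factorial_Ring.prime (class_number F)" and I: "is_frac I" "\<not> principal I"
    and S: "S \<subseteq> carrier (class_group F)" "ideal_class F I \<in> S"
  shows "generate (class_group F) S = carrier (class_group F)"
proof -
  let ?H = "generate (class_group F) S"
  have sub: "subgroup ?H (class_group F)" by (rule CG.generate_is_subgroup[OF S(1)])
  have fin: "finite (carrier (class_group F))"
    using class_number_nz unfolding class_number_def Coset.order_def by (meson card.infinite)
  have HC: "?H \<subseteq> carrier (class_group F)" by (rule subgroup.subset[OF sub])
  have "card (rcosets\<^bsub>class_group F\<^esub> ?H) * card ?H = class_number F"
    unfolding class_number_def by (rule CG.lagrange[OF sub])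
  then have "card ?H dvd class_number F" by (metis dvd_triv_right)
  then have "card ?H = 1 \<or> card ?H = class_number F" using pr prime_nat_iff by blast
  moreover have "card ?H \<noteq> 1"
  proof
    assume "card ?H = 1"
    then obtain x where x: "?H = {x}" by (rule card_1_singletonE)
    moreover have "\<one>\<^bsub>class_group F\<^esub> \<in> ?H" by (rule generate.one)
    moreover have "ideal_class F I \<in> ?H" by (rule generate.incl[OF S(2)])
    ultimately have "ideal_class F I = \<one>\<^bsub>class_group F\<^esub>" by blast
    then show False using ideal_class_eq_one_iff[OF I(1)] I(2) by blast
  qed
  ultimately have "card ?H = card (carrier (class_group F))" by (simp add: class_number_def Coset.order_def)
  then show ?thesis using card_subset_eq[OF fin HC] by blast
qed

end

section \<open>Residue degree and ramification\<close>

lemma carrier_ring_of_integers_Rats: "carrier (ring_of_integers \<rat>) = \<int>"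
  using rational_algebraic_int_is_int Ints_subset_Rats int_imp_algebraic_int
  by (auto simp: ring_of_integers_def)

context integer_ring
begin

lemma prime_ideal_proper: "is_prime P \<Longrightarrow> is_ideal P" "is_prime P \<Longrightarrow> 1 \<notin> P"
  by (auto simp: is_prime_def)

text \<open>The residue ring is finite, so two powers of \<open>x\<close> agree modulo
  \<open>P\<close>; cancelling the lower one, which is outside \<open>P\<close>, exhibits a power of
  \<open>x\<close> as the inverse.\<close>

lemma inverse_mod_prime:
  assumes P: "is_prime P" and x: "x \<in> R" "x \<notin> P"
  shows "\<exists>y\<in>R. 1 - x * y \<in> P"
proof -
  note I = prime_ideal_proper(1)[OF P]
  obtain a where a: "a \<in> P" "a \<noteq> 0" using frac_nz[OF ideal_frac[OF I]] by blast
  have aR: "a \<in> R" using a I ideal_R by blast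
  obtain C where C: "finite C" "\<And>y. y \<in> R \<Longrightarrow> \<exists>c\<in>C. (y - c) / a \<in> R"
    using residues[OF aR a(2)] by metis
  have "\<exists>c\<in>C. (x ^ k - c) / a \<in> R" for k by (rule C(2)[OF R_power[OF x(1)]])
  then obtain g where g: "\<And>k. g k \<in> C" "\<And>k. (x ^ k - g k) / a \<in> R" by metis
  obtain k l where kl: "k < l" "g k = g l" by (rule sequence_in_finite_set_repeats[OF C(1) g(1)])
  have "(x ^ k - g k) / a - (x ^ l - g l) / a \<in> R" by (intro R_diff g)
  then have "(x ^ k - x ^ l) / a \<in> R" using kl(2) by (simp add: diff_divide_distrib)
  from frac_mult[OF ideal_frac[OF I] this a(1)] have d: "x ^ k - x ^ l \<in> P" using a(2) by simp
  have "x ^ l = x ^ k * (x * x ^ (l - k - 1))"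
    using kl(1) by (simp add: power_add[symmetric] flip: power_Suc)
  then have "x ^ k - x ^ l = x ^ k * (1 - x * x ^ (l - k - 1))" by (simp add: right_diff_distrib)
  then have "x ^ k * (1 - x * x ^ (l - k - 1)) \<in> P" using d by simp
  moreover have "x ^ k \<notin> P" for k
  proof (induction k)
    case (Suc k)
    then show ?case using P x R_power[OF x(1), of k] by (auto simp: is_prime_def)
  qed (use P in \<open>simp add: is_prime_def\<close>)
  ultimately have "1 - x * x ^ (l - k - 1) \<in> P"
    using P R_power[OF x(1)] by (auto simp: is_prime_def intro!: R_intros x)
  then show ?thesis using R_power[OF x(1)] by blast
qed

context
  fixes P and q :: nat
  assumes P: "is_prime P" and q: "Factorial_Ring.prime q" and qP: "of_nat q \<in> P"
begin

lemma HOL_ideal_P: "ideal P (ring_of_integers F)"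
  using HOL_ideal_iff prime_ideal_proper(1)[OF P] by blast

lemma int_in_prime_iff: "of_int k \<in> P \<longleftrightarrow> int q dvd k"
proof
  note f = ideal_frac[OF prime_ideal_proper(1)[OF P]]
  assume k: "of_int k \<in> P"
  show "int q dvd k"
  proof (rule ccontr)
    assume "\<not> int q dvd k"
    then have "coprime (int q) k" using q by (simp add: prime_imp_coprime)
    then obtain u v where uv: "u * int q + v * k = 1"
      using bezout_int[of "int q" k] by (auto simp: coprime_iff_gcd_eq_1)
    have "of_int u * of_nat q + of_int v * of_int k \<in> P"
      by (rule frac_add[OF f frac_mult[OF f R_of_int qP] frac_mult[OF f R_of_int k]])
    also have "of_int u * of_nat q + of_int v * of_int k = (of_int (u * int q + v * k) :: complex)" by simp
    finally show False using prime_ideal_proper(2)[OF P] unfolding uv by simp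
  qed
next
  assume "int q dvd k"
  then obtain c where "k = c * int q" by (metis dvd_div_mult_self)
  then have "of_int k = of_int c * (of_nat q :: complex)" by simp
  then show "of_int k \<in> P" using frac_mult[OF ideal_frac[OF prime_ideal_proper(1)[OF P]] R_of_int qP] by simp
qed

lemma coset_eq_iff:
  assumes "x \<in> R" "y \<in> R"
  shows "P +>\<^bsub>ring_of_integers F\<^esub> x = P +>\<^bsub>ring_of_integers F\<^esub> y \<longleftrightarrow> x - y \<in> P"
proof -
  have eq: "P +>\<^bsub>ring_of_integers F\<^esub> x = {p + x | p. p \<in> P}" for x
    by (auto simp: a_r_coset_def')
  note f = ideal_frac[OF prime_ideal_proper(1)[OF P]]
  show ?thesis
  proof
    assume "P +>\<^bsub>ring_of_integers F\<^esub> x = P +>\<^bsub>ring_of_integers F\<^esub> y"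
    then have "x \<in> {p + y | p. p \<in> P}" unfolding eq using frac_0[OF f] by force
    then show "x - y \<in> P" by auto
  next
    assume d: "x - y \<in> P"
    have "{p + x | p. p \<in> P} = {p + y | p. p \<in> P}"
    proof (intro subset_antisym subsetI)
      fix u assume "u \<in> {p + x | p. p \<in> P}"
      then obtain p where "p \<in> P" "u = p + x" by blast
      then have "u = (p + (x - y)) + y" "p + (x - y) \<in> P" using frac_add[OF f _ d] by auto
      then show "u \<in> {p + y | p. p \<in> P}" by blast
    next
      fix u assume "u \<in> {p + y | p. p \<in> P}"
      then obtain p where "p \<in> P" "u = p + y" by blast
      then have "u = (p - (x - y)) + x" "p - (x - y) \<in> P" using frac_diff[OF f _ d] by auto
      then show "u \<in> {p + x | p. p \<in> P}" by blast
    qed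
    then show "P +>\<^bsub>ring_of_integers F\<^esub> x = P +>\<^bsub>ring_of_integers F\<^esub> y" unfolding eq .
  qed
qed

text \<open>\<open>ring.dim\<close> is the true dimension once finite dimension is known, which
  follows from finiteness of the residue field. In dimension 1 the image of the integers, of
  dimension 1 over itself, fills the residue field.\<close>

lemma residue_degree_pos_and_one:
  shows "residue_degree F \<rat> P \<ge> 1"
    and "residue_degree F \<rat> P = 1 \<Longrightarrow> x \<in> R \<Longrightarrow> \<exists>k::int. x - of_int k \<in> P"
proof -
  let ?A = "ring_of_integers F"
  let ?Q = "?A Quot P"
  define c where "c = (\<lambda>x. P +>\<^bsub>?A\<^esub> x)"
  define K where "K = c ` \<int>"
  interpret A: cring ?A by (rule cring_ring_of_integers)
  interpret I: ideal P ?A by (rule HOL_ideal_P)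
  interpret Qc: cring ?Q by (rule I.quotient_is_cring[OF A.cring_axioms])
  interpret h: ring_hom_ring ?A ?Q c unfolding c_def by (rule I.rcos_ring_hom_ring)
  have IntsR: "x \<in> R" if "x \<in> \<int>" for x using that R_of_int by (auto elim: Ints_cases)
  have carr: "carrier ?Q = c ` R" by (auto simp: FactRing_def A_RCOSETS_def' c_def a_r_coset_def')
  have zero: "\<zero>\<^bsub>?Q\<^esub> = c 0" and one: "\<one>\<^bsub>?Q\<^esub> = c 1" using h.hom_zero h.hom_one by simp_all
  have mult: "c x \<otimes>\<^bsub>?Q\<^esub> c y = c (x * y)" if "x \<in> R" "y \<in> R" for x y using h.hom_mult[of x y] that by simp
  have add: "c x \<oplus>\<^bsub>?Q\<^esub> c y = c (x + y)" if "x \<in> R" "y \<in> R" for x y using h.hom_add[of x y] that by simp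
  have neg: "\<ominus>\<^bsub>?Q\<^esub> c x = c (- x)" if "x \<in> R" for x
    using h.hom_a_inv[of x] that a_inv_ring_of_integers[OF that] by simp
  have ceq: "c x = c y \<longleftrightarrow> x - y \<in> P" if "x \<in> R" "y \<in> R" for x y
    unfolding c_def by (rule coset_eq_iff[OF that])
  have one_nz: "\<one>\<^bsub>?Q\<^esub> \<noteq> \<zero>\<^bsub>?Q\<^esub>"
    unfolding zero one using ceq[OF R_1 R_0] prime_ideal_proper(2)[OF P] by simp
  have inv_ex: "\<exists>v\<in>R. c u \<otimes>\<^bsub>?Q\<^esub> c v = \<one>\<^bsub>?Q\<^esub>" if u: "u \<in> R" "c u \<noteq> \<zero>\<^bsub>?Q\<^esub>" for u
  proof -
    have "u \<notin> P" using u ceq[OF u(1) R_0] by (simp add: zero)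
    then obtain v where v: "v \<in> R" "1 - u * v \<in> P" using inverse_mod_prime[OF P u(1)] by blast
    then have "c 1 = c (u * v)" using ceq[OF R_1 R_mult[OF u(1) v(1)]] by simp
    then show ?thesis using v(1) mult[OF u(1) v(1)] one by metis
  qed
  interpret Q: field ?Q
  proof (rule Qc.cring_fieldI2[OF one_nz[symmetric]])
    fix a assume a: "a \<in> carrier ?Q" "a \<noteq> \<zero>\<^bsub>?Q\<^esub>"
    then obtain u where "u \<in> R" "a = c u" unfolding carr by blast
    then show "\<exists>b\<in>carrier ?Q. a \<otimes>\<^bsub>?Q\<^esub> b = \<one>\<^bsub>?Q\<^esub>" using inv_ex[of u] a unfolding carr by blast
  qed
  have sf: "subfield K ?Q"
  proof (rule Q.subfieldI')
    show "subring K ?Q"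
    proof (rule Qc.subringI)
      show "K \<subseteq> carrier ?Q" unfolding K_def carr using IntsR by blast
      show "\<one>\<^bsub>?Q\<^esub> \<in> K" unfolding one K_def by simp
      show "\<ominus>\<^bsub>?Q\<^esub> h \<in> K" if "h \<in> K" for h using that IntsR neg unfolding K_def by force
      show "h1 \<otimes>\<^bsub>?Q\<^esub> h2 \<in> K" if "h1 \<in> K" "h2 \<in> K" for h1 h2
        using that IntsR mult unfolding K_def by force
      show "h1 \<oplus>\<^bsub>?Q\<^esub> h2 \<in> K" if "h1 \<in> K" "h2 \<in> K" for h1 h2
        using that IntsR add unfolding K_def by force
    qed
    fix k assume k: "k \<in> K - {\<zero>\<^bsub>?Q\<^esub>}"
    then obtain i :: int where i: "k = c (of_int i)" unfolding K_def by (auto elim: Ints_cases)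
    have "of_int i \<notin> P" using k ceq[OF R_of_int R_0] unfolding i zero by simp
    then have "\<not> int q dvd i" using int_in_prime_iff by simp
    then have "coprime (int q) i" using q by (simp add: prime_imp_coprime)
    then obtain u v where uv: "u * int q + v * i = 1"
      using bezout_int[of "int q" i] by (auto simp: coprime_iff_gcd_eq_1)
    have "(1::complex) - of_int i * of_int v = of_int (u * int q)"
      using arg_cong[OF uv, of "of_int :: int \<Rightarrow> complex"] by (simp add: algebra_simps)
    then have "(1::complex) - of_int i * of_int v \<in> P" using int_in_prime_iff[of "u * int q"] by simp
    then have "c 1 = c (of_int i * of_int v)" using ceq[OF R_1 R_mult[OF R_of_int R_of_int]] by simp
    then have "k \<otimes>\<^bsub>?Q\<^esub> c (of_int v) = \<one>\<^bsub>?Q\<^esub>" unfolding i one using mult R_of_int by simp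
    moreover have "c (of_int v) \<in> carrier ?Q" "k \<in> carrier ?Q" unfolding carr i using R_of_int by auto
    ultimately have "inv\<^bsub>?Q\<^esub> k = c (of_int v)" using Qc.comm_inv_char[of k "c (of_int v)"] by blast
    then show "inv\<^bsub>?Q\<^esub> k \<in> K" unfolding K_def by simp
  qed
  have fin: "finite (carrier ?Q)"
  proof -
    obtain C where C: "finite C" "C \<subseteq> R" "\<And>y. y \<in> R \<Longrightarrow> \<exists>d\<in>C. (y - d) / of_nat q \<in> R"
      using residues[of "of_nat q"] R_of_nat prime_gt_0_nat[OF q] by auto
    have "c ` R \<subseteq> c ` C"
    proof
      fix w assume "w \<in> c ` R"
      then obtain y where y: "y \<in> R" "w = c y" by blast
      then obtain d where d: "d \<in> C" "(y - d) / of_nat q \<in> R" using C(3) by blast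
      from frac_mult[OF ideal_frac[OF prime_ideal_proper(1)[OF P]] d(2) qP]
      have "y - d \<in> P" using prime_gt_0_nat[OF q] by simp
      then show "w \<in> c ` C" using ceq[of y d] y d C(2) by blast
    qed
    then show ?thesis unfolding carr using C(1) finite_subset by blast
  qed
  then obtain Us where Us: "set Us = carrier ?Q" using finite_list by blast
  have "Qc.Span K Us = carrier ?Q"
    using Qc.Span_base_incl[OF sf, of Us] Qc.Span_in_carrier[OF subfieldE(3)[OF sf], of Us] Us by blast
  then have fd: "Qc.finite_dimension K (carrier ?Q)"
    using Qc.Span_finite_dimension[OF sf, of Us] Us by simp
  define f where "f = residue_degree F \<rat> P"
  have feq: "f = Qc.dim K (carrier ?Q)"
    unfolding f_def residue_degree_def Let_def K_def c_def carrier_ring_of_integers_Rats ..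
  have dim: "Qc.dimension f K (carrier ?Q)"
    using Qc.finite_dimensionE[OF sf fd] by (simp add: feq over_def)
  show "residue_degree F \<rat> P \<ge> 1"
  proof (rule ccontr)
    assume "\<not> ?thesis"
    then have "f = 0" by (simp add: f_def)
    then have "carrier ?Q = {\<zero>\<^bsub>?Q\<^esub>}" using dim Qc.dimension_zero[OF sf] by simp
    then show False using one_nz Qc.one_closed by blast
  qed
  show "\<exists>k::int. x - of_int k \<in> P" if f1: "residue_degree F \<rat> P = 1" and x: "x \<in> R"
  proof -
    have d1: "Qc.dimension 1 K (carrier ?Q)" using dim f1 by (simp add: f_def)
    \<comment> \<open>A one-element basis of the prime field \<open>K\<close> stays independent in
      the residue field, where it spans because the dimension there is also 1.\<close>
    have "Qc.dimension 1 K K" by (rule Qc.dimension_one[OF sf])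
    then obtain Vs where Vs: "Qc.independent K Vs" "length Vs = 1" "Qc.Span K Vs = K" "set Vs \<subseteq> carrier ?Q"
      using Qc.exists_base[OF sf] by blast
    have "Qc.Span K Vs = carrier ?Q"
      using Qc.independent_length_eq_dimension[OF sf d1 Vs(1) Vs(4)] Vs(2) by blast
    then have "c x \<in> K" using Vs(3) x carr by blast
    then obtain k :: int where "c x = c (of_int k)" unfolding K_def by (auto elim: Ints_cases)
    then show ?thesis using ceq[OF x R_of_int] by blast
  qed
qed

end

end

context finite_class_number
begin

text \<open>Exponent 1 always works. A larger one is impossible, because the ideal generated by the
  rational integers in \<open>P\<close> contains \<open>q\<close>, while the higher powers of
  \<open>P\<close> lie in \<open>P \<star> P\<close>.\<close>

lemma unramified_if_not_in_square:
  assumes P: "is_prime P" and q: "Factorial_Ring.prime q" "of_nat q \<in> P" "of_nat q \<notin> P \<star> P"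
  shows "unramified F \<rat> P"
proof -
  interpret A: cring "ring_of_integers F" by (rule cring_ring_of_integers)
  note I = prime_ideal_proper(1)[OF P]
  note f = ideal_frac[OF I]
  define S where "S = P \<inter> carrier (ring_of_integers \<rat>)"
  have SR: "S \<subseteq> carrier (ring_of_integers F)" using ideal_R[OF I] by (auto simp: S_def)
  have pow: "P [^]\<^bsub>ideal_group F\<^esub> (e::nat) = ideal_power P e" for e by (rule ideal_group_pow[OF f])
  have p1: "ideal_power P 1 = P" using set_prod_R[OF f] ideal_power_Suc[of P 0] by (simp add: ideal_power_0)
  have "ideal P (ring_of_integers F)" using HOL_ideal_iff I by blast
  then have "Idl\<^bsub>ring_of_integers F\<^esub> S \<subseteq> P" by (rule A.genideal_minimal) (auto simp: S_def)
  then have 1: "Idl\<^bsub>ring_of_integers F\<^esub> S \<subseteq> P [^]\<^bsub>ideal_group F\<^esub> (1::nat)" unfolding pow p1 .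
  have 2: "e \<le> 1" if e: "Idl\<^bsub>ring_of_integers F\<^esub> S \<subseteq> P [^]\<^bsub>ideal_group F\<^esub> (e::nat)" for e
  proof (rule ccontr)
    assume "\<not> e \<le> 1"
    then obtain k where k: "e = Suc (Suc k)" by (metis One_nat_def Suc_le_D not_less_eq_eq)
    have "of_nat q \<in> S" using q(2) by (simp add: S_def carrier_ring_of_integers_Rats)
    then have "of_nat q \<in> ideal_power P e" using A.genideal_self[OF SR] e unfolding pow by blast
    also have "ideal_power P e = (P \<star> P) \<star> ideal_power P k"
      by (simp add: k ideal_power_Suc set_prod_assoc)
    also have "\<dots> \<subseteq> (P \<star> P) \<star> R"
    proof (rule set_prod_mono)
      show "ideal_power P k \<subseteq> R"
      proof (induction k)
        case (Suc k)
        have "ideal_power P (Suc k) \<subseteq> R \<star> R" unfolding ideal_power_Suc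
          using ideal_R[OF I] Suc by (intro set_prod_mono) auto
        then show ?case using set_prod_R[OF frac_R] by simp
      qed (simp add: ideal_power_0)
    qed simp
    also have "\<dots> = P \<star> P" by (rule set_prod_R[OF frac_set_prod[OF f f]])
    finally show False using q(3) by blast
  qed
  have "(GREATEST e::nat. Idl\<^bsub>ring_of_integers F\<^esub> S \<subseteq> P [^]\<^bsub>ideal_group F\<^esub> e) = 1"
    by (rule Greatest_equality) (use 1 2 in blast)+
  then show ?thesis unfolding unramified_def ramification_index_def S_def .
qed

end

section \<open>Subfields of the cyclotomic field\<close>

lemma CC_inv: "x \<noteq> 0 \<Longrightarrow> inv\<^bsub>CC\<^esub> x = inverse x"
proof -
  assume "x \<noteq> 0"
  interpret field "CC" by (rule field_from_type_algebra)
  show ?thesis using comm_inv_char[of x "inverse x"] \<open>x \<noteq> 0\<close> by simp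
qed

lemma CC_a_inv: "\<ominus>\<^bsub>CC\<^esub> x = - x"
proof -
  interpret field "CC" by (rule field_from_type_algebra)
  show ?thesis using minus_equality[of "- x" x] by simp
qed

lemma generate_field_CC_diff:
  "x \<in> generate_field CC S \<Longrightarrow> y \<in> generate_field CC S \<Longrightarrow> x - y \<in> generate_field CC S"
  using generate_field.eng_add[of x CC S "- y"] generate_field.a_inv[of y CC S] by (simp add: CC_a_inv)

lemma generate_field_CC_mult:
  "x \<in> generate_field CC S \<Longrightarrow> y \<in> generate_field CC S \<Longrightarrow> x * y \<in> generate_field CC S"
  using generate_field.eng_mult[of x CC S y] by simp

lemma generate_field_CC_add:
  "x \<in> generate_field CC S \<Longrightarrow> y \<in> generate_field CC S \<Longrightarrow> x + y \<in> generate_field CC S"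
  using generate_field.eng_add[of x CC S y] by simp

lemma generate_field_CC_1: "1 \<in> generate_field CC S"
  using generate_field.one[of CC S] by simp

lemma generate_field_CC_0: "0 \<in> generate_field CC S"
  using generate_field_CC_diff[OF generate_field_CC_1 generate_field_CC_1] by simp

lemma generate_field_CC_inverse: "x \<in> generate_field CC S \<Longrightarrow> inverse x \<in> generate_field CC S"
  using generate_field.m_inv[of x CC S] by (cases "x = 0") (simp_all add: CC_inv generate_field_CC_0)

lemma generate_field_CC_of_nat: "of_nat k \<in> generate_field CC S"
  by (induction k) (auto simp: generate_field_CC_0 generate_field_CC_1 generate_field_CC_add)

lemma generate_field_CC_of_int: "of_int k \<in> generate_field CC S"
proof -
  have "- of_nat j \<in> generate_field CC S" for j
    using generate_field_CC_diff[OF generate_field_CC_0 generate_field_CC_of_nat[of j]] by simp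
  then show ?thesis by (cases k) (simp_all add: generate_field_CC_of_nat del: of_nat_Suc)
qed

lemma generate_field_CC_Rats: "x \<in> \<rat> \<Longrightarrow> x \<in> generate_field CC S"
proof -
  assume "x \<in> \<rat>"
  then obtain r where "x = of_rat r" by (auto elim: Rats_cases)
  then show ?thesis
    by (cases r) (auto simp: of_rat_rat divide_inverse
        intro!: generate_field_CC_mult generate_field_CC_inverse generate_field_CC_of_int)
qed

lemma generate_field_CC_minimal:
  assumes "S \<subseteq> E" "1 \<in> E" "\<And>x y. x \<in> E \<Longrightarrow> y \<in> E \<Longrightarrow> x - y \<in> E"
    "\<And>x y. x \<in> E \<Longrightarrow> y \<in> E \<Longrightarrow> x * y \<in> E" "\<And>x. x \<in> E \<Longrightarrow> inverse x \<in> E"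
  shows "generate_field CC S \<subseteq> E"
proof
  have z: "0 \<in> E" using assms(3)[OF assms(2,2)] by simp
  have m: "- x \<in> E" if "x \<in> E" for x using assms(3)[OF z that] by simp
  fix x assume "x \<in> generate_field CC S"
  then show "x \<in> E"
  proof (induction rule: generate_field.induct)
    case (eng_add x y)
    then show ?case using assms(3)[OF _ m, of x y] by simp
  qed (use assms m in \<open>auto simp: CC_inv CC_a_inv\<close>)
qed

lemma Rats_imp_Reals: "x \<in> \<rat> \<Longrightarrow> x \<in> (\<real> :: complex set)"
proof -
  assume "x \<in> \<rat>"
  then obtain r where "x = of_rat r" by (auto elim: Rats_cases)
  then show ?thesis by (cases r) (simp add: of_rat_rat)
qed

context cyclotomic
begin

lemma cyclotomic_field_eq: "cyclotomic_field n = QZ"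
proof
  show "cyclotomic_field n \<subseteq> QZ"
    unfolding cyclotomic_field_def using QZ_z
    by (intro generate_field_CC_minimal) (auto simp: z_def[symmetric] intro: QZ_intros QZ_inverse)
  have zin: "z \<in> cyclotomic_field n"
    unfolding cyclotomic_field_def z_def[symmetric] by (rule generate_field.incl) simp
  have pow: "z ^ k \<in> cyclotomic_field n" for k
    using zin unfolding cyclotomic_field_def
    by (induction k) (auto simp: generate_field_CC_1 intro: generate_field_CC_mult)
  have sums: "sum f I \<in> cyclotomic_field n" if "\<And>i. i \<in> I \<Longrightarrow> f i \<in> cyclotomic_field n" for f and I :: "nat set"
    using that unfolding cyclotomic_field_def
    by (induction I rule: infinite_finite_induct) (auto simp: generate_field_CC_0 intro: generate_field_CC_add)
  show "QZ \<subseteq> cyclotomic_field n"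
  proof
    fix x assume "x \<in> QZ"
    then obtain f where f: "x = qpoly f z" by (auto simp: QZ_def)
    show "x \<in> cyclotomic_field n" unfolding f qpoly_altdef
    proof (rule sums)
      fix i
      have "of_rat (coeff f i) \<in> cyclotomic_field n"
        unfolding cyclotomic_field_def by (rule generate_field_CC_Rats) simp
      then show "of_rat (coeff f i) * z ^ i \<in> cyclotomic_field n"
        using pow[of i] unfolding cyclotomic_field_def by (rule generate_field_CC_mult)
    qed
  qed
qed

lemma QZ_integral_multiple:
  assumes "x \<in> QZ" shows "\<exists>m>0. algebraic_int (of_nat m * x)"
proof -
  define A where "A = {x. \<exists>m>0. algebraic_int (of_nat m * x :: complex)}"
  have add: "x + y \<in> A" if xy: "x \<in> A" "y \<in> A" for x y
  proof -
    obtain k l where kl: "k > 0" "algebraic_int (of_nat k * x)" "l > 0" "algebraic_int (of_nat l * y)"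
      using xy unfolding A_def by blast
    have "algebraic_int (of_nat l * (of_nat k * x) + of_nat k * (of_nat l * y))"
      by (intro algebraic_int_intros kl)
    then have "algebraic_int (of_nat (k * l) * (x + y))" by (simp add: algebra_simps)
    then show ?thesis unfolding A_def using kl by (intro CollectI exI[of _ "k * l"]) simp
  qed
  have rat: "of_rat r * z ^ i \<in> A" for r i
  proof (cases r)
    case (Fract a b)
    have eq: "of_nat (nat b) * (of_rat r * z ^ i) = of_int a * z ^ i"
      using Fract by (simp add: of_rat_rat)
    have "algebraic_int (of_nat (nat b) * (of_rat r * z ^ i))"
      unfolding eq by (intro algebraic_int_intros z_AI)
    then show ?thesis unfolding A_def using Fract by (intro CollectI exI[of _ "nat b"]) simp
  qed
  have zero: "0 \<in> A" unfolding A_def by (auto intro: exI[of _ 1])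
  have sums: "sum f I \<in> A" if "\<And>i. i \<in> I \<Longrightarrow> f i \<in> A" for f and I :: "nat set"
    using that by (induction I rule: infinite_finite_induct) (auto simp: zero intro: add)
  obtain f where "x = qpoly f z" using assms by (auto simp: QZ_def)
  then have "x \<in> A" using sums[of "{..degree f}" "\<lambda>i. of_rat (coeff f i) * z ^ i"] rat
    by (simp add: qpoly_altdef)
  then show ?thesis by (simp add: A_def)
qed

text \<open>By \<open>AI_expansion\<close>, \<open>of_nat n * x\<close> is an integral combination
  of powers of \<open>z\<close>. Reducing its coefficients modulo \<open>n * m\<close> and dividing
  by \<open>n\<close> leaves finitely many representatives, possibly not integral.\<close>

lemma QZ_finite_residues:
  assumes m: "m > 0"
  shows "\<exists>C. finite C \<and> (\<forall>x\<in>QZ. algebraic_int x \<longrightarrow> (\<exists>c\<in>C. algebraic_int ((x - c) / of_nat m)))"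
proof -
  define N where "N = int (n * m)"
  have N0: "N > 0" using m n_gt_1 by (simp add: N_def)
  define C where "C = (\<lambda>c. (\<Sum>k<n. of_int (c k) * z ^ k) / of_nat n) ` ({..<n} \<rightarrow>\<^sub>E {0..<N})"
  have "finite C" unfolding C_def by (intro finite_imageI finite_PiE) auto
  moreover have "\<exists>c\<in>C. algebraic_int ((x - c) / of_nat m)" if x: "x \<in> QZ" "algebraic_int x" for x
  proof -
    obtain a where a: "of_nat n * x = (\<Sum>k<n. of_int (a k) * z ^ k)" using AI_expansion[OF x] by blast
    define c where "c = restrict (\<lambda>k. a k mod N) {..<n}"
    define y where "y = (\<Sum>k<n. of_int (c k) * z ^ k) / of_nat n"
    have "c \<in> {..<n} \<rightarrow>\<^sub>E {0..<N}" unfolding c_def using N0 by auto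
    then have "y \<in> C" unfolding C_def y_def by (rule imageI)
    have "of_nat n * (x - y) = (\<Sum>k<n. of_int (a k) * z ^ k) - (\<Sum>k<n. of_int (c k) * z ^ k)"
      using n_gt_1 by (simp add: right_diff_distrib a y_def)
    also have "\<dots> = (\<Sum>k<n. (of_nat n * of_nat m) * (of_int (a k div N) * z ^ k))"
      unfolding sum_subtractf[symmetric]
    proof (rule sum.cong[OF refl])
      fix k assume "k \<in> {..<n}"
      then have "of_int (a k) = (of_int (N * (a k div N) + c k) :: complex)" by (simp add: c_def)
      then show "of_int (a k) * z ^ k - of_int (c k) * z ^ k = (of_nat n * of_nat m) * (of_int (a k div N) * z ^ k)"
        by (simp add: N_def algebra_simps)
    qed
    also have "\<dots> = of_nat n * (of_nat m * (\<Sum>k<n. of_int (a k div N) * z ^ k))"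
      by (simp add: sum_distrib_left mult.assoc)
    finally have "x - y = of_nat m * (\<Sum>k<n. of_int (a k div N) * z ^ k)" using n_gt_1 by simp
    then have "(x - y) / of_nat m = (\<Sum>k<n. of_int (a k div N) * z ^ k)" using m by simp
    moreover have "algebraic_int (\<Sum>k<n. of_int (a k div N) * z ^ k)"
      by (intro algebraic_int_sum algebraic_int_intros z_AI)
    ultimately show ?thesis using \<open>y \<in> C\<close> by (intro bexI[of _ y]) simp_all
  qed
  ultimately show ?thesis by blast
qed

lemma integer_ring_subfield:
  assumes "F \<subseteq> QZ" "1 \<in> F" "\<And>x y. x \<in> F \<Longrightarrow> y \<in> F \<Longrightarrow> x - y \<in> F"
    "\<And>x y. x \<in> F \<Longrightarrow> y \<in> F \<Longrightarrow> x * y \<in> F" "\<And>x. x \<in> F \<Longrightarrow> inverse x \<in> F"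
  shows "integer_ring F"
proof
  show "\<exists>m>0. algebraic_int (of_nat m * x)" if "x \<in> F" for x
    using that assms(1) QZ_integral_multiple by blast
  show "\<exists>C. finite C \<and> (\<forall>x\<in>F. algebraic_int x \<longrightarrow> (\<exists>c\<in>C. algebraic_int ((x - c) / of_nat m)))"
    if "m > 0" for m :: nat
    using QZ_finite_residues[OF that] assms(1) by blast
qed (use assms in auto)

end

section \<open>The maximal real subfield and the quadratic field inside it\<close>

locale real_cyclotomic = cyclotomic +
  assumes n_mod_4: "n mod 4 = 1" and n_nonsquare: "\<And>a :: nat. a\<^sup>2 \<noteq> n"
begin

abbreviation "K \<equiv> max_real_cyclotomic_field n"
abbreviation "k \<equiv> real_quadratic_field n"

definition s :: complex where "s = complex_of_real (sqrt (real n))"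

lemma K_eq: "K = QZ \<inter> \<real>" by (simp add: max_real_cyclotomic_field_def cyclotomic_field_eq)

lemma s_sq: "s * s = of_nat n" and s_QZ: "s \<in> QZ" and s_real: "s \<in> \<real>" and cnj_s: "cnj s = s" and s_nz: "s \<noteq> 0"
proof -
  show "s * s = of_nat n" unfolding s_def of_real_mult[symmetric] by simp
  show "s \<in> QZ" unfolding s_def by (rule sqrt_in_QZ[OF n_mod_4])
qed (use n_gt_1 in \<open>auto simp: s_def\<close>)

lemma s_AI: "algebraic_int s"
  using algebraic_int_rootof[of s 2] s_sq by (simp add: power2_eq_square algebraic_int_of_nat)

lemma s_irrational: "s \<notin> \<rat>"
proof
  assume "s \<in> \<rat>"
  then have "s \<in> \<int>" using s_AI rational_algebraic_int_is_int by blast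
  then obtain i :: int where "s = of_int i" by (auto elim: Ints_cases)
  then have "of_int (i * i) = (of_int (int n) :: complex)" using s_sq by simp
  then have "i * i = int n" by (simp only: of_int_eq_iff)
  then have "int ((nat \<bar>i\<bar>)\<^sup>2) = int n" by (simp add: power2_eq_square)
  then have "(nat \<bar>i\<bar>)\<^sup>2 = n" by (simp only: of_nat_eq_iff)
  then show False using n_nonsquare by blast
qed

lemma k_eq: "k = {a + b * s | a b. a \<in> \<rat> \<and> b \<in> \<rat>}" (is "_ = ?E")
proof
  have Ei: "a + b * s \<in> ?E" if "a \<in> \<rat>" "b \<in> \<rat>" for a b using that by blast
  show "k \<subseteq> ?E"
    unfolding real_quadratic_field_def s_def[symmetric]
  proof (rule generate_field_CC_minimal)
    show "{s} \<subseteq> ?E" using Ei[of 0 1] by simp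
    show "1 \<in> ?E" using Ei[of 1 0] by simp
    fix x assume "x \<in> ?E"
    then obtain a b where x: "x = a + b * s" "a \<in> \<rat>" "b \<in> \<rat>" by blast
    show "inverse x \<in> ?E"
    proof (cases "x = 0")
      case True then show ?thesis using Ei[of 0 0] by simp
    next
      case False
      have nz: "a - b * s \<noteq> 0"
      proof
        assume e: "a - b * s = 0"
        show False
        proof (cases "b = 0")
          case True then show False using e False x by simp
        next
          case bnz: False
          then have "s = a / b" using e by (simp add: field_simps)
          then show False using s_irrational x by simp
        qed
      qed
      define D where "D = a * a - b * b * of_nat n"
      have D: "D = x * (a - b * s)" unfolding x D_def using s_sq by (simp add: algebra_simps)
      then have "D \<noteq> 0" using nz False by simp
      then have "inverse x = (a - b * s) / D" using False nz unfolding D by (simp add: inverse_eq_divide)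
      also have "\<dots> = a / D + (- b / D) * s" by (simp add: diff_divide_distrib)
      finally show ?thesis using x Ei[of "a / D" "- b / D"] by (simp add: D_def)
    qed
    fix y assume "y \<in> ?E"
    then obtain c d where y: "y = c + d * s" "c \<in> \<rat>" "d \<in> \<rat>" by blast
    have eq: "x - y = (a - c) + (b - d) * s" by (simp add: x y algebra_simps)
    show "x - y \<in> ?E" unfolding eq by (rule Ei) (use x y in simp_all)
    have "x * y = a * c + b * d * (s * s) + (a * d + b * c) * s" by (simp add: x y algebra_simps)
    then have eq: "x * y = (a * c + b * d * of_nat n) + (a * d + b * c) * s" by (simp only: s_sq)
    show "x * y \<in> ?E" unfolding eq by (rule Ei) (use x y in simp_all)
  qed
  show "?E \<subseteq> k"
  proof
    fix x assume "x \<in> ?E"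
    then obtain a b where x: "x = a + b * s" "a \<in> \<rat>" "b \<in> \<rat>" by blast
    have sk: "s \<in> k" unfolding real_quadratic_field_def s_def by (rule generate_field.incl) simp
    show "x \<in> k" unfolding x(1)
      using generate_field_CC_add[OF generate_field_CC_Rats[OF x(2)]
          generate_field_CC_mult[OF generate_field_CC_Rats[OF x(3)] sk[unfolded real_quadratic_field_def]]]
      by (simp add: real_quadratic_field_def)
  qed
qed

lemma k_subset_K: "k \<subseteq> K"
proof
  fix x assume "x \<in> k"
  then obtain a b where x: "x = a + b * s" "a \<in> \<rat>" "b \<in> \<rat>" unfolding k_eq by blast
  have "a + b * s \<in> \<real>" by (intro Reals_add Reals_mult Rats_imp_Reals x s_real)
  moreover have "a + b * s \<in> QZ" by (intro QZ_add QZ_mult QZ_Rats x s_QZ)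
  ultimately show "x \<in> K" unfolding K_eq x(1) by blast
qed

sublocale KK: integer_ring K
proof (rule integer_ring_subfield)
  show "K \<subseteq> QZ" by (simp add: K_eq)
qed (auto simp: K_eq intro: QZ_intros QZ_inverse)

sublocale kk: integer_ring k
proof (rule integer_ring_subfield)
  show "k \<subseteq> QZ" using k_subset_K by (auto simp: K_eq)
qed (auto simp: real_quadratic_field_def
       intro: generate_field_CC_1 generate_field_CC_diff generate_field_CC_mult generate_field_CC_inverse)

lemma s_k: "s \<in> k" unfolding k_eq by (intro CollectI exI[of _ 0] exI[of _ 1]) simp

lemma kR_subset_KR: "kk.R \<subseteq> KK.R"
  using k_subset_K by (auto simp: kk.R_def KK.R_def)

lemma K_QZ: "x \<in> K \<Longrightarrow> x \<in> QZ" and K_cnj: "x \<in> K \<Longrightarrow> cnj x = x"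
  by (auto simp: K_eq Reals_cnj_iff)

section \<open>Galois action on the square root of n\<close>

lemma conj_s: assumes "coprime j n" shows "conj_map j s = s \<or> conj_map j s = - s"
proof -
  have "conj_map j s * conj_map j s = conj_map j (of_nat n)"
    using conj_mult[OF assms s_QZ s_QZ] s_sq by simp
  then have "conj_map j s ^ 2 = s ^ 2" using s_sq by (simp add: conj_of_nat[OF assms] power2_eq_square)
  then show ?thesis by (simp only: power2_eq_iff)
qed

lemma ex_conj_s_neg: "\<exists>j\<in>totatives n. conj_map j s = - s"
proof (rule ccontr)
  assume "\<not> ?thesis"
  then have "conj_map j s = s" if "j \<in> totatives n" for j
    using that conj_s[of j] by (auto simp: in_totatives_iff)
  then show False using fixed_imp_rational[OF s_QZ] s_irrational by blast
qed

text \<open>A fixed extension of the nontrivial automorphism of the quadratic field.\<close>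

definition \<tau> :: nat where "\<tau> = (SOME j. j \<in> totatives n \<and> conj_map j s = - s)"

lemma \<tau>: "coprime \<tau> n" "conj_map \<tau> s = - s"
proof -
  have "\<tau> \<in> totatives n \<and> conj_map \<tau> s = - s"
    unfolding \<tau>_def by (rule someI_ex) (use ex_conj_s_neg in blast)
  then show "coprime \<tau> n" "conj_map \<tau> s = - s" by (auto simp: in_totatives_iff)
qed

text \<open>\<open>H\<close> represents the Galois group of the cyclotomic field over
  \<open>k\<close>. \<open>H'\<close> picks one index from each pair \<open>j\<close>,
  \<open>n - j\<close> and so represents the Galois group of \<open>K\<close> over
  \<open>k\<close>.\<close>

definition H :: "nat set" where "H = {j \<in> totatives n. conj_map j s = s}"
definition H' :: "nat set" where "H' = {j \<in> H. 2 * j < n}"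

lemma H_coprime: "j \<in> H \<Longrightarrow> coprime j n" and H_s: "j \<in> H \<Longrightarrow> conj_map j s = s"
  by (auto simp: H_def in_totatives_iff)

lemma finite_H: "finite H" "finite H'" by (simp_all add: H_def H'_def)

lemma mod_totatives: "coprime j n \<Longrightarrow> j mod n \<in> totatives n"
proof -
  assume "coprime j n"
  then have c: "coprime (j mod n) n" using n_gt_1 by simp
  then have "j mod n > 0" using n_gt_1 by (intro Nat.gr0I) auto
  moreover have "j mod n < n" using n_gt_1 by simp
  ultimately show ?thesis using c by (simp add: in_totatives_iff)
qed

lemma conj_mod: "coprime j n \<Longrightarrow> x \<in> QZ \<Longrightarrow> conj_map (j mod n) x = conj_map j x"
  using n_gt_1 by (intro conj_cong) auto

lemma mod_H: "coprime j n \<Longrightarrow> conj_map j s = s \<Longrightarrow> j mod n \<in> H"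
  using mod_totatives conj_mod[OF _ s_QZ] by (simp add: H_def)

lemma coprime_n_minus: "coprime (n - Suc 0) n"
  using n_gt_1 coprime_diff_one_left_nat[of n] by simp

lemma coprime_n_diff: assumes "coprime j n" "j < n" shows "coprime (n - j) n"
proof (rule coprimeI)
  fix d assume d: "d dvd n - j" "d dvd n"
  then have "d dvd n - (n - j)" by (rule dvd_diff_nat[rotated])
  then have "d dvd j" using assms(2) by simp
  from coprime_common_divisor[OF assms(1) this d(2)] show "is_unit d" .
qed

lemma conj_n_minus:
  assumes "coprime j n" "j < n" "x \<in> QZ" shows "conj_map (n - j) x = conj_map j (cnj x)"
proof -
  have "conj_map j (cnj x) = conj_map j (conj_map (n - 1) x)" by (simp add: conj_minus_one_cnj[OF assms(3), symmetric])
  also have "\<dots> = conj_map (j * (n - 1)) x" using coprime_n_minus assms by (intro conj_conj) auto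
  also have "\<dots> = conj_map (n - j) x"
  proof (rule conj_cong)
    show "coprime (j * (n - 1)) n" using assms coprime_n_minus by simp
    have "j * (n - 1) + j = j * n" using n_gt_1 by (simp add: diff_mult_distrib2)
    moreover have "(n - j) + j = n" using assms(2) by simp
    ultimately have "[j * (n - 1) + j = (n - j) + j] (mod n)" by (simp add: cong_def)
    then show c: "[j * (n - 1) = n - j] (mod n)" by (simp only: cong_add_rcancel_nat)
    show "coprime (n - j) n" using assms by (intro coprime_n_diff)
  qed (rule assms)
  finally show ?thesis ..
qed

lemma H_lt: "j \<in> H \<Longrightarrow> j < n" using totatives_less[of j n] n_gt_1 by (simp add: H_def)

lemma n_minus_H: "j \<in> H \<Longrightarrow> n - j \<in> H"
proof -
  assume j: "j \<in> H"
  have "conj_map (n - j) s = s" using conj_n_minus[OF H_coprime[OF j] H_lt[OF j] s_QZ] H_s[OF j] cnj_s by simp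
  moreover have "coprime (n - j) n" using H_coprime[OF j] H_lt[OF j] by (rule coprime_n_diff)
  ultimately show "n - j \<in> H" using H_lt[OF j] H_coprime[OF j] by (auto simp: H_def in_totatives_iff)
qed

lemma H_mult: "i \<in> H \<Longrightarrow> j \<in> H \<Longrightarrow> (i * j) mod n \<in> H"
proof (rule mod_H)
  assume ij: "i \<in> H" "j \<in> H"
  then show "coprime (i * j) n" using H_coprime by simp
  have "conj_map (i * j) s = conj_map i (conj_map j s)" using ij H_coprime s_QZ by (simp add: conj_conj)
  then show "conj_map (i * j) s = s" using H_s ij by simp
qed

text \<open>Multiplication by \<tau> exchanges \<open>H\<close> with its complement in the
  totatives.\<close>

lemma card_totatives_H: "totient n = 2 * card H"
proof -
  define H2 where "H2 = {j \<in> totatives n. conj_map j s = - s}"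
  have "s \<noteq> - s" using s_nz by simp
  have part: "totatives n = H \<union> H2" "H \<inter> H2 = {}"
    using \<open>s \<noteq> - s\<close> by (auto simp: H_def H2_def in_totatives_iff dest: conj_s)
  let ?f = "\<lambda>j. (\<tau> * j) mod n"
  have bij: "bij_betw ?f (totatives n) (totatives n)" by (rule totatives_reindex[OF \<tau>(1)])
  have fs: "conj_map (?f j) s = - conj_map j s" if j: "coprime j n" for j
  proof -
    have "conj_map (?f j) s = conj_map (\<tau> * j) s" using j \<tau>(1) s_QZ by (intro conj_mod) auto
    also have "\<dots> = conj_map (j * \<tau>) s" by (simp only: mult.commute)
    also have "\<dots> = conj_map j (conj_map \<tau> s)" using conj_conj[OF j \<tau>(1) s_QZ] by simp
    finally show ?thesis using \<tau>(2) conj_minus[OF j s_QZ] by simp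
  qed
  have "?f ` H = H2"
  proof (intro subset_antisym subsetI)
    fix y assume "y \<in> ?f ` H"
    then obtain j where j: "j \<in> H" "y = ?f j" by blast
    have "?f j \<in> totatives n" using bij_betwE[OF bij] j(1) by (simp add: H_def)
    moreover have "conj_map (?f j) s = - s" using fs[OF H_coprime[OF j(1)]] H_s[OF j(1)] by simp
    ultimately show "y \<in> H2" unfolding j(2) by (simp only: H2_def mem_Collect_eq)
  next
    fix y assume y: "y \<in> H2"
    then have "y \<in> ?f ` totatives n" using bij_betw_imp_surj_on[OF bij] by (simp add: H2_def)
    then obtain j where j: "j \<in> totatives n" "y = ?f j" by blast
    have "conj_map (?f j) s = - conj_map j s" using j(1) by (intro fs) (simp add: in_totatives_iff)
    moreover have "conj_map (?f j) s = - s" using y unfolding j(2) by (simp only: H2_def mem_Collect_eq)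
    ultimately have "conj_map j s = s" by simp
    then have "j \<in> H" using j(1) by (simp add: H_def)
    then show "y \<in> ?f ` H" unfolding j(2) by (rule imageI)
  qed
  moreover have "inj_on ?f H"
    using bij_betw_imp_inj_on[OF bij] by (rule inj_on_subset) (simp add: part(1))
  ultimately have "card H2 = card H" using card_image by metis
  moreover have "finite H2" by (simp add: H2_def)
  ultimately have "card (totatives n) = 2 * card H" unfolding part(1)
    using part(2) finite_H by (subst card_Un_disjoint) auto
  then show ?thesis by (simp add: totient_def)
qed

lemma n_odd: "odd n" using n_mod_4 by presburger

text \<open>As \<open>n\<close> is odd, no index equals its reflection \<open>n - j\<close>, and
  \<open>H\<close> splits into \<open>H'\<close> and its mirror image.\<close>

lemma card_H: "card H = 2 * card H'"
proof -
  have eq: "H = H' \<union> (\<lambda>j. n - j) ` H'"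
  proof (intro subset_antisym subsetI)
    fix j assume j: "j \<in> H"
    show "j \<in> H' \<union> (\<lambda>j. n - j) ` H'"
    proof (cases "2 * j < n")
      case False
      have "2 * j \<noteq> n" using n_odd by auto
      then have "n - j \<in> H'" using n_minus_H[OF j] False H_lt[OF j] by (auto simp: H'_def)
      moreover have "j = n - (n - j)" using H_lt[OF j] by simp
      ultimately show ?thesis by blast
    qed (use j in \<open>simp add: H'_def\<close>)
  next
    fix j assume "j \<in> H' \<union> (\<lambda>j. n - j) ` H'"
    then show "j \<in> H" using n_minus_H by (auto simp: H'_def)
  qed
  have "inj_on (\<lambda>j. n - j) H'" by (rule inj_onI) (auto simp: H'_def)
  then have "card ((\<lambda>j. n - j) ` H') = card H'" by (rule card_image)
  moreover have "H' \<inter> (\<lambda>j. n - j) ` H' = {}" by (auto simp: H'_def)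
  ultimately show ?thesis by (subst eq, subst card_Un_disjoint) (auto simp: finite_H)
qed

lemma totient_div_4: "totient n div 4 = card H'"
  using card_totatives_H card_H by simp

text \<open>On \<open>K\<close> this is the relative norm to \<open>k\<close>: for real elements
  \<open>j\<close> and \<open>n - j\<close> act alike, so each automorphism of \<open>K\<close> over
  \<open>k\<close> occurs once.\<close>

definition norm_K :: "complex \<Rightarrow> complex" where
  "norm_K x = (\<Prod>j\<in>H'. conj_map j x)"

lemma H'_coprime: "j \<in> H' \<Longrightarrow> coprime j n" using H_coprime by (simp add: H'_def)

lemma norm_mult: "x \<in> QZ \<Longrightarrow> y \<in> QZ \<Longrightarrow> norm_K (x * y) = norm_K x * norm_K y"
  unfolding norm_K_def prod.distrib[symmetric] by (intro prod.cong refl conj_mult H'_coprime)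

lemma norm_1: "norm_K 1 = 1"
  unfolding norm_K_def by (intro prod.neutral ballI conj_1 H'_coprime)

lemma norm_power: "x \<in> QZ \<Longrightarrow> norm_K (x ^ e) = norm_K x ^ e"
  by (induction e) (auto simp: norm_1 norm_mult QZ_power)

lemma norm_nz: "x \<in> QZ \<Longrightarrow> x \<noteq> 0 \<Longrightarrow> norm_K x \<noteq> 0"
  unfolding norm_K_def using H'_coprime by (auto simp: conj_eq_0_iff finite_H)

lemma norm_QZ: "x \<in> QZ \<Longrightarrow> norm_K x \<in> QZ"
  unfolding norm_K_def by (intro QZ_prod conj_in_QZ H'_coprime)

lemma norm_AI: "x \<in> QZ \<Longrightarrow> algebraic_int x \<Longrightarrow> algebraic_int (norm_K x)"
  unfolding norm_K_def by (intro algebraic_int_prod conj_AI H'_coprime)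

lemma norm_k: assumes "x \<in> k" shows "norm_K x = x ^ (totient n div 4)"
proof -
  obtain a b where x: "x = a + b * s" "a \<in> \<rat>" "b \<in> \<rat>" using assms unfolding k_eq by blast
  have "conj_map j x = x" if j: "j \<in> H'" for j
  proof -
    have c: "coprime j n" "conj_map j s = s" using j H_s H'_coprime by (auto simp: H'_def)
    show ?thesis unfolding x(1)
      using x c by (simp add: conj_add conj_mult conj_Rats QZ_intros QZ_Rats s_QZ)
  qed
  then show ?thesis unfolding norm_K_def totient_div_4 by simp
qed

text \<open>The representative of plus or minus \<open>j\<close> modulo \<open>n\<close> in the
  lower half; through it, multiplication by an element of \<open>H\<close> becomes a permutation of
  \<open>H'\<close>.\<close>

definition refl_mod :: "nat \<Rightarrow> nat" where
  "refl_mod j = (if 2 * (j mod n) < n then j mod n else n - j mod n)"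

lemma conj_refl_mod:
  assumes "coprime j n" "x \<in> K" shows "conj_map (refl_mod j) x = conj_map j x"
proof -
  have "conj_map (n - j mod n) x = conj_map (j mod n) (cnj x)"
    using assms n_gt_1 K_QZ by (intro conj_n_minus) auto
  then show ?thesis using K_cnj[OF assms(2)] conj_mod[OF assms(1) K_QZ[OF assms(2)]] by (simp add: refl_mod_def)
qed

text \<open>Equal values mean that \<open>i * a\<close> is congruent to plus or minus
  \<open>i * b\<close>. The minus sign would give \<open>n dvd a + b\<close>, impossible as
  \<open>0 < a + b\<close> and \<open>a + b < n\<close>.\<close>

lemma refl_mod_bij:
  assumes i: "i \<in> H" shows "bij_betw (\<lambda>j. refl_mod (i * j)) H' H'"
proof -
  let ?f = "\<lambda>j. refl_mod (i * j)"
  have "?f ` H' \<subseteq> H'"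
  proof safe
    fix j assume "j \<in> H'"
    then have ij: "(i * j) mod n \<in> H" using H_mult[OF i] by (simp add: H'_def)
    have "2 * ((i * j) mod n) \<noteq> n" using n_odd by (metis dvd_triv_left)
    then show "?f j \<in> H'" using ij n_minus_H[OF ij] H_lt[OF ij] by (auto simp: refl_mod_def H'_def)
  qed
  moreover have "inj_on ?f H'"
  proof (rule inj_onI)
    fix a b assume ab: "a \<in> H'" "b \<in> H'" "?f a = ?f b"
    have lt: "2 * a < n" "2 * b < n" using ab by (auto simp: H'_def)
    have ci: "coprime i n" using H_coprime[OF i] .
    have "(i * a) mod n = (i * b) mod n \<or> (i * a) mod n + (i * b) mod n = n"
    proof -
      have "A = B \<or> A + B = n"
        if "A < n" "B < n" "(if 2 * A < n then A else n - A) = (if 2 * B < n then B else n - B)" for A B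
        using that by (cases "2 * A < n"; cases "2 * B < n"; simp; arith)
      moreover have "(i * a) mod n < n" "(i * b) mod n < n" using n_gt_1 by auto
      ultimately show ?thesis using ab(3) unfolding refl_mod_def by blast
    qed
    then show "a = b"
    proof
      assume "(i * a) mod n = (i * b) mod n"
      then have "[i * a = i * b] (mod n)" by (simp add: cong_def)
      then have "[a = b] (mod n)" using ci by (simp add: cong_mult_lcancel_nat)
      then show ?thesis using lt by (simp add: cong_def)
    next
      assume "(i * a) mod n + (i * b) mod n = n"
      then have "((i * a) mod n + (i * b) mod n) mod n = 0" by simp
      then have "(i * a + i * b) mod n = 0" by (simp only: mod_add_eq)
      then have "n dvd i * (a + b)" by (simp add: distrib_left mod_eq_0_iff_dvd)
      then have "n dvd a + b" using ci by (simp add: coprime_dvd_mult_right_iff coprime_commute)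
      moreover have "a + b < n" using lt by simp
      moreover have "a > 0" using ab(1) by (auto simp: H'_def H_def in_totatives_iff)
      ultimately show ?thesis using nat_dvd_not_less[of "a + b" n] by simp
    qed
  qed
  ultimately show ?thesis using finite_H by (simp add: bij_betw_def endo_inj_surj)
qed

lemma norm_fixed:
  assumes i: "i \<in> H" and x: "x \<in> K" shows "conj_map i (norm_K x) = norm_K x"
proof -
  have ci: "coprime i n" using H_coprime[OF i] .
  have "conj_map i (norm_K x) = (\<Prod>j\<in>H'. conj_map i (conj_map j x))"
    unfolding norm_K_def using x K_QZ H'_coprime by (intro conj_prod[OF ci] conj_in_QZ) auto
  also have "\<dots> = (\<Prod>j\<in>H'. conj_map (refl_mod (i * j)) x)"
    using ci x H'_coprime K_QZ by (intro prod.cong refl) (simp add: conj_conj conj_refl_mod)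
  also have "\<dots> = norm_K x"
    unfolding norm_K_def by (rule prod.reindex_bij_betw[OF refl_mod_bij[OF i]])
  finally show ?thesis .
qed

text \<open>With \<open>y'\<close> the image of \<open>y\<close> under \<tau>, both
  \<open>y + y'\<close> and \<open>(y - y') * s\<close> are fixed by all automorphisms, hence
  rational, and \<open>y\<close> is recovered from them.\<close>

lemma fixed_by_H_imp_k:
  assumes y: "y \<in> QZ" and fx: "\<And>j. j \<in> H \<Longrightarrow> conj_map j y = y"
  shows "y \<in> k"
proof -
  define y' where "y' = conj_map \<tau> y"
  have y': "y' \<in> QZ" unfolding y'_def by (rule conj_in_QZ[OF \<tau>(1) y])
  have fixc: "conj_map j y = y" if "coprime j n" "conj_map j s = s" for j
    using fx[OF mod_H[OF that]] conj_mod[OF that(1) y] by simp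
  have pos: "conj_map j y' = y'" if j: "coprime j n" "conj_map j s = s" for j
  proof -
    have "conj_map j y' = conj_map (\<tau> * j) y"
      unfolding y'_def using conj_conj[OF j(1) \<tau>(1) y] by (simp add: mult.commute)
    also have "\<dots> = conj_map \<tau> (conj_map j y)" using conj_conj[OF \<tau>(1) j(1) y] by simp
    finally show ?thesis using fixc[OF j] by (simp add: y'_def)
  qed
  \<comment> \<open>If \<open>j\<close> negates \<open>s\<close>, then \<open>j * \<tau>\<close>
    fixes \<open>s\<close> and so fixes \<open>y\<close>, which gives the image of
    \<open>y'\<close>. The image of \<open>y\<close> is found in the same way from the inverse
    \<open>l\<close> of \<open>j\<close>.\<close>
  have neg: "conj_map j y = y'" "conj_map j y' = y" if j: "coprime j n" "conj_map j s = - s" for j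
  proof -
    have cj: "coprime (j * \<tau>) n" using j \<tau> by simp
    have "conj_map (j * \<tau>) s = conj_map j (- s)" using conj_conj[OF j(1) \<tau>(1) s_QZ] \<tau>(2) by simp
    then have "conj_map (j * \<tau>) s = s" using conj_minus[OF j(1) s_QZ] j(2) by simp
    from fixc[OF cj this] show y: "conj_map j y' = y" unfolding y'_def using conj_conj[OF j(1) \<tau>(1) \<open>y \<in> QZ\<close>] by simp
    obtain l where l: "[j * l = 1] (mod n)" using j(1) by (metis cong_solve_coprime_nat One_nat_def)
    then have cl: "coprime l n"
      by (metis cong_imp_coprime cong_sym coprime_1_left coprime_mult_left_iff)
    have one: "conj_map (j * l) w = w" if "w \<in> QZ" for w
    proof -
      have "conj_map (j * l) w = conj_map (Suc 0) w" using l cl j(1) that by (intro conj_cong) auto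
      then show ?thesis using conj_one[OF that] by simp
    qed
    have cc: "conj_map j (conj_map l w) = w" if "w \<in> QZ" for w using conj_conj[OF j(1) cl that] one[OF that] by simp
    have ls: "conj_map l s = - s"
    proof -
      have "conj_map l s = s \<or> conj_map l s = - s" by (rule conj_s[OF cl])
      moreover have "conj_map l s \<noteq> s" using cc[OF s_QZ] j(2) s_nz by auto
      ultimately show ?thesis by blast
    qed
    have "conj_map (l * \<tau>) s = conj_map l (- s)" using conj_conj[OF cl \<tau>(1) s_QZ] \<tau>(2) by simp
    then have "conj_map (l * \<tau>) s = s" using conj_minus[OF cl s_QZ] ls by simp
    moreover have "coprime (l * \<tau>) n" using cl \<tau> by simp
    ultimately have "conj_map (l * \<tau>) y = y" by (intro fixc)
    then have "conj_map l y' = y" unfolding y'_def using conj_conj[OF cl \<tau>(1) \<open>y \<in> QZ\<close>] by simp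
    then show "conj_map j y = y'" using cc[OF y'] by simp
  qed
  have u: "y + y' \<in> \<rat>"
  proof (rule fixed_imp_rational)
    fix j assume "j \<in> totatives n"
    then have j: "coprime j n" by (simp add: in_totatives_iff)
    show "conj_map j (y + y') = y + y'"
      using conj_s[OF j] fixc[OF j] pos[OF j] neg[OF j] by (auto simp: conj_add[OF j y y'])
  qed (intro QZ_add y y')
  have v: "(y - y') * s \<in> \<rat>"
  proof (rule fixed_imp_rational)
    fix j assume "j \<in> totatives n"
    then have j: "coprime j n" by (simp add: in_totatives_iff)
    have "conj_map j ((y - y') * s) = (conj_map j y - conj_map j y') * conj_map j s"
      using conj_mult[OF j QZ_diff[OF y y'] s_QZ] conj_diff[OF j y y'] by simp
    also have "\<dots> = (y - y') * s"
      using conj_s[OF j] fixc[OF j] pos[OF j] neg[OF j] by (auto simp: algebra_simps)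
    finally show "conj_map j ((y - y') * s) = (y - y') * s" .
  qed (intro QZ_mult QZ_diff y y' s_QZ)
  have "((y - y') * s) * s = (y - y') * of_nat n" using s_sq by (simp add: mult.assoc)
  then have "y = (y + y') / 2 + ((y - y') * s) / (2 * of_nat n) * s"
    using n_gt_1 by (simp add: field_simps)
  then show ?thesis unfolding k_eq using u v by (intro CollectI exI conjI) (assumption | simp)+
qed

lemma norm_in_k: "x \<in> K \<Longrightarrow> norm_K x \<in> k"
  by (rule fixed_by_H_imp_k) (auto intro: norm_QZ norm_fixed K_QZ)

lemma norm_in_kR: "x \<in> KK.R \<Longrightarrow> norm_K x \<in> kk.R"
  by (auto simp: KK.R_def kk.R_def intro: norm_in_k norm_AI K_QZ)

end

section \<open>A non-principal ideal of the quadratic field\<close>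

text \<open>
  Descent by multiplication with \<open>t - sqrt (t\<^sup>2 + 1)\<close>, a unit of norm \<open>-1\<close>.
\<close>

lemma small_norm_descent:
  fixes t M x y :: int
  assumes M: "M < 2 * t" and nonsq: "\<And>x. \<bar>x\<^sup>2\<bar> \<noteq> M"
  shows "\<bar>x\<^sup>2 - (t\<^sup>2 + 1) * y\<^sup>2\<bar> \<noteq> M"
proof (induction "nat \<bar>y\<bar>" arbitrary: x y rule: less_induct)
  case less
  show ?case
  proof
    assume eq: "\<bar>x\<^sup>2 - (t\<^sup>2 + 1) * y\<^sup>2\<bar> = M"
    have M0: "M \<ge> 0" using eq by auto
    then have t0: "t > 0" using M by simp
    define a b where "a = \<bar>x\<bar>" and "b = \<bar>y\<bar>"
    have ab: "a \<ge> 0" "b \<ge> 0" "\<bar>a\<^sup>2 - (t\<^sup>2 + 1) * b\<^sup>2\<bar> = M" using eq by (auto simp: a_def b_def)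
    have "b \<noteq> 0" using ab(3) nonsq[of a] by auto
    then have b1: "b \<ge> 1" using ab(2) by simp
    have b2: "2 * t \<le> 2 * t * b\<^sup>2"
    proof -
      have "1 \<le> b\<^sup>2" by (rule one_le_power[OF b1])
      then show ?thesis using t0 by simp
    qed
    \<comment> \<open>\<open>c1\<close> and \<open>c2\<close> together say
      \<open>\<bar>b'\<bar> < b\<close> for the new second coordinate. If either failed, the form
      would be at least \<open>2 * t * b\<^sup>2\<close> in absolute value, which exceeds
      \<open>M\<close>.\<close>
    have c1: "a < b * (t + 1)"
    proof (rule ccontr)
      assume "\<not> ?thesis"
      then have "(b * (t + 1))\<^sup>2 \<le> a\<^sup>2" using b1 t0 by (intro power_mono) auto
      moreover have "(b * (t + 1))\<^sup>2 - (t\<^sup>2 + 1) * b\<^sup>2 = 2 * t * b\<^sup>2"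
        by (simp add: power2_eq_square algebra_simps)
      ultimately show False using b2 M ab(3) by linarith
    qed
    have c2: "b * (t - 1) < a"
    proof (rule ccontr)
      assume "\<not> ?thesis"
      then have "a\<^sup>2 \<le> (b * (t - 1))\<^sup>2" using ab(1) by (intro power_mono) auto
      moreover have "(t\<^sup>2 + 1) * b\<^sup>2 - (b * (t - 1))\<^sup>2 = 2 * t * b\<^sup>2"
        by (simp add: power2_eq_square algebra_simps)
      ultimately show False using b2 M ab(3) by linarith
    qed
    define a' b' where "a' = a * t - (t\<^sup>2 + 1) * b" and "b' = b * t - a"
    have "\<bar>b'\<bar> < b" using c1 c2 by (auto simp: b'_def algebra_simps)
    then have "nat \<bar>b'\<bar> < nat \<bar>y\<bar>" by (simp add: b_def)
    then have "\<bar>a'\<^sup>2 - (t\<^sup>2 + 1) * b'\<^sup>2\<bar> \<noteq> M" by (rule less.hyps)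
    moreover have "a'\<^sup>2 - (t\<^sup>2 + 1) * b'\<^sup>2 = - (a\<^sup>2 - (t\<^sup>2 + 1) * b\<^sup>2)"
      unfolding a'_def b'_def by (simp add: power2_eq_square algebra_simps)
    ultimately show False using ab(3) by simp
  qed
qed

text \<open>The denominator \<open>r\<close> of \<open>y\<close> in lowest terms satisfies
  \<open>r\<^sup>2 dvd int n\<close>.\<close>

lemma rat_square_times_squarefree:
  fixes n :: nat and y :: rat
  assumes sf: "squarefree n" and int: "of_nat n * y\<^sup>2 = of_int M"
  shows "y \<in> \<int>"
proof -
  obtain p r where pr: "quotient_of y = (p, r)" by fastforce
  have y: "y = of_int p / of_int r" by (rule quotient_of_div[OF pr])
  have r0: "r > 0" by (rule quotient_of_denom_pos[OF pr])
  have cop: "coprime p r" by (rule quotient_of_coprime[OF pr])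
  have "of_nat n * (of_int p)\<^sup>2 = (of_int M * (of_int r)\<^sup>2 :: rat)"
    using int r0 unfolding y by (simp add: power_divide field_simps)
  then have "of_int (int n * p\<^sup>2) = (of_int (M * r\<^sup>2) :: rat)" by simp
  then have "int n * p\<^sup>2 = M * r\<^sup>2" by (simp only: of_int_eq_iff)
  then have "r\<^sup>2 dvd int n * p\<^sup>2" by simp
  moreover have "coprime (r\<^sup>2) (p\<^sup>2)" using cop by (simp add: coprime_commute)
  ultimately have "r\<^sup>2 dvd int n" by (simp add: coprime_dvd_mult_left_iff)
  then have "int ((nat r)\<^sup>2) dvd int n" using r0 by simp
  then have "(nat r)\<^sup>2 dvd n" by (simp only: int_dvd_int_iff)
  then have "nat r dvd 1" by (rule squarefreeD[OF sf])
  then have "r = 1" using r0 by simp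
  then show ?thesis by (simp add: y)
qed

locale chowla_field = real_cyclotomic +
  fixes q m :: nat
  assumes q: "Factorial_Ring.prime q" and q_odd: "odd q" and m_gt_1: "m > 1"
    and n_eq: "n = (2 * m * q)\<^sup>2 + 1" and n_squarefree: "squarefree n"
begin

lemma q_pos: "q > 0" using q prime_gt_0_nat by blast

lemma q_not_dvd_n: "\<not> q dvd n"
proof
  assume "q dvd n"
  moreover have "q dvd (2 * m * q)\<^sup>2" by (simp add: power2_eq_square)
  ultimately have "q dvd 1" unfolding n_eq by (metis dvd_add_right_iff)
  then show False using q not_prime_unit by blast
qed

text \<open>Follows from \<open>2 * m * q \<ge> 12\<close>. The bound 128 = 2^7 provides eight
  powers of 2 as totatives; the other keeps \<open>q + 1\<close> and \<open>q - 1\<close> from being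
  multiples of \<open>n\<close>.\<close>

lemma n_large: "n \<ge> 128" "q + 1 < n"
proof -
  have q3: "q \<ge> 3" using q_odd prime_ge_2_nat[OF q] by (cases "q = 2") auto
  have "12 * 1 \<le> 2 * m * q" "4 * q \<le> 2 * m * q"
  proof -
    have "2 * 2 * 3 \<le> 2 * m * q" using m_gt_1 q3 by (intro mult_le_mono) auto
    then show "12 * 1 \<le> 2 * m * q" by simp
    show "4 * q \<le> 2 * m * q" using m_gt_1 by simp
  qed
  moreover define t where "t = 2 * m * q"
  ultimately have t: "12 \<le> t" "4 * q \<le> t" by simp_all
  have n: "n = t * t + 1" by (simp add: n_eq t_def power2_eq_square)
  have "12 * t \<le> t * t" using t by (intro mult_le_mono1)
  then show "n \<ge> 128" "q + 1 < n" using t n q3 by linarith+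
qed

section \<open>The ideal of norm q in the quadratic field\<close>

definition w :: complex where "w = s - 1"

lemma w_kR: "w \<in> kk.R"
  unfolding w_def using s_k s_AI by (intro kk.R_diff kk.R_1) (simp add: kk.R_def)

definition Q0 :: "complex set" where "Q0 = {of_nat q * u + w * v | u v. u \<in> kk.R \<and> v \<in> kk.R}"

lemma q_Q0: "of_nat q \<in> Q0" and w_Q0: "w \<in> Q0"
proof -
  have "of_nat q = of_nat q * 1 + w * 0" "w = of_nat q * 0 + w * 1" by simp_all
  then show "of_nat q \<in> Q0" "w \<in> Q0" unfolding Q0_def using kk.R_0 kk.R_1 by blast+
qed

lemma Q0_ideal: "kk.is_ideal Q0"
proof (rule kk.is_idealI[of Q0 "of_nat q"])
  show "Q0 \<subseteq> kk.R" unfolding Q0_def using w_kR by (auto intro!: kk.R_intros)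
  have "0 = of_nat q * 0 + w * 0" by simp
  then show "0 \<in> Q0" unfolding Q0_def using kk.R_0 by blast
  show "x + y \<in> Q0" if xy: "x \<in> Q0" "y \<in> Q0" for x y
  proof -
    obtain u v where "x = of_nat q * u + w * v" "u \<in> kk.R" "v \<in> kk.R" using xy(1) unfolding Q0_def by blast
    moreover obtain u' v' where "y = of_nat q * u' + w * v'" "u' \<in> kk.R" "v' \<in> kk.R" using xy(2) unfolding Q0_def by blast
    ultimately have "x + y = of_nat q * (u + u') + w * (v + v')" "u + u' \<in> kk.R" "v + v' \<in> kk.R"
      by (auto simp: algebra_simps intro: kk.R_add)
    then show ?thesis unfolding Q0_def by blast
  qed
  show "r * x \<in> Q0" if rx: "r \<in> kk.R" "x \<in> Q0" for r x
  proof -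
    obtain u v where "x = of_nat q * u + w * v" "u \<in> kk.R" "v \<in> kk.R" using rx(2) unfolding Q0_def by blast
    then have "r * x = of_nat q * (r * u) + w * (r * v)" "r * u \<in> kk.R" "r * v \<in> kk.R"
      using rx(1) by (auto simp: algebra_simps intro: kk.R_mult)
    then show ?thesis unfolding Q0_def by blast
  qed
  show "of_nat q \<in> Q0" by (rule q_Q0)
  show "of_nat q \<noteq> (0::complex)" using q_pos by simp
qed

abbreviation "cj \<equiv> conj_map \<tau>"

lemma k_QZ: "x \<in> k \<Longrightarrow> x \<in> QZ" using k_subset_K K_QZ by blast

lemma cj_k:
  assumes "a \<in> \<rat>" "b \<in> \<rat>" shows "cj (a + b * s) = a - b * s"
  using assms \<tau> by (simp add: conj_add[OF \<tau>(1)] conj_mult[OF \<tau>(1)] conj_Rats[OF \<tau>(1)] QZ_Rats QZ_mult s_QZ)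

lemma cj_kR: assumes "x \<in> kk.R" shows "cj x \<in> kk.R"
proof -
  have xk: "x \<in> k" by (rule kk.R_F[OF assms])
  then obtain a b where x: "x = a + b * s" "a \<in> \<rat>" "b \<in> \<rat>" unfolding k_eq by blast
  have "cj x = a + (- b) * s" using cj_k[OF x(2,3)] x(1) by simp
  moreover have "a + (- b) * s \<in> k" unfolding k_eq using x by (intro CollectI exI conjI) (rule refl, auto)
  ultimately have "cj x \<in> k" by simp
  moreover have "algebraic_int (cj x)" by (rule conj_AI[OF \<tau>(1) k_QZ[OF xk] kk.R_AI[OF assms]])
  ultimately show ?thesis by (simp add: kk.R_def)
qed

lemma cj_mult: "x \<in> kk.R \<Longrightarrow> y \<in> kk.R \<Longrightarrow> cj (x * y) = cj x * cj y"
  by (intro conj_mult[OF \<tau>(1)] k_QZ kk.R_F)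

lemma norm_rational: assumes "x \<in> kk.R" shows "x * cj x \<in> \<int>"
proof -
  obtain a b where x: "x = a + b * s" "a \<in> \<rat>" "b \<in> \<rat>" using kk.R_F[OF assms] unfolding k_eq by blast
  have "x * cj x = a * a - b * b * (s * s)" unfolding x(1) cj_k[OF x(2,3)] by (simp add: algebra_simps)
  then have "x * cj x \<in> \<rat>" using x s_sq by simp
  moreover have "algebraic_int (x * cj x)" by (intro kk.R_AI kk.R_mult assms cj_kR)
  ultimately show ?thesis using rational_algebraic_int_is_int by blast
qed

text \<open>The trace of the quotient is \<open>- 2 / q\<close>, not an integer for odd
  \<open>q\<close>. This distinguishes \<open>Q0\<close> from the ideal generated by
  \<open>q\<close>.\<close>

lemma w_over_q: "\<not> algebraic_int (w / of_nat q)"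
proof
  assume A: "algebraic_int (w / of_nat q)"
  have wq: "w / of_nat q \<in> QZ" using k_QZ[OF kk.R_F[OF w_kR]] by (intro QZ_divide QZ_of_nat)
  have "w / of_nat q = (- 1 / of_nat q) + (1 / of_nat q) * s" by (simp add: w_def diff_divide_distrib)
  then have "cj (w / of_nat q) = (- 1 / of_nat q) - (1 / of_nat q) * s" using cj_k[of "- 1 / of_nat q" "1 / of_nat q"] by simp
  then have "w / of_nat q + cj (w / of_nat q) = of_int (- 2) / of_int (int q)"
    by (simp add: w_def diff_divide_distrib)
  moreover have "algebraic_int (w / of_nat q + cj (w / of_nat q))"
    by (intro algebraic_int_add A conj_AI[OF \<tau>(1) wq A])
  ultimately have "algebraic_int (of_int (- 2) / of_int (int q) :: complex)" by simp
  then have "int q dvd - 2" using q_pos by (intro algebraic_int_of_int_quotient) auto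
  then have "int q dvd int 2" by simp
  then have "q dvd 2" by (simp only: int_dvd_int_iff)
  then have "q = 2" using q prime_ge_2_nat[OF q] by (auto dest: dvd_imp_le)
  then show False using q_odd by simp
qed

text \<open>Let \<beta> be a generator, of norm \<open>M\<close>. The norm \<open>1 - n\<close> of
  \<open>w\<close> is a multiple of \<open>q\<close>, hence so is \<open>M\<close>, while
  \<open>M\<close> divides \<open>q ^ 2\<close>; thus \<open>M\<close> is \<open>q\<close> or
  \<open>q ^ 2\<close> up to sign. In the second case \<beta> is \<open>q\<close> times a unit and
  \<open>q\<close> would divide \<open>w\<close>; the first case contradicts
  \<open>small_norm_descent\<close>.\<close>

lemma Q0_not_principal: "\<not> kk.principal Q0"
proof
  assume "kk.principal Q0"
  then obtain \<beta> where \<beta>: "\<beta> \<in> k" "\<beta> \<noteq> 0" "Q0 = scale \<beta> kk.R" unfolding kk.principal_def by blast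
  have "\<beta> \<in> Q0" unfolding \<beta>(3) using kk.R_1 by (intro image_eqI[of _ _ 1]) auto
  then obtain u v where uv: "\<beta> = of_nat q * u + w * v" "u \<in> kk.R" "v \<in> kk.R" unfolding Q0_def by blast
  have \<beta>R: "\<beta> \<in> kk.R" using \<open>\<beta> \<in> Q0\<close> kk.ideal_R[OF Q0_ideal] by blast
  obtain \<gamma> where \<gamma>: "\<gamma> \<in> kk.R" "of_nat q = \<beta> * \<gamma>" using q_Q0 unfolding \<beta>(3) by blast
  obtain \<delta> where \<delta>: "\<delta> \<in> kk.R" "w = \<beta> * \<delta>" using w_Q0 unfolding \<beta>(3) by blast
  have qR: "of_nat q \<in> kk.R" by (rule kk.R_of_nat)
  have cq: "cj (of_nat q) = of_nat q" by (rule conj_of_nat[OF \<tau>(1)])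
  have cw: "cj w = - s - 1" using cj_k[of "-1" 1] by (simp add: w_def)
  obtain M :: int where M: "\<beta> * cj \<beta> = of_int M" using norm_rational[OF \<beta>R] by (auto elim: Ints_cases)
  obtain G :: int where G: "\<gamma> * cj \<gamma> = of_int G" using norm_rational[OF \<gamma>(1)] by (auto elim: Ints_cases)
  have ww: "w * cj w = of_nat q * of_int (- int (4 * m * m * q))"
  proof -
    have "w * cj w = 1 - s * s" unfolding cw unfolding w_def by (simp add: algebra_simps)
    also have "s * s = of_nat ((2 * m * q)\<^sup>2) + 1" unfolding s_sq by (subst n_eq) simp
    also have "1 - \<dots> = - of_nat ((2 * m * q)\<^sup>2)" by simp
    also have "(2 * m * q)\<^sup>2 = q * (4 * m * m * q)" by (simp add: power2_eq_square)
    finally show ?thesis by simp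
  qed
  have qM: "int q dvd M"
  proof -
    have "cj \<beta> = of_nat q * cj u + cj w * cj v"
      unfolding uv(1) using uv w_kR qR cq
      by (simp add: conj_add[OF \<tau>(1)] cj_mult QZ_mult k_QZ kk.R_F)
    then have "of_int M = (of_nat q * u + w * v) * (of_nat q * cj u + cj w * cj v)"
      using M uv(1) by simp
    also have "\<dots> = of_nat q * (of_nat q * u * cj u + u * cj w * cj v + w * v * cj u) + (w * cj w) * (v * cj v)"
      by (simp add: algebra_simps)
    also have "\<dots> = of_nat q * (of_nat q * u * cj u + u * cj w * cj v + w * v * cj u + of_int (- int (4 * m * m * q)) * (v * cj v))"
      unfolding ww by (simp add: algebra_simps)
    finally have "of_int M / of_int (int q) = of_nat q * u * cj u + u * cj w * cj v + w * v * cj u + of_int (- int (4 * m * m * q)) * (v * cj v)"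
      using q_pos by simp
    also have "\<dots> \<in> kk.R" by (intro kk.R_add kk.R_mult kk.R_of_nat kk.R_of_int uv w_kR cj_kR)
    finally have "algebraic_int (of_int M / of_int (int q) :: complex)" by (rule kk.R_AI)
    then show ?thesis using q_pos by (intro algebraic_int_of_int_quotient) auto
  qed
  have MG: "M * G = int q * int q"
  proof -
    have "of_int (M * G) = (\<beta> * cj \<beta>) * (\<gamma> * cj \<gamma>)" unfolding M G by simp
    also have "\<dots> = (\<beta> * \<gamma>) * cj (\<beta> * \<gamma>)" using cj_mult[OF \<beta>R \<gamma>(1)] by (simp add: mult_ac)
    also have "\<dots> = of_int (int q * int q)" unfolding \<gamma>(2)[symmetric] cq by simp
    finally show ?thesis by (simp only: of_int_eq_iff)
  qed
  obtain M' where M': "M = int q * M'" using qM by blast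
  have M'G: "M' * G = int q" using MG q_pos unfolding M' by simp
  then have "M' dvd int q" using dvd_triv_left[of M' G] by simp
  then have "int (nat \<bar>M'\<bar>) dvd int q" by simp
  then have "nat \<bar>M'\<bar> dvd q" by (simp only: int_dvd_int_iff)
  then have "nat \<bar>M'\<bar> = 1 \<or> nat \<bar>M'\<bar> = q" using q prime_nat_iff by blast
  then have "\<bar>M'\<bar> = 1 \<or> \<bar>M'\<bar> = int q" by auto
  then show False
  proof
    assume "\<bar>M'\<bar> = int q"
    moreover have "\<bar>M'\<bar> * \<bar>G\<bar> = int q" using M'G by (simp only: abs_mult[symmetric] abs_of_nat)
    ultimately have "\<bar>G\<bar> = 1" using q_pos by simp
    moreover have "G * G = \<bar>G\<bar> * \<bar>G\<bar>" by simp
    ultimately have GG: "G * G = 1" by simp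
    have "(\<gamma> * cj \<gamma>) * (\<gamma> * cj \<gamma>) = of_int (G * G)" unfolding G by simp
    also have "\<dots> = 1" by (simp add: GG)
    finally have "(\<gamma> * cj \<gamma>) * (\<gamma> * cj \<gamma>) = 1" .
    then have inv: "\<gamma> * (cj \<gamma> * (\<gamma> * cj \<gamma>)) = 1" by (simp add: mult.assoc)
    \<comment> \<open>The inverse of \<gamma> in the ring of integers, as the norm of \<gamma>
      squares to 1.\<close>
    define \<gamma>' where "\<gamma>' = cj \<gamma> * (\<gamma> * cj \<gamma>)"
    have \<gamma>': "\<gamma>' \<in> kk.R" unfolding \<gamma>'_def by (intro kk.R_mult cj_kR \<gamma>)
    have "\<gamma>' * \<delta> * of_nat q = \<beta> * \<delta> * (\<gamma> * \<gamma>')" unfolding \<gamma>(2) by (simp add: mult_ac)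
    also have "\<dots> = w" using inv \<delta>(2) by (simp add: \<gamma>'_def)
    finally have "w / of_nat q = \<gamma>' * \<delta>" using q_pos by (simp add: field_simps)
    moreover have "\<gamma>' * \<delta> \<in> kk.R" by (intro kk.R_mult \<gamma>' \<delta>)
    ultimately show False using w_over_q kk.R_AI by simp
  next
    assume M'1: "\<bar>M'\<bar> = 1"
    \<comment> \<open>Elements of the ring of integers may have half-integral coordinates, so the
      norm equation is written for \<open>2 * a\<close> and \<open>2 * b\<close>, which turns
      \<open>q\<close> into \<open>4 * q\<close>.\<close>
    obtain a b where ab: "\<beta> = a + b * s" "a \<in> \<rat>" "b \<in> \<rat>" using \<beta>(1) unfolding k_eq by blast
    have cb: "cj \<beta> = a - b * s" unfolding ab(1) by (rule cj_k[OF ab(2,3)])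
    have "algebraic_int (\<beta> + cj \<beta>)" by (intro kk.R_AI kk.R_add \<beta>R cj_kR)
    moreover have "\<beta> + cj \<beta> = 2 * a" using ab(1) cb by simp
    ultimately have "2 * a \<in> \<int>" using rational_algebraic_int_is_int ab(2) by (metis Rats_mult Rats_number_of)
    then obtain x :: int where x: "2 * a = of_int x" by (auto elim: Ints_cases)
    obtain y where y: "2 * b = of_rat y"
      using ab(3) by (metis Rats_cases Rats_mult Rats_number_of)
    have norm4: "(2 * a)\<^sup>2 - of_nat n * (2 * b)\<^sup>2 = 4 * of_int M"
    proof -
      have "(2 * a)\<^sup>2 - of_nat n * (2 * b)\<^sup>2 = 4 * ((a + b * s) * (a - b * s))"
        unfolding s_sq[symmetric] by (simp add: power2_eq_square algebra_simps)
      then show ?thesis using M ab(1) cb by simp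
    qed
    then have e: "of_nat n * (of_rat y)\<^sup>2 = (of_int x)\<^sup>2 - (4 * of_int M :: complex)"
      unfolding x y by (simp add: algebra_simps)
    have "of_rat (of_nat n * y\<^sup>2) = of_nat n * (of_rat y :: complex)\<^sup>2"
      by (simp add: of_rat_mult of_rat_power)
    also have "\<dots> = of_rat (of_int (x\<^sup>2 - 4 * M))" unfolding e of_rat_of_int_eq by simp
    finally have "of_nat n * y\<^sup>2 = of_int (x\<^sup>2 - 4 * M)" by (simp only: of_rat_eq_iff)
    then have "y \<in> \<int>" by (rule rat_square_times_squarefree[OF n_squarefree])
    then obtain y' :: int where y': "y = of_int y'" by (auto elim: Ints_cases)
    have "of_int (x\<^sup>2 - int n * y'\<^sup>2) = (of_int (4 * M) :: complex)"
      using norm4 unfolding x y y' by simp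
    then have "x\<^sup>2 - int n * y'\<^sup>2 = 4 * M" by (simp only: of_int_eq_iff)
    then have "\<bar>x\<^sup>2 - int n * y'\<^sup>2\<bar> = 4 * int q" using M'1 unfolding M' by (simp add: abs_mult)
    moreover have "int n = (int (2 * m * q))\<^sup>2 + 1" by (simp add: n_eq)
    ultimately have "\<bar>x\<^sup>2 - ((int (2 * m * q))\<^sup>2 + 1) * y'\<^sup>2\<bar> = 4 * int q" by simp
    moreover have "\<bar>x\<^sup>2 - ((int (2 * m * q))\<^sup>2 + 1) * y'\<^sup>2\<bar> \<noteq> 4 * int q"
    proof (rule small_norm_descent)
      have "int q < int (m * q)" using m_gt_1 q_pos by simp
      then show "4 * int q < 2 * int (2 * m * q)" by simp
      fix x :: int
      show "\<bar>x\<^sup>2\<bar> \<noteq> 4 * int q"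
      proof
        assume "\<bar>x\<^sup>2\<bar> = 4 * int q"
        then have e: "x\<^sup>2 = 4 * int q" by simp
        then have "even (x\<^sup>2)" by simp
        then have "even x" by simp
        then obtain z where "x = 2 * z" by blast
        then have "z * z = int q" using e by (simp add: power2_eq_square)
        then have "int (nat \<bar>z\<bar> * nat \<bar>z\<bar>) = int q" by simp
        then have zq: "nat \<bar>z\<bar> * nat \<bar>z\<bar> = q" by (simp only: of_nat_eq_iff)
        then have "nat \<bar>z\<bar> dvd q" using dvd_triv_left by metis
        then have "nat \<bar>z\<bar> = 1 \<or> nat \<bar>z\<bar> = q" using q prime_nat_iff by blast
        then show False using zq prime_ge_2_nat[OF q] by auto
      qed
    qed
    ultimately show False by blast
  qed
qed

end

section \<open>Extension to the real cyclotomic field\<close>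

context integer_ring
begin

lemma ideal_power_scale: "is_frac I \<Longrightarrow> ideal_power (scale x I) j = scale (x ^ j) (ideal_power I j)"
proof (induction j)
  case (Suc j)
  have "ideal_power (scale x I) (Suc j) = scale x I \<star> scale (x ^ j) (ideal_power I j)"
    using Suc by (simp add: ideal_power_Suc)
  also have "\<dots> = scale x (scale (x ^ j) (ideal_power I j) \<star> I)"
    by (simp only: set_prod_scale set_prod_commute[of I])
  also have "\<dots> = scale x (scale (x ^ j) (I \<star> ideal_power I j))"
    by (simp only: set_prod_scale set_prod_commute[of I])
  finally show ?case by (simp only: scale_scale ideal_power_Suc power_Suc)
qed (simp add: ideal_power_0)

text \<open>\<open>J\<close>, the quotient of \<open>I\<close> by \<open>b\<close>, has
  \<open>j\<close>-th power \<open>R\<close>. Its elements are \<open>j\<close>-th roots of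
  algebraic integers, so it is contained in \<open>R\<close>; then its \<open>j\<close>-th power,
  which contains 1, is contained in \<open>J\<close>. This permits extracting \<open>h\<close>-th
  roots of ideals, with \<open>h\<close> the class number.\<close>

lemma principal_if_power_principal:
  assumes I: "is_frac I" and b: "b \<in> F" "b \<noteq> 0" and j: "j > 0"
    and eq: "ideal_power I j = scale (b ^ j) R"
  shows "I = scale b R"
proof -
  define J where "J = scale (inverse b) I"
  have IJ: "I = scale b J" using b(2) by (simp add: J_def scale_scale del: image_image)
  have fJ: "is_frac J" unfolding J_def using b by (intro frac_scale I F_inverse) auto
  have "J \<subseteq> R"
  proof
    fix y assume y: "y \<in> J"
    then obtain x where x: "x \<in> I" "y = inverse b * x" unfolding J_def by blast
    obtain r where r: "r \<in> R" "x ^ j = b ^ j * r" using ideal_power_in[OF x(1), of j] unfolding eq by blast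
    have "y ^ j = r" using b(2) unfolding x(2) power_mult_distrib r(2) by (simp add: power_inverse)
    then have "algebraic_int y" using algebraic_int_rootof[OF _ j, of y] R_AI[OF r(1)] by simp
    then show "y \<in> R" using frac_F[OF fJ y] by (simp add: R_def)
  qed
  then have iJ: "is_ideal J" using fJ by (simp add: is_ideal_def)
  have "ideal_power J j = scale (inverse b ^ j) (scale (b ^ j) R)"
    unfolding J_def using ideal_power_scale[OF I] eq by simp
  also have "\<dots> = R" using b(2) by (simp only: scale_scale) (simp add: power_inverse)
  finally have "1 \<in> ideal_power J j" using R_1 by simp
  moreover have "ideal_power J j \<subseteq> J"
  proof -
    obtain i where i: "j = Suc i" using j by (cases j) auto
    have pR: "ideal_power J i \<subseteq> R" for i
    proof (induction i)
      case (Suc i)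
      have "ideal_power J (Suc i) \<subseteq> R \<star> R" unfolding ideal_power_Suc
        by (rule set_prod_mono[OF \<open>J \<subseteq> R\<close> Suc])
      then show ?case using set_prod_R[OF frac_R] by simp
    qed (simp add: ideal_power_0)
    have "ideal_power J j \<subseteq> J \<star> R" unfolding i ideal_power_Suc by (rule set_prod_mono[OF _ pR]) simp
    then show ?thesis using set_prod_R[OF fJ] by simp
  qed
  ultimately have "J = R" using ideal_one[OF iJ] by blast
  then show ?thesis using IJ by simp
qed

end

context chowla_field
begin

definition QK :: "complex set" where "QK = Q0 \<star> KK.R"

lemma QK_ideal: "KK.is_ideal QK" and q_QK: "of_nat q \<in> QK"
proof -
  note f = kk.ideal_frac[OF Q0_ideal]
  show qQ: "of_nat q \<in> QK" unfolding QK_def using set_prod_prod[OF q_Q0 KK.R_1] by simp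
  have Q0K: "Q0 \<subseteq> KK.R" using kk.ideal_R[OF Q0_ideal] kR_subset_KR by blast
  show "KK.is_ideal QK"
  proof (rule KK.is_idealI[of QK "of_nat q"])
    have "QK \<subseteq> KK.R \<star> KK.R" unfolding QK_def by (rule set_prod_mono[OF Q0K]) simp
    then show "QK \<subseteq> KK.R" using KK.set_prod_R[OF KK.frac_R] by simp
    show "0 \<in> QK" unfolding QK_def using set_prod_prod[OF kk.frac_0[OF f] KK.R_1] by simp
    show "x + y \<in> QK" if "x \<in> QK" "y \<in> QK" for x y using that unfolding QK_def by (rule set_prod_add)
    show "r * x \<in> QK" if r: "r \<in> KK.R" and x: "x \<in> QK" for r x
      using x unfolding QK_def
    proof (induction rule: set_prod_induct)
      case (prod i j)
      then show ?case using set_prod_prod[OF prod(1) KK.R_mult[OF r prod(2)]] by (simp add: mult_ac)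
    qed (auto simp: distrib_left intro: set_prod_add)
    show "of_nat q \<in> QK" by (rule qQ)
    show "of_nat q \<noteq> (0::complex)" using q_pos by simp
  qed
qed

lemma QK_power: "KK.ideal_power QK j \<subseteq> kk.ideal_power Q0 j \<star> KK.R"
proof (induction j)
  case 0
  show ?case
  proof
    fix x assume "x \<in> KK.ideal_power QK 0"
    then show "x \<in> kk.ideal_power Q0 0 \<star> KK.R"
      using set_prod_prod[OF kk.R_1, of x KK.R] by (simp add: KK.ideal_power_0 kk.ideal_power_0)
  qed
next
  case (Suc j)
  have "KK.ideal_power QK (Suc j) \<subseteq> (Q0 \<star> KK.R) \<star> (kk.ideal_power Q0 j \<star> KK.R)"
    unfolding KK.ideal_power_Suc QK_def[symmetric] by (rule set_prod_mono[OF subset_refl Suc])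
  also have "\<dots> = (Q0 \<star> kk.ideal_power Q0 j) \<star> (KK.R \<star> KK.R)"
    by (metis set_prod_assoc set_prod_commute)
  also have "\<dots> = kk.ideal_power Q0 (Suc j) \<star> KK.R"
    by (simp only: KK.set_prod_R[OF KK.frac_R] kk.ideal_power_Suc)
  finally show ?case .
qed

lemma Q0_power_subset:
  assumes "Q0 \<subseteq> scale a KK.R" shows "kk.ideal_power Q0 j \<subseteq> scale (a ^ j) KK.R"
proof (induction j)
  case 0
  then show ?case using kR_subset_KR by (simp add: kk.ideal_power_0)
next
  case (Suc j)
  have "kk.ideal_power Q0 (Suc j) \<subseteq> scale a KK.R \<star> scale (a ^ j) KK.R"
    unfolding kk.ideal_power_Suc by (rule set_prod_mono[OF assms Suc])
  also have "\<dots> = scale a (KK.R \<star> scale (a ^ j) KK.R)" by (rule set_prod_scale)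
  also have "KK.R \<star> scale (a ^ j) KK.R = scale (a ^ j) KK.R \<star> KK.R" by (rule set_prod_commute)
  also have "scale a \<dots> = scale (a ^ Suc j) KK.R"
    by (simp only: set_prod_scale KK.set_prod_R[OF KK.frac_R] scale_scale power_Suc)
  finally show ?case .
qed

text \<open>
  If the extension of \<open>Q0\<close> to \<open>K\<close> is generated by \<open>a\<close>, the \<open>h\<close>-th power of \<open>Q0\<close> by \<open>c\<close>, and
  \<open>d * x = h * y + 1\<close> for the degree \<open>d\<close> of \<open>K\<close> over \<open>k\<close>, then \<open>norm_K a ^ x / c ^ y\<close> generates \<open>Q0\<close>.
\<close>

lemma QK_not_principal:
  assumes cn: "class_number k \<noteq> 0" and cop: "coprime (totient n div 4) (class_number k)"
  shows "\<not> KK.principal QK"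
proof
  interpret kf: finite_class_number k by unfold_locales (rule cn)
  define h d where "h = class_number k" and "d = totient n div 4"
  have f0: "kk.is_frac Q0" by (rule kk.ideal_frac[OF Q0_ideal])
  assume "KK.principal QK"
  then obtain a where a: "a \<in> K" "a \<noteq> 0" "QK = scale a KK.R" unfolding KK.principal_def by blast
  have aQK: "a \<in> QK" unfolding a(3) using KK.R_1 by (intro image_eqI[of _ _ 1]) auto
  have "kk.principal (kk.ideal_power Q0 h)" unfolding h_def by (rule kf.principal_class_number_power[OF f0])
  then obtain c where c: "c \<in> k" "c \<noteq> 0" "kk.ideal_power Q0 h = scale c kk.R" unfolding kk.principal_def by blast
  have "a ^ h \<in> kk.ideal_power Q0 h \<star> KK.R" using KK.ideal_power_in[OF aQK] QK_power by blast
  also have "kk.ideal_power Q0 h \<star> KK.R \<subseteq> scale c KK.R"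
  proof -
    have "kk.R \<star> KK.R \<subseteq> KK.R \<star> KK.R" by (rule set_prod_mono[OF kR_subset_KR]) simp
    then have "kk.R \<star> KK.R \<subseteq> KK.R" using KK.set_prod_R[OF KK.frac_R] by simp
    then show ?thesis unfolding c(3) set_prod_scale by blast
  qed
  finally obtain u where u: "u \<in> KK.R" "a ^ h = c * u" by blast
  have "Q0 \<subseteq> QK"
  proof
    fix x assume "x \<in> Q0"
    then show "x \<in> QK" unfolding QK_def using set_prod_prod[OF _ KK.R_1, of x Q0] by simp
  qed
  then have "Q0 \<subseteq> scale a KK.R" unfolding a(3) .
  from Q0_power_subset[OF this, of h] have "scale c kk.R \<subseteq> scale (a ^ h) KK.R" unfolding c(3) .
  moreover have "c \<in> scale c kk.R" using kk.R_1 by (intro image_eqI[of _ _ 1]) auto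
  ultimately have "c \<in> scale (a ^ h) KK.R" by (rule subsetD)
  then obtain u' where u': "u' \<in> KK.R" "c = a ^ h * u'" by blast
  \<comment> \<open>\<open>a ^ h\<close> and \<open>c\<close> generate the same ideal of
    \<open>K\<close>, so they differ by a unit, whose relative norm is a unit of
    \<open>k\<close>.\<close>
  have uu: "u * u' = 1"
  proof -
    have "c * (u * u') = c * u * u'" by (simp only: mult.assoc)
    also have "\<dots> = c * 1" by (simp only: u(2)[symmetric] u'(2)[symmetric] mult_1_right)
    finally have "c * (u * u') = c * 1" .
    then show ?thesis using c(2) by (simp only: mult_cancel_left) simp
  qed
  have QZs: "a \<in> QZ" "c \<in> QZ" "u \<in> QZ" "u' \<in> QZ" using a c u u' K_QZ k_QZ KK.R_F by blast+
  have Nu: "norm_K u \<in> kk.R" "norm_K u' \<in> kk.R" using u u' norm_in_kR by blast+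
  have Nuu: "norm_K u * norm_K u' = 1" using norm_mult[OF QZs(3,4)] uu norm_1 by simp
  have Na: "norm_K a \<in> k" "norm_K a \<noteq> 0" using norm_in_k[OF a(1)] norm_nz[OF QZs(1) a(2)] by blast+
  have Nah: "norm_K a ^ h = c ^ d * norm_K u"
  proof -
    have "norm_K a ^ h = norm_K (a ^ h)" by (rule norm_power[OF QZs(1), symmetric])
    also have "\<dots> = norm_K c * norm_K u" unfolding u(2) by (rule norm_mult[OF QZs(2,3)])
    finally show ?thesis using norm_k[OF c(1)] by (simp add: d_def)
  qed
  have "h > 0" using cn by (simp add: h_def)
  \<comment> \<open>Bezout with \<open>d * x\<close> on the larger side requires nonzero
    \<open>d\<close>. For \<open>d = 0\<close> coprimality gives \<open>h = 1\<close>, and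
    \<open>Q0\<close> itself would be principal.\<close>
  have "d \<noteq> 0"
  proof
    assume "d = 0"
    then have "h = 1" using cop by (simp add: d_def h_def)
    then have "kk.principal (kk.ideal_power Q0 (Suc 0))"
      using \<open>kk.principal (kk.ideal_power Q0 h)\<close> by simp
    then show False using Q0_not_principal kk.set_prod_R[OF f0] by (simp add: kk.ideal_power_Suc kk.ideal_power_0)
  qed
  then obtain x y where xy: "d * x = h * y + 1"
    using bezout_nat[of d h] cop by (auto simp: d_def h_def coprime_iff_gcd_eq_1)
  define b where "b = norm_K a ^ x / c ^ y"
  have b: "b \<in> k" "b \<noteq> 0" unfolding b_def using Na c kk.F_power kk.F_divide by auto
  have "b ^ h = c * norm_K u ^ x"
  proof -
    have "(norm_K a ^ x) ^ h = (norm_K a ^ h) ^ x" by (simp add: power_mult[symmetric] mult.commute)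
    also have "\<dots> = c ^ (d * x) * norm_K u ^ x" unfolding Nah by (simp add: power_mult_distrib power_mult)
    also have "c ^ (d * x) = (c ^ y) ^ h * c" unfolding xy by (simp add: power_mult[symmetric] mult.commute)
    finally show ?thesis unfolding b_def using c(2) by (simp add: power_divide field_simps)
  qed
  moreover have "scale (c * norm_K u ^ x) kk.R = scale c kk.R"
  proof -
    have "scale (norm_K u ^ x) kk.R = kk.R"
    proof (intro subset_antisym subsetI)
      fix r assume r: "r \<in> kk.R"
      have "r = norm_K u ^ x * (norm_K u' ^ x * r)"
        using Nuu by (simp add: mult.assoc[symmetric] power_mult_distrib[symmetric])
      then show "r \<in> scale (norm_K u ^ x) kk.R"
        using kk.R_mult[OF kk.R_power[OF Nu(2)] r] by blast
    qed (use Nu in \<open>auto intro: kk.R_mult kk.R_power\<close>)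
    then show ?thesis by (metis scale_scale)
  qed
  ultimately have "kk.ideal_power Q0 h = scale (b ^ h) kk.R" using c(3) by simp
  from kk.principal_if_power_principal[OF f0 b \<open>h > 0\<close> this] show False
    using Q0_not_principal b unfolding kk.principal_def by blast
qed

text \<open>Write \<open>\<theta> j = z ^ j + cnj z ^ j\<close>. If every class modulo
  \<open>P\<close> contained an integer, \<open>\<theta> 1 ^ q\<close> would be congruent to
  \<open>\<theta> 1\<close> by Fermat and to \<open>\<theta> q\<close> by Frobenius. But
  \<open>z ^ q * (\<theta> q - \<theta> 1)\<close> equals
  \<open>(1 - z ^ (q + 1)) * (1 - z ^ (q - 1))\<close>, a divisor of \<open>n ^ 2\<close>, so
  \<open>n ^ 2\<close> would lie in \<open>P\<close> and \<open>q\<close> would divide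
  \<open>n\<close>.\<close>

lemma not_all_integral_mod_prime:
  assumes P: "KK.is_prime P" and qP: "of_nat q \<in> P"
  shows "\<exists>x\<in>KK.R. \<forall>i::int. x - of_int i \<notin> P"
proof (rule ccontr)
  assume "\<not> ?thesis"
  then have all: "\<And>x. x \<in> KK.R \<Longrightarrow> \<exists>i::int. x - of_int i \<in> P" by blast
  note f = KK.ideal_frac[OF KK.prime_ideal_proper(1)[OF P]]
  have zc: "z * cnj z = 1" by (simp add: cnj_z)
  have cA: "algebraic_int (cnj z)" using z_AI by simp
  have cQ: "cnj z \<in> QZ" unfolding cnj_z by (intro QZ_inverse QZ_z)
  define \<theta> where "\<theta> j = z ^ j + cnj z ^ j" for j :: nat
  have \<theta>R: "\<theta> j \<in> KK.R" for j
  proof -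
    have "cnj (\<theta> j) = \<theta> j" by (simp add: \<theta>_def)
    then have "\<theta> j \<in> \<real>" by (simp only: Reals_cnj_iff)
    moreover have "\<theta> j \<in> QZ" unfolding \<theta>_def by (intro QZ_add QZ_power QZ_z cQ)
    ultimately have "\<theta> j \<in> K" by (simp add: K_eq)
    moreover have "algebraic_int (\<theta> j)"
      unfolding \<theta>_def by (intro algebraic_int_add algebraic_int_power z_AI cA)
    ultimately show ?thesis by (simp add: KK.R_def)
  qed
  obtain i :: int where i: "\<theta> 1 - of_int i \<in> P" using all[OF \<theta>R] by blast
  have pw: "\<theta> 1 ^ j - of_int i ^ j \<in> P" for j
  proof (induction j)
    case (Suc j)
    have "\<theta> 1 * (\<theta> 1 ^ j - of_int i ^ j) + of_int i ^ j * (\<theta> 1 - of_int i) \<in> P"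
      by (intro KK.frac_add[OF f] KK.frac_mult[OF f] Suc i \<theta>R KK.R_power KK.R_of_int)
    then show ?case by (simp add: algebra_simps)
  qed (use KK.frac_0[OF f] in simp)
  have "of_int (i ^ q - i) \<in> P" using KK.int_in_prime_iff[OF P q qP] fermat_int[OF q] by blast
  then have "\<theta> 1 ^ q - of_int i ^ q + of_int (i ^ q - i) - (\<theta> 1 - of_int i) \<in> P"
    by (intro KK.frac_diff[OF f] KK.frac_add[OF f] pw i)
  then have t1: "\<theta> 1 ^ q - \<theta> 1 \<in> P" by simp
  have "ai_cong q (\<theta> 1 ^ q) (\<theta> q)"
    unfolding \<theta>_def using ai_cong_frobenius_add[OF q z_AI cA] by simp
  then have "algebraic_int ((\<theta> 1 ^ q - \<theta> q) / of_nat q)" by (simp add: ai_cong_def)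
  moreover have "(\<theta> 1 ^ q - \<theta> q) / of_nat q \<in> K"
    by (intro KK.F_divide KK.F_diff KK.F_power KK.F_of_nat KK.R_F \<theta>R)
  ultimately have "(\<theta> 1 ^ q - \<theta> q) / of_nat q \<in> KK.R" by (simp add: KK.R_def)
  from KK.frac_mult[OF f this qP] have t2: "\<theta> 1 ^ q - \<theta> q \<in> P" using q_pos by simp
  have t3: "\<theta> q - \<theta> 1 \<in> P" using KK.frac_diff[OF f t1 t2] by simp
  define \<alpha> where "\<alpha> = \<theta> q - \<theta> 1"
  have q1: "q > 1" using prime_gt_1_nat[OF q] .
  have fac: "z ^ q * \<alpha> = (1 - z ^ (q + 1)) * (1 - z ^ (q - 1))"
  proof -
    have a: "z ^ q * cnj z ^ q = 1" using zc by (simp add: power_mult_distrib[symmetric])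
    have b: "z ^ q * cnj z = z ^ (q - 1)"
      using zc q1 by (simp add: power_eq_if mult.assoc)
    have e: "(q + 1) + (q - 1) = q + q" using q1 by simp
    have "z ^ q * \<alpha> = z ^ (q + q) + z ^ q * cnj z ^ q - z ^ (q + 1) - z ^ q * cnj z"
      by (simp add: \<alpha>_def \<theta>_def algebra_simps power_add)
    also have "\<dots> = z ^ ((q + 1) + (q - 1)) + 1 - z ^ (q + 1) - z ^ (q - 1)" unfolding a b e ..
    also have "\<dots> = (1 - z ^ (q + 1)) * (1 - z ^ (q - 1))"
      unfolding power_add[of z "q + 1"] by (simp add: algebra_simps)
    finally show ?thesis .
  qed
  have nd: "\<not> n dvd q + 1" "\<not> n dvd q - 1" using n_large(2) q1 by (auto dest!: dvd_imp_le)
  then have nz: "1 - z ^ (q + 1) \<noteq> 0" "1 - z ^ (q - 1) \<noteq> 0"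
    using z_eq_1_iff[of "q + 1"] z_eq_1_iff[of "q - 1"] by auto
  then have \<alpha>0: "\<alpha> \<noteq> 0" using fac by auto
  have quot: "of_nat n ^ 2 / \<alpha> = z ^ q * ((of_nat n / (1 - z ^ (q + 1))) * (of_nat n / (1 - z ^ (q - 1))))"
  proof -
    have e: "Z * (N / A * (N / B)) = Z * N ^ 2 / (A * B)" for Z N A B :: complex
      by (simp add: power2_eq_square)
    show ?thesis unfolding e fac[symmetric] by simp
  qed
  have "algebraic_int (of_nat n ^ 2 / \<alpha>)"
    unfolding quot by (intro algebraic_int_mult algebraic_int_power z_AI one_minus_z_dvd nd)
  moreover have "of_nat n ^ 2 / \<alpha> \<in> K"
    unfolding \<alpha>_def by (intro KK.F_divide KK.F_diff KK.F_power KK.F_of_nat KK.R_F \<theta>R)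
  ultimately have "of_nat n ^ 2 / \<alpha> \<in> KK.R" by (simp add: KK.R_def)
  from KK.frac_mult[OF f this t3] have "of_nat n ^ 2 \<in> P" using \<alpha>0 by (simp add: \<alpha>_def)
  then have "of_int (int (n ^ 2)) \<in> P" by simp
  then have "int q dvd int (n ^ 2)" using KK.int_in_prime_iff[OF P q qP] by blast
  then have "q dvd n ^ 2" by (simp only: int_dvd_int_iff)
  then show False using q q_not_dvd_n prime_dvd_power by blast
qed

text \<open>Let \<open>J\<close> be the inverse of \<open>P\<close>. If \<open>q\<close> were in
  \<open>P \<star> P\<close>, then for \<open>j\<close> in \<open>J\<close> both
  \<open>of_nat q * j\<close> and its square divided by \<open>q\<close> would be integral, so
  \<open>j\<close> would be integral by \<open>reduced_mod_prime\<close>. Then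
  \<open>P \<star> J\<close>, which is the whole ring, would be contained in
  \<open>P\<close>.\<close>

lemma q_not_in_square:
  assumes cn: "class_number K \<noteq> 0" and P: "KK.is_prime P" and qP: "of_nat q \<in> P"
  shows "of_nat q \<notin> P \<star> P"
proof
  assume q2: "of_nat q \<in> P \<star> P"
  note I = KK.prime_ideal_proper(1)[OF P]
  note f = KK.ideal_frac[OF I]
  obtain J where J: "KK.is_frac J" "P \<star> J = KK.R" using KK.frac_invertible[OF cn f] .
  have "j \<in> KK.R" if j: "j \<in> J" for j
  proof -
    have "of_nat q * j \<in> (P \<star> P) \<star> J" by (rule set_prod_prod[OF q2 j])
    also have "(P \<star> P) \<star> J = P" by (simp only: set_prod_assoc J(2) KK.set_prod_R[OF f])
    finally have qj: "of_nat q * j \<in> P" .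
    have "of_nat q * j * j \<in> KK.R" using set_prod_prod[OF qj j] J(2) by simp
    then have "algebraic_int ((of_nat q * j) ^ 2 / of_nat q)"
      using KK.R_AI q_pos by (simp add: power2_eq_square mult_ac)
    moreover have "of_nat q * j \<in> QZ" "algebraic_int (of_nat q * j)"
      using KK.ideal_R[OF I qj] KK.R_F K_QZ KK.R_AI by blast+
    ultimately have "algebraic_int ((of_nat q * j) / of_nat q)"
      using reduced_mod_prime[OF _ _ q q_not_dvd_n] by blast
    then show ?thesis using KK.frac_F[OF J(1) j] q_pos by (simp add: KK.R_def)
  qed
  then have "P \<star> J \<subseteq> P \<star> KK.R" by (intro set_prod_mono) auto
  then have "KK.R \<subseteq> P" unfolding J(2) KK.set_prod_R[OF f] .
  then show False using KK.R_1 KK.prime_ideal_proper(2)[OF P] by blast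
qed

text \<open>The powers 2^0, ..., 2^7 are totatives, \<open>n\<close> being odd. The bound makes
  \<open>totient n div 4\<close> at least 2.\<close>

lemma totient_ge_8: "totient n \<ge> 8"
proof -
  have "inj_on (\<lambda>i. 2 ^ i :: nat) {..<8}" by (auto simp: inj_on_def)
  then have "card ((\<lambda>i. 2 ^ i :: nat) ` {..<8}) = 8" by (simp add: card_image)
  moreover have "(\<lambda>i. 2 ^ i :: nat) ` {..<8} \<subseteq> totatives n"
  proof safe
    fix i :: nat assume "i < 8"
    then have "(2::nat) ^ i \<le> 2 ^ 7" by (intro power_increasing) auto
    then have "2 ^ i \<le> n" using n_large(1) by simp
    moreover have "coprime (2 ^ i) n" using n_odd by simp
    ultimately show "2 ^ i \<in> totatives n" by (simp add: in_totatives_iff)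
  qed
  ultimately show ?thesis unfolding totient_def by (metis card_mono finite_totatives)
qed

lemma residue_degrees_nontrivial:
  assumes prK: "Factorial_Ring.prime (class_number K)"
    and cop: "coprime (totient n div 4) (class_number k)"
  shows "generating_residue_degrees K \<rat> \<noteq> {1}"
proof -
  have cnK: "class_number K \<noteq> 0" using prK by auto
  \<comment> \<open>The value 0 would stand for an infinite class group; coprimality with 0 leaves
    only \<open>totient n div 4 = 1\<close>.\<close>
  have cnk: "class_number k \<noteq> 0"
  proof
    assume "class_number k = 0"
    then have "totient n div 4 = 1" using cop by simp
    then show False using totient_ge_8 by simp
  qed
  interpret Kf: finite_class_number K by unfold_locales (rule cnK)
  have qR: "of_nat q \<in> KK.R" "of_nat q \<noteq> (0::complex)" using KK.R_of_nat q_pos by auto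
  \<comment> \<open>\<open>q\<close> lies in the non-principal ideal \<open>QK\<close>, so the
    primes containing \<open>q\<close> cannot all be principal.\<close>
  obtain P where P: "KK.is_prime P" "of_nat q \<in> P" "\<not> KK.principal P"
    using KK.principal_if_primes_principal[OF qR _ QK_ideal q_QK] QK_not_principal[OF cnk cop]
    unfolding KK.principal_def by blast
  define f where "f = residue_degree K \<rat> P"
  have f1: "f \<ge> 1" unfolding f_def by (rule KK.residue_degree_pos_and_one(1)[OF P(1) q P(2)])
  have fn1: "f \<noteq> 1"
    using not_all_integral_mod_prime[OF P(1,2)] KK.residue_degree_pos_and_one(2)[OF P(1) q P(2)]
    unfolding f_def by blast
  have ur: "unramified K \<rat> P"
    by (rule Kf.unramified_if_not_in_square[OF P(1) q P(2) q_not_in_square[OF cnK P(1,2)]])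
  let ?S = "ideal_class K ` {P \<in> prime_ideals K. unramified K \<rat> P \<and> residue_degree K \<rat> P = f}"
  have "generate (class_group K) ?S = carrier (class_group K)"
  proof (rule Kf.generate_class_group[OF prK])
    show "KK.is_frac P" by (rule KK.ideal_frac[OF KK.prime_ideal_proper(1)[OF P(1)]])
    show "?S \<subseteq> carrier (class_group K)"
      using Kf.ideal_class_in_carrier KK.ideal_frac KK.prime_ideal_proper(1)
      by (auto simp: KK.prime_ideals_eq)
    show "ideal_class K P \<in> ?S" using P(1) ur by (auto simp: KK.prime_ideals_eq f_def)
  qed (rule P(3))
  then have "f \<in> generating_residue_degrees K \<rat>" using f1 by (simp add: generating_residue_degrees_def)
  then show ?thesis using fn1 by blast
qed

end

theorem theorem1p4:
  fixes q m n :: nat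
  assumes "Factorial_Ring.prime q" and "odd q"
    and "m > 1"
    and "n = (2 * m * q)\<^sup>2 + 1"
    and "squarefree n"
    and "Factorial_Ring.prime (class_number (max_real_cyclotomic_field n))"
    and "coprime (totient n div 4) (class_number (real_quadratic_field n))"
  shows "generating_residue_degrees (max_real_cyclotomic_field n) \<rat> \<noteq> {1}"
proof -
  have q0: "q > 0" using assms(1) prime_gt_0_nat by blast
  have n1: "n > 1" using assms(3,4) q0 by simp
  have "chowla_field n q m"
  proof
    show "n mod 4 = 1" unfolding assms(4) by (simp add: power2_eq_square mod_Suc)
    show "a\<^sup>2 \<noteq> n" for a :: nat
    proof
      assume "a\<^sup>2 = n"
      then have "a\<^sup>2 dvd n" by simp
      then have "a dvd 1" by (rule squarefreeD[OF assms(5)])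
      then show False using \<open>a\<^sup>2 = n\<close> n1 by simp
    qed
  qed (use assms n1 in auto)
  then show ?thesis using assms(6,7) by (rule chowla_field.residue_degrees_nontrivial)
qed

end
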